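(* Let $A\in\mathbb{R}^{n\times n}$, $B\in\mathbb{R}^{n\times m}$, $C\in\mathbb{R}^{p\times n}$ with $(A,B)$ stabilizable and $(A,C)$ detectable (in the discrete-time sense), and assume all eigenvalues of $A$ lie in the closed unit disc. Consider identical agents $x_i(k+1)=Ax_i(k)+Bu_i(k)$, $y_i(k)=Cx_i(k)$ with the network measurements $\bar\zeta_i$ defined in the context. Let a nonempty node set $\mathscr{C}$ be given, which defines the graph sets $\mathbb{G}_{\mathscr{C}}^N$, and let $y_r\in\mathbb{R}^p$ be a constant reference. Define $$\mathscr{Y}_r=\{y\in\mathbb{R}^p \mid \exists x\in\mathbb{R}^n,\ u\in\mathbb{R}^m:\ Ax+Bu=x,\ Cx=y\}.$$ Then the scalable state synchronization problem (defined in the context) is solvable if and only if $y_r\in\mathscr{Y}_r$. More specifically, for every $y_r\in\mathscr{Y}_r$ the following protocol achieves $\lim_{k\to\infty}(y_i(k)-y_r)=0$ for all $i$ and $\lim_{k\to\infty}(x_i(k)-x_j(k))=0$ for all $i,j$, for every network size $N$, every graph $\mathscr{G}\in\mathbb{G}_{\mathscr{C}}^N$ and all communication delays $\kappa_{ij}\in\mathbb{Z}_{\ge 0}$. Construction of the protocol. Let $R$ be an injective matrix with $\operatorname{Im}R=\mathscr{Y}_r$, and choose $\Pi,\Gamma$ such that $$\begin{pmatrix}A-I&B\\C&0\end{pmatrix}\begin{pmatrix}\Pi\\\Gamma\end{pmatrix}=\begin{pmatrix}0\\R\end{pmatrix},\qquad \operatorname{rank}\begin{pmatrix}A-I&B\Gamma\\C&0\end{pmatrix}=n+\operatorname{rank}\Gamma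 .$$ Set $\nu=\operatorname{rank}\Gamma$. Choose $\Gamma_1\in\mathbb{R}^{m\times\nu}$ injective with $\operatorname{Im}\Gamma_1=\operatorname{Im}\Gamma$, and $\Gamma_2$ such that $\begin{pmatrix}\Gamma_1&\Gamma_2\end{pmatrix}$ is square and invertible. Put $$\bar A=\begin{pmatrix}A&B\Gamma_1\\0&I\end{pmatrix},\quad \bar B=\begin{pmatrix}B\Gamma_2&0\\0&I\end{pmatrix},\quad \bar C=\begin{pmatrix}C&0\end{pmatrix},$$ and choose $K,F$ such that $\bar A-\bar BK$ and $\bar A-F\bar C$ are Schur stable. Each agent $i$ uses the precompensator $$p_i(k+1)=p_i(k)+\begin{pmatrix}0&I\end{pmatrix}v_i(k),\qquad u_i(k)=\Gamma_1p_i(k)+\begin{pmatrix}\Gamma_2&0\end{pmatrix}v_i(k),\qquad p_i(k)\in\mathbb{R}^{\nu},$$ together with $$\hat x_i(k+1)=\bar A\hat x_i(k)-\bar BK\hat\zeta_i(k)+F(\bar\zeta_i(k)-\bar C\hat x_i(k)),$$ $$\chi_i(k+1)=\bar A\chi_i(k)+\bar Bv_i(k)+\bar A\hat x_i(k)-\bar A\hat\zeta_i(k),\qquad v_i(k)=-K\chi_i(k),$$ where the exchanged variable is $\xi_i(k)=\chi_i(k)$, i.e. $\hat\zeta_i(k)=\frac{1}{2+d_{in}(i)}\sum_{j=1}^N\bar\ell_{ij}\chi_j(k-\kappa_{ij})$.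
   Context: Agents and graph. There are $N$ agents $i\in\{1,\dots,N\}$ with $x_i(k)\in\mathbb{R}^n$, $u_i(k)\in\mathbb{R}^m$, $y_i(k)\in\mathbb{R}^p$, $k\in\mathbb{Z}_{\ge0}$. The communication network is a weighted directed graph on nodes $\{1,\dots,N\}$ with adjacency weights $a_{ij}\ge 0$, $a_{ii}=0$; $a_{ij}>0$ means there is an edge from $j$ to $i$. The Laplacian $L=[\ell_{ij}]$ has $\ell_{ii}=\sum_{k}a_{ik}$ and $\ell_{ij}=-a_{ij}$ for $i\ne j$. The in-degree is $d_{in}(i)=\sum_{j=1}^N a_{ij}$. Root set. $\mathscr{C}\subseteq\{1,\dots,N\}$ is a nonempty set of agents that can measure their output relative to the constant reference $y_r\in\mathbb{R}^p$; $\iota_i=1$ if $i\in\mathscr{C}$ and $\iota_i=0$ otherwise. The expanded Laplacian is $\bar L=L+\operatorname{diag}\{\iota_i\}=[\bar\ell_{ij}]$. $\mathbb{G}_{\mathscr{C}}^N$ is the set of all directed weighted graphs with $N$ nodes (containing the node set $\mathscr{C}$) such that every node is a member of a directed tree (a subgraph in which every node has exactly one parent, except the root, which has none) whose root lies in $\mathscr{C}$. A directed spanning tree need not exist. Measurements. $\kappa_{ij}\in\mathbb{Z}_{\ge0}$ is an unknown constant communication delay from agent $j$ to agent $i$, with $\kappa_{ii}=0$. Agent $i$ receives $$\bar\zeta_i(k)=\frac{1}{2+d_{in}(i)}\sum_{j=1}^N\bar\ell_{ij}\,(y_j(k-\kappa_{ij})-y_r),\qquad \hat\zeta_i(k)=\frac{1}{2+d_{in}(i)}\sum_{j=1}^N\bar\ell_{ij}\,\xi_j(k-\kappa_{ij}),$$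 where $\xi_j$ is a variable produced internally by agent $j$, transmitted with the same delays as $y_j$. Scalable state synchronization problem (for given $(A,B,C)$, $y_r$ and $\mathscr{C}$). Find a linear dynamic protocol, with matrices $A_c,B_{c1},B_{c2},F_c,H_c$ the same for all agents and chosen using only knowledge of $(A,B,C)$ (not of $N$, the graph or the delays), of the form $$x_{c,i}(k+1)=A_cx_{c,i}(k)+B_{c1}\bar\zeta_i(k)+B_{c2}\hat\zeta_i(k),\qquad u_i(k)=F_cx_{c,i}(k),\qquad \xi_i(k)=H_cx_{c,i}(k),$$ such that for any $N$, any graph $\mathscr{G}\in\mathbb{G}_{\mathscr{C}}^N$ and any delays $\kappa_{ij}\in\mathbb{Z}_{\ge0}$: (i) $\lim_{k\to\infty}(y_i(k)-y_r)=0$ for all $i$; (ii) $\lim_{k\to\infty}(x_i(k)-x_j(k))=0$ for all $i,j$. Convergence is understood for all initial conditions (including the initial history of the delayed signals). The problem is solvable if such a protocol exists. A square matrix is Schur stable if all its eigenvalues lie strictly inside the unit circle. *)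

theory Defs
  imports Complex_Main "Jordan_Normal_Form.Matrix" "Jordan_Normal_Form.Char_Poly"
    "Jordan_Normal_Form.DL_Rank"
begin

section \<open>Matrices\<close>

definition append_cols :: "'a :: zero mat \<Rightarrow> 'a mat \<Rightarrow> 'a mat" (infixr "@\<^sub>c" 65) where
  "append_cols M M' = four_block_mat M M' (0\<^sub>m 0 (dim_col M)) (0\<^sub>m 0 (dim_col M'))"

definition mat_image :: "real mat \<Rightarrow> real vec set" where
  "mat_image M = (\<lambda>v. M *\<^sub>v v) ` carrier_vec (dim_col M)"

definition injective_mat :: "real mat \<Rightarrow> bool" where
  "injective_mat M \<longleftrightarrow> inj_on (\<lambda>v. M *\<^sub>v v) (carrier_vec (dim_col M))"

text \<open>The eigenvalues of a real matrix are its complex ones. The spectral radius is avoided because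
  it is unspecified for the matrix of size 0, which is possible here.\<close>

definition schur_stable :: "real mat \<Rightarrow> bool" where
  "schur_stable M \<longleftrightarrow> (\<forall>z. eigenvalue (map_mat complex_of_real M) z \<longrightarrow> cmod z < 1)"

definition eigenvalues_in_closed_disc :: "real mat \<Rightarrow> bool" where
  "eigenvalues_in_closed_disc M \<longleftrightarrow>
    (\<forall>z. eigenvalue (map_mat complex_of_real M) z \<longrightarrow> cmod z \<le> 1)"

text \<open>Both notions are the discrete-time ones, for an \<open>n \<times> n\<close> matrix \<open>A\<close>.\<close>

definition stabilizable :: "nat \<Rightarrow> nat \<Rightarrow> real mat \<Rightarrow> real mat \<Rightarrow> bool" where
  "stabilizable n m A B \<longleftrightarrow> (\<exists>K \<in> carrier_mat m n. schur_stable (A - B * K))"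

definition detectable :: "nat \<Rightarrow> nat \<Rightarrow> real mat \<Rightarrow> real mat \<Rightarrow> bool" where
  "detectable n p A C \<longleftrightarrow> (\<exists>F \<in> carrier_mat n p. schur_stable (A - F * C))"


section \<open>Communication network\<close>

text \<open>Agents are \<open>1, \<dots>, N\<close>; \<open>a i j > 0\<close> means that there is an edge from \<open>j\<close> to \<open>i\<close>.
  Edges are pairs \<open>(j, i)\<close> of parent and child.\<close>

definition weighted_digraph :: "nat \<Rightarrow> (nat \<Rightarrow> nat \<Rightarrow> real) \<Rightarrow> bool" where
  "weighted_digraph N a \<longleftrightarrow> (\<forall>i\<in>{1..N}. a i i = 0 \<and> (\<forall>j\<in>{1..N}. 0 \<le> a i j))"

definition edges :: "nat \<Rightarrow> (nat \<Rightarrow> nat \<Rightarrow> real) \<Rightarrow> (nat \<times> nat) set" where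
  "edges N a = {(j, i). j \<in> {1..N} \<and> i \<in> {1..N} \<and> 0 < a i j}"

text \<open>The last conjunct is connectedness: without it, the disjoint union of a root and a directed
  cycle would count as a tree.\<close>

definition directed_tree :: "nat set \<Rightarrow> (nat \<times> nat) set \<Rightarrow> nat \<Rightarrow> bool" where
  "directed_tree V E r \<longleftrightarrow> r \<in> V \<and> E \<subseteq> V \<times> V \<and>
    (\<forall>j. (j, r) \<notin> E) \<and> (\<forall>v \<in> V - {r}. \<exists>!j. (j, v) \<in> E) \<and> (\<forall>v \<in> V. (r, v) \<in> E\<^sup>*)"

definition graph_set :: "nat set \<Rightarrow> nat \<Rightarrow> (nat \<Rightarrow> nat \<Rightarrow> real) set" where
  "graph_set \<C> N = {a. weighted_digraph N a \<and> \<C> \<subseteq> {1..N} \<and>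
    (\<forall>i\<in>{1..N}. \<exists>V E r. V \<subseteq> {1..N} \<and> E \<subseteq> edges N a \<and> directed_tree V E r \<and> r \<in> \<C> \<and> i \<in> V)}"

definition in_degree :: "nat \<Rightarrow> (nat \<Rightarrow> nat \<Rightarrow> real) \<Rightarrow> nat \<Rightarrow> real" where
  "in_degree N a i = (\<Sum>j=1..N. a i j)"

definition laplacian :: "nat \<Rightarrow> (nat \<Rightarrow> nat \<Rightarrow> real) \<Rightarrow> nat \<Rightarrow> nat \<Rightarrow> real" where
  "laplacian N a i j = (if i = j then \<Sum>k=1..N. a i k else - a i j)"

definition expanded_laplacian ::
  "nat \<Rightarrow> (nat \<Rightarrow> nat \<Rightarrow> real) \<Rightarrow> nat set \<Rightarrow> nat \<Rightarrow> nat \<Rightarrow> real" where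
  "expanded_laplacian N a \<C> i j = laplacian N a i j + (if i = j \<and> i \<in> \<C> then 1 else 0)"

definition delays :: "nat \<Rightarrow> (nat \<Rightarrow> nat \<Rightarrow> nat) \<Rightarrow> bool" where
  "delays N \<kappa> \<longleftrightarrow> (\<forall>i\<in>{1..N}. \<kappa> i i = 0)"

text \<open>The signals that are transmitted with delay have integer time; their values at negative times
  are the initial history and are not constrained by the dynamics below. All other signals have
  time in the natural numbers.

  The following is the value at agent \<open>i\<close> and time \<open>k\<close> of the measurement of a delayed
  \<open>d\<close>-dimensional signal \<open>s\<close> through the network.\<close>

definition network_measurement ::
  "nat \<Rightarrow> nat \<Rightarrow> (nat \<Rightarrow> nat \<Rightarrow> real) \<Rightarrow> nat set \<Rightarrow> (nat \<Rightarrow> nat \<Rightarrow> nat) \<Rightarrow>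
   (nat \<Rightarrow> int \<Rightarrow> real vec) \<Rightarrow> nat \<Rightarrow> nat \<Rightarrow> real vec" where
  "network_measurement d N a \<C> \<kappa> s i k = vec d (\<lambda>l. 1 / (2 + in_degree N a i) *
    (\<Sum>j=1..N. expanded_laplacian N a \<C> i j * (s j (int k - int (\<kappa> i j)) $ l)))"


section \<open>Agents and scalable state synchronization\<close>

definition agents ::
  "nat \<Rightarrow> nat \<Rightarrow> nat \<Rightarrow> real mat \<Rightarrow> real mat \<Rightarrow> real mat \<Rightarrow> nat \<Rightarrow> (nat \<Rightarrow> nat \<Rightarrow> real vec) \<Rightarrow>
   (nat \<Rightarrow> nat \<Rightarrow> real vec) \<Rightarrow> (nat \<Rightarrow> int \<Rightarrow> real vec) \<Rightarrow> bool" where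
  "agents n m p A B C N x u y \<longleftrightarrow> (\<forall>i\<in>{1..N}.
    (\<forall>k. x i k \<in> carrier_vec n \<and> u i k \<in> carrier_vec m) \<and> (\<forall>t. y i t \<in> carrier_vec p) \<and>
    (\<forall>k. x i (Suc k) = A *\<^sub>v x i k + B *\<^sub>v u i k \<and> y i (int k) = C *\<^sub>v x i k))"

definition tendsto_zero_vec :: "nat \<Rightarrow> (nat \<Rightarrow> real vec) \<Rightarrow> bool" where
  "tendsto_zero_vec d w \<longleftrightarrow> (\<forall>l<d. (\<lambda>k. w k $ l) \<longlonglongrightarrow> 0)"

definition synchronized ::
  "nat \<Rightarrow> nat \<Rightarrow> nat \<Rightarrow> real vec \<Rightarrow> (nat \<Rightarrow> nat \<Rightarrow> real vec) \<Rightarrow> (nat \<Rightarrow> int \<Rightarrow> real vec) \<Rightarrow> bool"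
where
  "synchronized n p N y\<^sub>r x y \<longleftrightarrow>
    (\<forall>i\<in>{1..N}. tendsto_zero_vec p (\<lambda>k. y i (int k) - y\<^sub>r)) \<and>
    (\<forall>i\<in>{1..N}. \<forall>j\<in>{1..N}. tendsto_zero_vec n (\<lambda>k. x i k - x j k))"

text \<open>A linear dynamic protocol with state dimension \<open>c\<close> and exchanged variable \<open>\<xi>\<close> of
  dimension \<open>q\<close>.\<close>

definition linear_protocol ::
  "nat \<Rightarrow> nat \<Rightarrow> nat \<Rightarrow> real mat \<Rightarrow> real mat \<Rightarrow> real mat \<Rightarrow> real mat \<Rightarrow> real mat \<Rightarrow>
   nat \<Rightarrow> (nat \<Rightarrow> nat \<Rightarrow> real) \<Rightarrow> nat set \<Rightarrow> (nat \<Rightarrow> nat \<Rightarrow> nat) \<Rightarrow> real vec \<Rightarrow>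
   (nat \<Rightarrow> nat \<Rightarrow> real vec) \<Rightarrow> (nat \<Rightarrow> int \<Rightarrow> real vec) \<Rightarrow>
   (nat \<Rightarrow> nat \<Rightarrow> real vec) \<Rightarrow> (nat \<Rightarrow> int \<Rightarrow> real vec) \<Rightarrow> bool" where
  "linear_protocol p c q A\<^sub>c B\<^sub>c\<^sub>1 B\<^sub>c\<^sub>2 F\<^sub>c H\<^sub>c N a \<C> \<kappa> y\<^sub>r u y x\<^sub>c \<xi> \<longleftrightarrow> (\<forall>i\<in>{1..N}.
    (\<forall>k. x\<^sub>c i k \<in> carrier_vec c) \<and> (\<forall>t. \<xi> i t \<in> carrier_vec q) \<and>
    (\<forall>k. let \<zeta>' = network_measurement p N a \<C> \<kappa> (\<lambda>j t. y j t - y\<^sub>r) i k;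
             \<zeta>'' = network_measurement q N a \<C> \<kappa> \<xi> i k
         in x\<^sub>c i (Suc k) = A\<^sub>c *\<^sub>v x\<^sub>c i k + B\<^sub>c\<^sub>1 *\<^sub>v \<zeta>' + B\<^sub>c\<^sub>2 *\<^sub>v \<zeta>'' \<and>
            u i k = F\<^sub>c *\<^sub>v x\<^sub>c i k \<and>
            \<xi> i (int k) = H\<^sub>c *\<^sub>v x\<^sub>c i k))"

text \<open>The protocol matrices are chosen before the network size, the graph and the delays.\<close>

definition scalable_sync_solvable ::
  "nat \<Rightarrow> nat \<Rightarrow> nat \<Rightarrow> real mat \<Rightarrow> real mat \<Rightarrow> real mat \<Rightarrow> real vec \<Rightarrow> nat set \<Rightarrow> bool" where
  "scalable_sync_solvable n m p A B C y\<^sub>r \<C> \<longleftrightarrow>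
    (\<exists>c q A\<^sub>c B\<^sub>c\<^sub>1 B\<^sub>c\<^sub>2 F\<^sub>c H\<^sub>c.
      A\<^sub>c \<in> carrier_mat c c \<and> B\<^sub>c\<^sub>1 \<in> carrier_mat c p \<and> B\<^sub>c\<^sub>2 \<in> carrier_mat c q \<and>
      F\<^sub>c \<in> carrier_mat m c \<and> H\<^sub>c \<in> carrier_mat q c \<and>
      (\<forall>N. \<forall>a \<in> graph_set \<C> N. \<forall>\<kappa>. delays N \<kappa> \<longrightarrow>
        (\<forall>x u y x\<^sub>c \<xi>. agents n m p A B C N x u y \<and>
          linear_protocol p c q A\<^sub>c B\<^sub>c\<^sub>1 B\<^sub>c\<^sub>2 F\<^sub>c H\<^sub>c N a \<C> \<kappa> y\<^sub>r u y x\<^sub>c \<xi> \<longrightarrow>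
          synchronized n p N y\<^sub>r x y)))"

definition regulable_outputs ::
  "nat \<Rightarrow> nat \<Rightarrow> nat \<Rightarrow> real mat \<Rightarrow> real mat \<Rightarrow> real mat \<Rightarrow> real vec set" where
  "regulable_outputs n m p A B C = {y \<in> carrier_vec p.
    \<exists>x \<in> carrier_vec n. \<exists>u \<in> carrier_vec m. A *\<^sub>v x + B *\<^sub>v u = x \<and> C *\<^sub>v x = y}"


section \<open>Construction of the protocol\<close>

definition design_R ::
  "nat \<Rightarrow> nat \<Rightarrow> nat \<Rightarrow> real mat \<Rightarrow> real mat \<Rightarrow> real mat \<Rightarrow> real mat \<Rightarrow> bool" where
  "design_R n m p A B C R \<longleftrightarrow> R \<in> carrier_mat p (dim_col R) \<and> injective_mat R \<and>
    mat_image R = regulable_outputs n m p A B C"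

definition design_regulator ::
  "nat \<Rightarrow> nat \<Rightarrow> nat \<Rightarrow> real mat \<Rightarrow> real mat \<Rightarrow> real mat \<Rightarrow> real mat \<Rightarrow> real mat \<Rightarrow> real mat \<Rightarrow> bool"
where
  "design_regulator n m p A B C R \<Pi>\<^sub>0 \<Gamma> \<longleftrightarrow>
    \<Pi>\<^sub>0 \<in> carrier_mat n (dim_col R) \<and> \<Gamma> \<in> carrier_mat m (dim_col R) \<and>
    four_block_mat (A - 1\<^sub>m n) B C (0\<^sub>m p m) * (\<Pi>\<^sub>0 @\<^sub>r \<Gamma>) = 0\<^sub>m n (dim_col R) @\<^sub>r R \<and>
    vec_space.rank (n + p) (four_block_mat (A - 1\<^sub>m n) (B * \<Gamma>) C (0\<^sub>m p (dim_col R)))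
      = n + vec_space.rank m \<Gamma>"

text \<open>Here \<open>\<nu>\<close> is the rank of \<open>\<Gamma>\<close>.\<close>

definition design_inputs :: "nat \<Rightarrow> nat \<Rightarrow> real mat \<Rightarrow> real mat \<Rightarrow> real mat \<Rightarrow> bool" where
  "design_inputs m \<nu> \<Gamma> \<Gamma>\<^sub>1 \<Gamma>\<^sub>2 \<longleftrightarrow>
    \<Gamma>\<^sub>1 \<in> carrier_mat m \<nu> \<and> injective_mat \<Gamma>\<^sub>1 \<and> mat_image \<Gamma>\<^sub>1 = mat_image \<Gamma> \<and>
    \<Gamma>\<^sub>2 \<in> carrier_mat m (m - \<nu>) \<and> invertible_mat (\<Gamma>\<^sub>1 @\<^sub>c \<Gamma>\<^sub>2)"

definition ext_A :: "nat \<Rightarrow> nat \<Rightarrow> real mat \<Rightarrow> real mat \<Rightarrow> real mat \<Rightarrow> real mat" where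
  "ext_A n \<nu> A B \<Gamma>\<^sub>1 = four_block_mat A (B * \<Gamma>\<^sub>1) (0\<^sub>m \<nu> n) (1\<^sub>m \<nu>)"

definition ext_B :: "nat \<Rightarrow> nat \<Rightarrow> nat \<Rightarrow> real mat \<Rightarrow> real mat \<Rightarrow> real mat" where
  "ext_B n m \<nu> B \<Gamma>\<^sub>2 = four_block_mat (B * \<Gamma>\<^sub>2) (0\<^sub>m n \<nu>) (0\<^sub>m \<nu> (m - \<nu>)) (1\<^sub>m \<nu>)"

definition ext_C :: "nat \<Rightarrow> nat \<Rightarrow> real mat \<Rightarrow> real mat" where
  "ext_C p \<nu> C = C @\<^sub>c 0\<^sub>m p \<nu>"

definition design_gains ::
  "nat \<Rightarrow> nat \<Rightarrow> nat \<Rightarrow> nat \<Rightarrow> real mat \<Rightarrow> real mat \<Rightarrow> real mat \<Rightarrow> real mat \<Rightarrow> real mat \<Rightarrow>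
   real mat \<Rightarrow> real mat \<Rightarrow> bool" where
  "design_gains n m p \<nu> A B C \<Gamma>\<^sub>1 \<Gamma>\<^sub>2 K F \<longleftrightarrow>
    K \<in> carrier_mat m (n + \<nu>) \<and> F \<in> carrier_mat (n + \<nu>) p \<and>
    schur_stable (ext_A n \<nu> A B \<Gamma>\<^sub>1 - ext_B n m \<nu> B \<Gamma>\<^sub>2 * K) \<and>
    schur_stable (ext_A n \<nu> A B \<Gamma>\<^sub>1 - F * ext_C p \<nu> C)"

text \<open>The signals are the precompensator state \<open>pc\<close>, the estimate \<open>xh\<close>, the exchanged variable
  \<open>chi\<close> (with its history) and the precompensator input \<open>v\<close>.\<close>

definition designed_protocol ::
  "nat \<Rightarrow> nat \<Rightarrow> nat \<Rightarrow> nat \<Rightarrow> real mat \<Rightarrow> real mat \<Rightarrow> real mat \<Rightarrow> real mat \<Rightarrow> real mat \<Rightarrow>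
   real mat \<Rightarrow> real mat \<Rightarrow>
   nat \<Rightarrow> (nat \<Rightarrow> nat \<Rightarrow> real) \<Rightarrow> nat set \<Rightarrow> (nat \<Rightarrow> nat \<Rightarrow> nat) \<Rightarrow> real vec \<Rightarrow>
   (nat \<Rightarrow> nat \<Rightarrow> real vec) \<Rightarrow> (nat \<Rightarrow> int \<Rightarrow> real vec) \<Rightarrow> (nat \<Rightarrow> nat \<Rightarrow> real vec) \<Rightarrow>
   (nat \<Rightarrow> nat \<Rightarrow> real vec) \<Rightarrow> (nat \<Rightarrow> int \<Rightarrow> real vec) \<Rightarrow> (nat \<Rightarrow> nat \<Rightarrow> real vec) \<Rightarrow> bool" where
  "designed_protocol n m p \<nu> A B C \<Gamma>\<^sub>1 \<Gamma>\<^sub>2 K F N a \<C> \<kappa> y\<^sub>r u y pc xh chi v \<longleftrightarrow>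
    (let A' = ext_A n \<nu> A B \<Gamma>\<^sub>1; B' = ext_B n m \<nu> B \<Gamma>\<^sub>2; C' = ext_C p \<nu> C in
    (\<forall>i\<in>{1..N}.
      (\<forall>k. pc i k \<in> carrier_vec \<nu> \<and> xh i k \<in> carrier_vec (n + \<nu>)) \<and>
      (\<forall>t. chi i t \<in> carrier_vec (n + \<nu>)) \<and>
      (\<forall>k. let \<zeta>' = network_measurement p N a \<C> \<kappa> (\<lambda>j t. y j t - y\<^sub>r) i k;
               \<zeta>'' = network_measurement (n + \<nu>) N a \<C> \<kappa> chi i k
           in pc i (Suc k) = pc i k + (0\<^sub>m \<nu> (m - \<nu>) @\<^sub>c 1\<^sub>m \<nu>) *\<^sub>v v i k \<and>
              u i k = \<Gamma>\<^sub>1 *\<^sub>v pc i k + (\<Gamma>\<^sub>2 @\<^sub>c 0\<^sub>m m \<nu>) *\<^sub>v v i k \<and>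
              xh i (Suc k) =
                A' *\<^sub>v xh i k - (B' * K) *\<^sub>v \<zeta>'' + F *\<^sub>v (\<zeta>' - C' *\<^sub>v xh i k) \<and>
              chi i (int (Suc k)) =
                A' *\<^sub>v chi i (int k) + B' *\<^sub>v v i k + A' *\<^sub>v xh i k - A' *\<^sub>v \<zeta>'' \<and>
              v i k = - (K *\<^sub>v chi i (int k)))))"

end

theory Submission
  imports Defs "Jordan_Normal_Form.Schur_Decomposition"
begin

notation mult_mat_vec (infixl "*v" 70)

text \<open>Sufficiency. In coordinates shifted by a steady state, \<open>x\<^sub>h\<close> is an observer for the network
  measurement of the extended state, so up to a vanishing error the difference \<open>e\<^sub>i\<close> between the
  extended state of agent \<open>i\<close> and its exchanged variable satisfies
  \<open>e\<^sub>i(k+1) = A' (\<Sum>\<^sub>j D\<^sub>i\<^sub>j e\<^sub>j(k - \<kappa>\<^sub>i\<^sub>j))\<close>, where \<open>D\<close> is the identity minus the scaled expanded Laplacian.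
  Since every agent is reached from a root, \<open>D\<close> is a nonnegative matrix that strictly contracts a
  weighted sup norm, and this is insensitive to delays. After triangularizing \<open>A'\<close>, whose eigenvalues
  lie in the closed disc, the components of \<open>e\<close> vanish one after the other. The rest is the loop
  \<open>A' - B'K\<close> with a vanishing input.

  Necessity. On a graph without delays the scaled expanded Laplacian \<open>W\<close> commutes with the network
  dynamics, so adding \<open>W\<close> applied to the increments of a trajectory yields another trajectory. Both
  synchronize, and \<open>W\<close> has different row sums at a root and at another agent; hence the increments
  vanish. As the image of a matrix is closed, the limit output is a steady-state output. No
  boundedness of the trajectories is used.\<close>

section \<open>Images and ranks of real matrices\<close>

lemma mult_mat_vec_index:
  assumes "M \<in> carrier_mat r c" "v \<in> carrier_vec c" "l < r"
  shows "(M *v v) $ l = (\<Sum>i<c. M $$ (l, i) * v $ i)"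
  using assms by (auto simp: scalar_prod_def atLeast0LessThan intro!: sum.cong)

lemma mat_imageI: "v \<in> carrier_vec (dim_col M) \<Longrightarrow> M *v v \<in> mat_image M"
  unfolding mat_image_def by blast

lemma mat_imageE:
  assumes "w \<in> mat_image M"
  obtains v where "v \<in> carrier_vec (dim_col M)" "w = M *v v"
  using assms unfolding mat_image_def by blast

lemma injective_mat_iff:
  assumes M: "M \<in> carrier_mat r c"
  shows "injective_mat M \<longleftrightarrow> (\<forall>v \<in> carrier_vec c. M *v v = 0\<^sub>v r \<longrightarrow> v = 0\<^sub>v c)"
proof
  assume "injective_mat M"
  then show "\<forall>v \<in> carrier_vec c. M *v v = 0\<^sub>v r \<longrightarrow> v = 0\<^sub>v c"
    using M mult_mat_vec_carrier unfolding injective_mat_def inj_on_def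
    by (metis carrier_matD(2) mult_minus_distrib_mat_vec minus_cancel_vec zero_carrier_vec)
next
  assume *: "\<forall>v \<in> carrier_vec c. M *v v = 0\<^sub>v r \<longrightarrow> v = 0\<^sub>v c"
  show "injective_mat M"
    unfolding injective_mat_def
  proof (rule inj_onI)
    fix v w assume v: "v \<in> carrier_vec (dim_col M)" and w: "w \<in> carrier_vec (dim_col M)"
      and eq: "M *v v = M *v w"
    have vc: "v \<in> carrier_vec c" and wc: "w \<in> carrier_vec c" using v w M by auto
    have "M *v (v - w) = M *v v - M *v w"
      by (rule mult_minus_distrib_mat_vec[OF M vc wc])
    also have "\<dots> = 0\<^sub>v r" using eq M wc by simp
    finally have "v - w = 0\<^sub>v c" using * vc wc by auto
    then show "v = w" using vc wc
      by (metis (no_types) M carrier_vecD eq_vecI index_minus_vec(1) index_zero_vec(1) right_minus_eq)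
  qed
qed

lemma mult_mat_vec_0: "M \<in> carrier_mat r c \<Longrightarrow> M *v 0\<^sub>v c = (0\<^sub>v r :: 'a :: semiring_0 vec)"
  by (intro eq_vecI) (auto simp: scalar_prod_def)

lemma mult_mat_vec_uminus:
  assumes "M \<in> carrier_mat r c" "v \<in> carrier_vec c"
  shows "M *v (- v) = - (M *v v :: 'a :: ring vec)"
  by (rule eq_vecI) (use assms scalar_prod_uminus_right[of _ v] in auto)

lemma zero_mat_mult_vec [simp]: "w \<in> carrier_vec s \<Longrightarrow> 0\<^sub>m r s *v w = (0\<^sub>v r :: 'a :: semiring_0 vec)"
  by (intro eq_vecI) (auto simp: scalar_prod_def)

lemma injective_square_inverse:
  assumes M: "(M :: real mat) \<in> carrier_mat d d"
    and inj: "\<forall>v \<in> carrier_vec d. M *v v = 0\<^sub>v d \<longrightarrow> v = 0\<^sub>v d"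
  obtains W where "W \<in> carrier_mat d d" "W * M = 1\<^sub>m d" "M * W = 1\<^sub>m d"
proof -
  have "det M \<noteq> 0" using det_0_iff_vec_prod_zero_field[OF M] inj by auto
  then have "M \<in> Units (ring_mat TYPE(real) d d)" using det_non_zero_imp_unit[OF M] by auto
  then show ?thesis using that unfolding Units_def ring_mat_def by auto
qed

lemma scalar_prod_self_eq_0:
  assumes "(v :: real vec) \<in> carrier_vec d" "v \<bullet> v = 0"
  shows "v = 0\<^sub>v d"
proof -
  have "(\<Sum>i<d. v $ i * v $ i) = 0"
    using assms by (simp add: scalar_prod_def atLeast0LessThan)
  then have "\<forall>i\<in>{..<d}. v $ i * v $ i = 0" by (subst (asm) sum_nonneg_eq_0_iff) auto
  then show ?thesis using assms by (intro eq_vecI) auto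
qed

text \<open>\<open>L\<close> is the pseudoinverse: with \<open>T\<close> the transpose of
  \<open>M\<close>, the product \<open>T * M\<close> is invertible because \<open>v\<close> paired
  with \<open>T * M * v\<close> is the squared length of \<open>M *v v\<close>. Then
  \<open>M * L\<close> is the orthogonal projection onto the image. The orthogonal residual serves
  twice below, in choosing \<open>\<Gamma>\<close> and in completing \<open>\<Gamma>\<^sub>1\<close>
  to a basis.\<close>

lemma injective_left_inverse:
  assumes M: "M \<in> carrier_mat r c" and inj: "injective_mat M"
  obtains L where "L \<in> carrier_mat c r" "L * M = 1\<^sub>m c"
    "\<forall>v\<in>carrier_vec r. \<forall>w\<in>carrier_vec c. (v - M *v (L *v v)) \<bullet> (M *v w) = 0"
proof -
  let ?T = "transpose_mat M"
  have T: "?T \<in> carrier_mat c r" using M by simp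
  have TM: "?T * M \<in> carrier_mat c c" using T M by simp
  have "v = 0\<^sub>v c" if v: "v \<in> carrier_vec c" and z: "(?T * M) *v v = 0\<^sub>v c" for v
  proof -
    have Mv: "M *v v \<in> carrier_vec r" using M v by simp
    have "(M *v v) \<bullet> (M *v v) = (?T *v (M *v v)) \<bullet> v"
      using transpose_vec_mult_scalar[OF M v Mv] by simp
    also have "\<dots> = 0" using z T M v by simp
    finally show ?thesis using scalar_prod_self_eq_0[OF Mv] inj M v by (simp add: injective_mat_iff)
  qed
  then obtain W where W: "W \<in> carrier_mat c c" "W * (?T * M) = 1\<^sub>m c" "(?T * M) * W = 1\<^sub>m c"
    using injective_square_inverse[OF TM] by blast
  show ?thesis
  proof (rule that[of "W * ?T"]; (intro ballI)?)
    show "W * ?T \<in> carrier_mat c r" using W T by simp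
    show "W * ?T * M = 1\<^sub>m c" using W T M by simp
    fix v w :: "real vec" assume v: "v \<in> carrier_vec r" and w: "w \<in> carrier_vec c"
    let ?u = "W * ?T *v v"
    have u: "?u \<in> carrier_vec c" using W T v by (metis mult_carrier_mat mult_mat_vec_carrier)
    have "?T *v (M *v ?u) = (?T * M) *v (W *v (?T *v v))"
      using W T M v u by simp
    also have "\<dots> = ((?T * M) * W) *v (?T *v v)"
      by (rule assoc_mult_mat_vec[symmetric]) (use W T M v TM in auto)
    also have "\<dots> = ?T *v v" using W T v by simp
    finally have "?T *v (v - M *v ?u) = 0\<^sub>v c"
      using T v M u by (simp add: mult_minus_distrib_mat_vec[OF T v])
    moreover have "v - M *v ?u \<in> carrier_vec r" using v M u by simp
    ultimately show "(v - M *v ?u) \<bullet> (M *v w) = 0"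
      using transpose_vec_mult_scalar[OF M w, of "v - M *v ?u"] w by simp
  qed
qed

text \<open>Rank and linear independence refer to the set of columns, in which a repeated column is
  invisible. Each direction therefore shows first that the columns are distinct: equal columns give
  two unit vectors with the same image, and they leave fewer than \<open>c\<close> elements to
  count.\<close>

lemma rank_eq_dim_col_iff:
  assumes M: "M \<in> carrier_mat r c"
  shows "vec_space.rank r M = c \<longleftrightarrow> injective_mat M"
proof
  interpret vec_space "TYPE(real)" r .
  assume inj: "injective_mat M"
  have d: "distinct (cols M)"
  proof (rule ccontr)
    assume "\<not> distinct (cols M)"
    then obtain i j where ij: "i < c" "j < c" "i \<noteq> j" "col M i = col M j"
      using M by (auto simp: distinct_conv_nth)
    have "M *v unit_vec c i = M *v unit_vec c j"
      using ij M by (intro eq_vecI) (auto simp flip: col_def simp: vec_eq_iff)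
    then have "unit_vec c i = (unit_vec c j :: real vec)"
      using inj M unfolding injective_mat_def inj_on_def by auto
    then show False using ij by (metis index_unit_vec(1) zero_neq_one)
  qed
  show "rank M = c"
  proof (rule lin_indpt_full_rank[OF M d])
    show "lin_indpt (set (cols M))"
      by (rule notI, erule lin_depE[OF M _ d]) (use inj M in \<open>auto simp: injective_mat_iff\<close>)
  qed
next
  interpret vec_space "TYPE(real)" r .
  assume rk: "rank M = c"
  have d: "distinct (cols M)"
  proof (rule ccontr)
    assume nd: "\<not> distinct (cols M)"
    obtain S where S: "maximal S (\<lambda>T. T \<subseteq> set (cols M) \<and> lin_indpt T)"
      using maximal_exists[of "(\<lambda>T. T \<subseteq> set (cols M) \<and> lin_indpt T)" "card (set (cols M))" "{}"]
      by (meson List.finite_set card_mono empty_iff empty_subsetI finite_lin_indpt2 rev_finite_subset)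
    then have "rank M \<le> card (set (cols M))"
      using rank_card_indpt[OF M S] by (simp add: card_mono maximal_def)
    also have "\<dots> < c" using nd M card_distinct card_length
      by (metis carrier_matD(2) cols_length le_neq_implies_less)
    finally show False using rk by simp
  qed
  show "injective_mat M"
    using lin_depI[OF M _ _ _ d] full_rank_lin_indpt[OF M rk d] M
    by (auto simp: injective_mat_iff)
qed

lemma rank_cong_image:
  assumes M: "M \<in> carrier_mat r c" and M': "M' \<in> carrier_mat r c'"
    and eq: "mat_image M = mat_image M'"
  shows "vec_space.rank r M = vec_space.rank r M'"
proof -
  interpret vec_space "TYPE(real)" r .
  have "span (set (cols N)) = mat_image N" if "N \<in> carrier_mat r d" for N d
    using col_space_eq[OF that] that unfolding col_space_def mat_image_def by auto
  then show ?thesis using M M' eq unfolding rank_def by metis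
qed

section \<open>Subspaces as images of injective matrices\<close>

definition vec_subspace :: "nat \<Rightarrow> real vec set \<Rightarrow> bool" where
  "vec_subspace d W \<longleftrightarrow> W \<subseteq> carrier_vec d \<and> 0\<^sub>v d \<in> W \<and>
    (\<forall>v\<in>W. \<forall>w\<in>W. v + w \<in> W) \<and> (\<forall>a. \<forall>v\<in>W. a \<cdot>\<^sub>v v \<in> W)"

lemma append_cols_carrier:
  "M \<in> carrier_mat r c \<Longrightarrow> M' \<in> carrier_mat r c' \<Longrightarrow> M @\<^sub>c M' \<in> carrier_mat r (c + c')"
  unfolding append_cols_def by (metis (no_types) add.right_neutral carrier_matD(2)
      four_block_carrier_mat zero_carrier_mat)

lemma append_cols_mult_vec:
  assumes "M \<in> carrier_mat r c" "M' \<in> carrier_mat r c'" "v \<in> carrier_vec c" "w \<in> carrier_vec c'"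
  shows "(M @\<^sub>c M') *v (v @\<^sub>v w) = M *v v + (M' *v w :: 'a :: comm_ring_1 vec)"
proof -
  have "(M @\<^sub>c M') *v (v @\<^sub>v w) = (M *v v + M' *v w) @\<^sub>v (0\<^sub>m 0 c *v v + 0\<^sub>m 0 c' *v w)"
    unfolding append_cols_def using assms
    by (subst four_block_mat_mult_vec[of _ r c _ c' _ 0]) auto
  also have "\<dots> = M *v v + M' *v w"
    by (rule eq_vecI) (use assms in auto)
  finally show ?thesis .
qed

lemma carrier_vec_splitE:
  assumes "v \<in> carrier_vec (a + b)"
  obtains x y where "x \<in> carrier_vec a" "y \<in> carrier_vec b" "v = x @\<^sub>v y"
  using assms vec_first_last_append vec_first_carrier vec_last_carrier by metis

lemma mat_of_vec_mult:
  assumes "(w :: real vec) \<in> carrier_vec r" "v \<in> carrier_vec 1"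
  shows "mat_of_cols r [w] *v v = (v $ 0) \<cdot>\<^sub>v w"
  by (rule eq_vecI) (use assms in \<open>auto simp: scalar_prod_def mat_of_cols_def\<close>)

text \<open>A basis is found by maximality: among injective matrices with image inside
  \<open>W\<close> take one with the most columns. A vector of \<open>W\<close> outside its image
  could be appended as a further column without losing injectivity.\<close>

lemma subspace_image:
  assumes W: "vec_subspace d W"
  obtains c J where "J \<in> carrier_mat d c" "injective_mat J" "mat_image J = W"
proof -
  define P where "P c \<longleftrightarrow> (\<exists>J \<in> carrier_mat d c. injective_mat J \<and> mat_image J \<subseteq> W)" for c
  have le: "c \<le> d" if P: "P c" for c
  proof -
    obtain J where J: "J \<in> carrier_mat d c" "injective_mat J" using P unfolding P_def by blast
    obtain L where L: "L \<in> carrier_mat c d" "L * J = 1\<^sub>m c"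
      using injective_left_inverse[OF J] .
    interpret vec_space "TYPE(real)" c .
    show "c \<le> d"
    proof (rule ccontr)
      assume "\<not> c \<le> d"
      \<comment> \<open>\<open>L\<close> has a right inverse and hence full image, while its rank is
        at most its number \<open>d\<close> of columns. This bounds the number of columns of an
        injective matrix.\<close>
      have "rank L = c"
      proof -
        have "v \<in> mat_image L" if v: "v \<in> carrier_vec c" for v
        proof -
          have "L *v (J *v v) = v" using L(2) v assoc_mult_mat_vec[OF L(1) J(1) v] by simp
          then show ?thesis using L J v mat_imageI[of "J *v v" L] by auto
        qed
        then have "mat_image L = mat_image (1\<^sub>m c)" using L by (auto simp: mat_image_def)
        then have "rank L = rank (1\<^sub>m c)" by (rule rank_cong_image[OF L(1) one_carrier_mat])
        also have "\<dots> = c" by (subst rank_eq_dim_col_iff[of _ c]) (auto simp: injective_mat_iff[of _ c c])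
        finally show ?thesis .
      qed
      then show False using rank_le_nc[OF L(1)] \<open>\<not> c \<le> d\<close> by simp
    qed
  qed
  have "P 0" unfolding P_def
    by (rule bexI[of _ "0\<^sub>m d 0"])
      (use W in \<open>auto simp: injective_mat_iff[of _ d 0] mat_image_def vec_subspace_def\<close>)
  define c where "c = (GREATEST c. P c)"
  have Pc: "P c" unfolding c_def by (rule GreatestI_nat[of P 0 d]) (use \<open>P 0\<close> le in auto)
  have max: "c' \<le> c" if "P c'" for c'
    unfolding c_def by (rule Greatest_le_nat[of P c' d]) (use that le in auto)
  obtain J where J: "J \<in> carrier_mat d c" "injective_mat J" "mat_image J \<subseteq> W"
    using Pc unfolding P_def by blast
  have "mat_image J = W"
  proof (rule ccontr)
    assume "mat_image J \<noteq> W"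
    then obtain w where w: "w \<in> W" "w \<notin> mat_image J" using J by blast
    have wd: "w \<in> carrier_vec d" using w W unfolding vec_subspace_def by blast
    let ?w = "mat_of_cols d [w]"
    have cw: "?w \<in> carrier_mat d 1" using mat_of_cols_carrier(1)[of d "[w]"] by simp
    let ?J = "J @\<^sub>c ?w"
    have cJ: "?J \<in> carrier_mat d (c + 1)" by (rule append_cols_carrier[OF J(1) cw])
    have mult: "?J *v (v @\<^sub>v s) = J *v v + (s $ 0) \<cdot>\<^sub>v w"
      if "v \<in> carrier_vec c" "s \<in> carrier_vec 1" for v s
      using append_cols_mult_vec[OF J(1) cw that] mat_of_vec_mult[OF wd that(2)] by simp
    have "P (c + 1)" unfolding P_def
    proof (intro bexI[of _ ?J] conjI cJ)
      show "mat_image ?J \<subseteq> W"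
      proof
        fix z assume "z \<in> mat_image ?J"
        then obtain u where u: "u \<in> carrier_vec (c + 1)" "z = ?J *v u"
          using cJ by (auto elim: mat_imageE)
        from u(1) obtain v s where vs: "v \<in> carrier_vec c" "s \<in> carrier_vec 1" "u = v @\<^sub>v s"
          by (elim carrier_vec_splitE)
        have "J *v v \<in> W" using J vs mat_imageI[of v J] by auto
        moreover have "(s $ 0) \<cdot>\<^sub>v w \<in> W" using w W unfolding vec_subspace_def by blast
        ultimately show "z \<in> W" using mult[OF vs(1,2)] u vs W unfolding vec_subspace_def by metis
      qed
      show "injective_mat ?J"
        unfolding injective_mat_iff[OF cJ]
      proof (intro ballI impI)
        fix u assume u: "u \<in> carrier_vec (c + 1)" and z: "?J *v u = 0\<^sub>v d"
        obtain v s where vs: "v \<in> carrier_vec c" "s \<in> carrier_vec 1" "u = v @\<^sub>v s"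
          using u by (elim carrier_vec_splitE)
        have eq: "J *v v + (s $ 0) \<cdot>\<^sub>v w = 0\<^sub>v d" using z mult[OF vs(1,2)] vs(3) by simp
        have s0: "s $ 0 = 0"
        proof (rule ccontr)
          assume s: "s $ 0 \<noteq> 0"
          have "J *v ((- inverse (s $ 0)) \<cdot>\<^sub>v v) = w"
          proof (rule eq_vecI)
            fix i assume i: "i < dim_vec w"
            have "(J *v v + (s $ 0) \<cdot>\<^sub>v w) $ i = 0" using eq i wd by simp
            then have e: "(J *v v) $ i = - (s $ 0) * w $ i" using i wd J by simp
            have "(J *v ((- inverse (s $ 0)) \<cdot>\<^sub>v v)) $ i = - inverse (s $ 0) * (J *v v) $ i"
              using mult_mat_vec[OF J(1) vs(1)] i wd J(1) by simp
            then show "(J *v ((- inverse (s $ 0)) \<cdot>\<^sub>v v)) $ i = w $ i" using e s by simp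
          qed (use J wd in auto)
          then show False using w(2) mat_imageI[of "(- inverse (s $ 0)) \<cdot>\<^sub>v v" J] J vs by auto
        qed
        have "J *v v = 0\<^sub>v d"
          using eq wd mult_mat_vec_carrier[OF J(1) vs(1)] J(1) unfolding s0 by (simp add: vec_eq_iff)
        then have "v = 0\<^sub>v c" using J vs by (simp add: injective_mat_iff)
        moreover have "s = 0\<^sub>v 1" using s0 vs by (intro eq_vecI) auto
        ultimately show "u = 0\<^sub>v (c + 1)" using vs by (intro eq_vecI) auto
      qed
    qed
    then show False using max[of "c + 1"] by simp
  qed
  then show ?thesis using that[of J] J by auto
qed

lemma append_vec_minus:
  assumes "a \<in> carrier_vec r" "a' \<in> carrier_vec r" "b \<in> carrier_vec s" "b' \<in> carrier_vec s"
  shows "(a @\<^sub>v b) - (a' @\<^sub>v b') = (a - a') @\<^sub>v (b - b' :: 'a :: ring vec)"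
  by (rule eq_vecI) (use assms in auto)

lemma projection_append_mult:
  assumes M: "M \<in> carrier_mat r a" and v: "v \<in> carrier_vec a" and w: "w \<in> carrier_vec b"
  shows "(M @\<^sub>c 0\<^sub>m r b) *v (v @\<^sub>v w) = (M *v v :: 'a :: comm_ring_1 vec)"
  using append_cols_mult_vec[OF M zero_carrier_mat v w] mult_mat_vec_carrier[OF M v] w by simp

lemma projection_append_mult_right:
  assumes M: "M \<in> carrier_mat r b" and v: "v \<in> carrier_vec a" and w: "w \<in> carrier_vec b"
  shows "(0\<^sub>m r a @\<^sub>c M) *v (v @\<^sub>v w) = (M *v w :: 'a :: comm_ring_1 vec)"
  using append_cols_mult_vec[OF zero_carrier_mat M v w] mult_mat_vec_carrier[OF M w] v by simp

lemma vec_subspace_kernel: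
  assumes M: "M \<in> carrier_mat r c"
  shows "vec_subspace c {v \<in> carrier_vec c. M *v v = 0\<^sub>v r}"
  using mult_add_distrib_mat_vec[OF M] mult_mat_vec[OF M] mult_mat_vec_0[OF M]
  unfolding vec_subspace_def by (auto intro!: eq_vecI)

lemma vec_subspace_image:
  assumes M: "M \<in> carrier_mat r c" and V: "vec_subspace c V"
  shows "vec_subspace r ((\<lambda>v. M *v v) ` V)"
  unfolding vec_subspace_def
proof (intro conjI ballI allI)
  have sub: "V \<subseteq> carrier_vec c" using V by (simp add: vec_subspace_def)
  show "(\<lambda>v. M *v v) ` V \<subseteq> carrier_vec r" using mult_mat_vec_carrier[OF M] sub by blast
  show "0\<^sub>v r \<in> (\<lambda>v. M *v v) ` V" using mult_mat_vec_0[OF M, symmetric] V unfolding vec_subspace_def by blast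
  fix v assume "v \<in> (\<lambda>v. M *v v) ` V"
  then obtain v' where v': "v' \<in> V" "v = M *v v'" by blast
  have vc: "v' \<in> carrier_vec c" using v' sub by blast
  show "a \<cdot>\<^sub>v v \<in> (\<lambda>v. M *v v) ` V" for a
    unfolding v'(2) mult_mat_vec[OF M vc, symmetric] using V v'(1) unfolding vec_subspace_def by blast
  fix w assume "w \<in> (\<lambda>v. M *v v) ` V"
  then obtain w' where w': "w' \<in> V" "w = M *v w'" by blast
  have wc: "w' \<in> carrier_vec c" using w' sub by blast
  show "v + w \<in> (\<lambda>v. M *v v) ` V"
    unfolding v'(2) w'(2) mult_add_distrib_mat_vec[OF M vc wc, symmetric]
    using V v'(1) w'(1) unfolding vec_subspace_def by blast
qed

lemma vec_subspace_mat_image: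
  assumes M: "M \<in> carrier_mat r c"
  shows "vec_subspace r (mat_image M)"
proof -
  have "vec_subspace c (carrier_vec c)" by (simp add: vec_subspace_def)
  then show ?thesis unfolding mat_image_def using vec_subspace_image[OF M] M by simp
qed

lemma rank_factor:
  assumes M: "M \<in> carrier_mat r c"
  obtains J where "J \<in> carrier_mat r (vec_space.rank r M)" "injective_mat J" "mat_image J = mat_image M"
proof -
  obtain d J where J: "J \<in> carrier_mat r d" "injective_mat J" "mat_image J = mat_image M"
    using subspace_image[OF vec_subspace_mat_image[OF M]] by blast
  have "vec_space.rank r M = d"
    using rank_cong_image[OF J(1) M J(3)] rank_eq_dim_col_iff[OF J(1)] J(2) by simp
  then show ?thesis using that J by metis
qed

text \<open>\<open>J * L\<close> is a matrix that fixes the image pointwise, and the fixed vectors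
  of a matrix are preserved under limits. The preimages \<open>z k\<close> themselves may
  diverge.\<close>

lemma mat_image_closed:
  assumes M: "M \<in> carrier_mat r c" and z: "\<And>k. z k \<in> carrier_vec c" and b: "b \<in> carrier_vec r"
    and lim: "\<And>l. l < r \<Longrightarrow> (\<lambda>k. (M *v z k) $ l) \<longlonglongrightarrow> b $ l"
  shows "b \<in> mat_image M"
proof -
  obtain d J where J: "J \<in> carrier_mat r d" "injective_mat J" "mat_image J = mat_image M"
    using subspace_image[OF vec_subspace_mat_image[OF M]] by blast
  obtain L where L: "L \<in> carrier_mat d r" "L * J = 1\<^sub>m d"
    using injective_left_inverse[OF J(1,2)] .
  have JL: "J * L \<in> carrier_mat r r" using J L by auto
  have fix_image: "(J * L) *v w = w" if w: "w \<in> mat_image M" for w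
  proof -
    obtain v where v: "v \<in> carrier_vec d" "w = J *v v"
      using w J(1) unfolding J(3)[symmetric] by (auto simp: mat_image_def)
    have "(J * L) *v w = J *v ((L * J) *v v)"
      using assoc_mult_mat_vec[OF J(1) L(1), of w] assoc_mult_mat_vec[OF L(1) J(1) v(1)] v J(1)
      by simp
    then show ?thesis using v L by simp
  qed
  have Mz: "M *v z k \<in> carrier_vec r" for k by (rule mult_mat_vec_carrier[OF M z])
  have "(J * L) *v b = b"
  proof (rule eq_vecI)
    fix l assume "l < dim_vec b"
    then have l: "l < r" using b by simp
    have "(\<lambda>k. ((J * L) *v (M *v z k)) $ l) \<longlonglongrightarrow> ((J * L) *v b) $ l"
    proof -
      have "(\<lambda>k. \<Sum>i<r. (J * L) $$ (l, i) * (M *v z k) $ i) \<longlonglongrightarrow> (\<Sum>i<r. (J * L) $$ (l, i) * b $ i)"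
        by (intro tendsto_intros lim) auto
      moreover have "((J * L) *v w) $ l = (\<Sum>i<r. (J * L) $$ (l, i) * w $ i)"
        if "w \<in> carrier_vec r" for w
        by (rule mult_mat_vec_index[OF JL that l])
      ultimately show ?thesis using Mz b by presburger
    qed
    moreover have "(J * L) *v (M *v z k) = M *v z k" for k
      using fix_image mat_imageI[of "z k" M] z M by auto
    ultimately show "((J * L) *v b) $ l = b $ l" using lim[OF l] LIMSEQ_unique by auto
  qed (use JL b in auto)
  moreover have "(J * L) *v b = J *v (L *v b)" by (rule assoc_mult_mat_vec[OF J(1) L(1) b])
  ultimately show ?thesis using mat_imageI[of "L *v b" J] J L b by auto
qed

section \<open>Delayed averaging\<close>

text \<open>Stated for any finite or infinite index type and any commutative ring because it serves
  the coupling and the averaging of agents, over the reals and, after triangularization, over the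
  complex numbers.\<close>

definition wsum :: "nat \<Rightarrow> 'i set \<Rightarrow> ('i \<Rightarrow> 'a :: comm_ring_1) \<Rightarrow> ('i \<Rightarrow> 'a vec) \<Rightarrow> 'a vec" where
  "wsum d I c s = vec d (\<lambda>l. \<Sum>j\<in>I. c j * s j $ l)"

lemma wsum_carrier [simp]: "wsum d I c s \<in> carrier_vec d"
  by (simp add: wsum_def)

lemma wsum_index [simp]: "l < d \<Longrightarrow> wsum d I c s $ l = (\<Sum>j\<in>I. c j * s j $ l)"
  by (simp add: wsum_def)

lemma wsum_cong: "(\<And>j. j \<in> I \<Longrightarrow> s j = s' j) \<Longrightarrow> wsum d I c s = wsum d I c s'"
  by (simp add: wsum_def cong: sum.cong)

lemma mult_mat_vec_wsum:
  assumes M: "M \<in> carrier_mat r d" and s: "\<And>j. j \<in> I \<Longrightarrow> s j \<in> carrier_vec d"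
  shows "M *v wsum d I c s = wsum r I c (\<lambda>j. M *v s j)"
proof (rule eq_vecI)
  fix l assume "l < dim_vec (wsum r I c (\<lambda>j. M *v s j))"
  then have l: "l < r" by (simp add: wsum_def)
  have "(M *v wsum d I c s) $ l = (\<Sum>i<d. \<Sum>j\<in>I. M $$ (l, i) * (c j * s j $ i))"
    using mult_mat_vec_index[OF M wsum_carrier l] by (simp add: sum_distrib_left)
  also have "\<dots> = (\<Sum>j\<in>I. \<Sum>i<d. c j * (M $$ (l, i) * s j $ i))"
    by (subst sum.swap) (simp add: mult.left_commute)
  also have "\<dots> = (\<Sum>j\<in>I. c j * (M *v s j) $ l)"
    using mult_mat_vec_index[OF M s l] by (simp add: sum_distrib_left)
  finally show "(M *v wsum d I c s) $ l = wsum r I c (\<lambda>j. M *v s j) $ l" using l by simp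
qed (use M in \<open>auto simp: wsum_def\<close>)

lemma delays_bounded:
  fixes \<kappa> :: "'i \<Rightarrow> 'i \<Rightarrow> nat"
  assumes "finite I"
  shows "\<exists>\<kappa>m. \<forall>i\<in>I. \<forall>j\<in>I. \<kappa> i j \<le> \<kappa>m"
proof -
  have "finite ((\<lambda>(i, j). \<kappa> i j) ` (I \<times> I))" using assms by simp
  from finite_nat_set_iff_bounded_le[THEN iffD1, OF this] show ?thesis by auto
qed

text \<open>In the sup norm with weights \<open>q\<close>, a bound \<open>b\<close> on all past
  values yields the bound \<open>\<theta> * b\<close> on the next one, up to the perturbation. A
  delay only postpones the moment from which an improved bound may be used. So the values are first
  shown to be bounded and the bound is then improved round by round.\<close>

lemma delayed_contraction_tendsto_0:
  fixes f :: "'i \<Rightarrow> int \<Rightarrow> complex" and \<kappa> :: "'i \<Rightarrow> 'i \<Rightarrow> nat"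
  assumes I: "finite I" and D: "\<And>i j. i \<in> I \<Longrightarrow> j \<in> I \<Longrightarrow> 0 \<le> D i j"
    and q: "\<And>i. i \<in> I \<Longrightarrow> 0 < q i" and \<theta>: "0 \<le> \<theta>" "\<theta> < 1"
    and contr: "\<And>i. i \<in> I \<Longrightarrow> cmod z * (\<Sum>j\<in>I. D i j * q j) \<le> \<theta> * q i"
    and lim: "\<And>i. i \<in> I \<Longrightarrow> (\<lambda>k. f i (int (Suc k)) -
      z * (\<Sum>j\<in>I. of_real (D i j) * f j (int k - int (\<kappa> i j)))) \<longlonglongrightarrow> 0"
    and i: "i \<in> I"
  shows "(\<lambda>k. f i (int k)) \<longlonglongrightarrow> 0"
proof -
  define w where "w i k = f i (int (Suc k)) - z * (\<Sum>j\<in>I. of_real (D i j) * f j (int k - int (\<kappa> i j)))" for i k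
  define g where "g i t = cmod (f i t) / q i" for i t
  have fin: "cmod (f i t) = g i t * q i" if "i \<in> I" for i t using q[OF that] by (simp add: g_def)
  have step: "g i (int (Suc k)) \<le> \<theta> * b + cmod (w i k) / q i"
    if i: "i \<in> I" and b: "0 \<le> b" "\<And>j. j \<in> I \<Longrightarrow> g j (int k - int (\<kappa> i j)) \<le> b" for i k b
  proof -
    have "cmod (f i (int (Suc k))) \<le> cmod (w i k) + cmod (z * (\<Sum>j\<in>I. of_real (D i j) * f j (int k - int (\<kappa> i j))))"
      using norm_triangle_ineq[of "w i k" "z * (\<Sum>j\<in>I. of_real (D i j) * f j (int k - int (\<kappa> i j)))"]
      by (simp add: w_def)
    also have "cmod (z * (\<Sum>j\<in>I. of_real (D i j) * f j (int k - int (\<kappa> i j))))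
        \<le> cmod z * (\<Sum>j\<in>I. D i j * (b * q j))"
      unfolding norm_mult
    proof (rule mult_left_mono)
      show "cmod (\<Sum>j\<in>I. of_real (D i j) * f j (int k - int (\<kappa> i j))) \<le> (\<Sum>j\<in>I. D i j * (b * q j))"
      proof (rule sum_norm_le)
        fix j assume j: "j \<in> I"
        have "g j (int k - int (\<kappa> i j)) * q j \<le> b * q j"
          using b(2)[OF j] q[OF j] by (simp add: mult_right_mono)
        then show "cmod (of_real (D i j) * f j (int k - int (\<kappa> i j))) \<le> D i j * (b * q j)"
          using D[OF i j] fin[OF j] by (simp add: norm_mult mult_left_mono)
      qed
    qed simp
    also have "\<dots> = b * (cmod z * (\<Sum>j\<in>I. D i j * q j))"
      by (simp add: sum_distrib_left mult_ac)
    also have "\<dots> \<le> b * (\<theta> * q i)" using contr[OF i] b(1) by (rule mult_left_mono)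
    finally show ?thesis using q[OF i] by (simp add: g_def field_simps)
  qed
  have wlim: "\<forall>\<^sub>F k in sequentially. \<forall>i\<in>I. cmod (w i k) / q i \<le> \<eta>" if "0 < \<eta>" for \<eta>
  proof (intro eventually_ball_finite I ballI)
    fix i assume i: "i \<in> I"
    have "(\<lambda>k. cmod (w i k) / q i) \<longlonglongrightarrow> 0"
      using tendsto_divide[OF tendsto_norm[OF lim[OF i]] tendsto_const[of "q i"]] q[OF i]
      unfolding w_def by simp
    then show "\<forall>\<^sub>F k in sequentially. cmod (w i k) / q i \<le> \<eta>"
      by (rule eventually_mono[OF order_tendstoD(2)[OF _ that]]) simp
  qed
  obtain \<kappa>m where \<kappa>m: "\<And>i j. i \<in> I \<Longrightarrow> j \<in> I \<Longrightarrow> \<kappa> i j \<le> \<kappa>m"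
    using delays_bounded[OF I, of \<kappa>] by blast
  obtain K1 where K1: "\<And>k i. K1 \<le> k \<Longrightarrow> i \<in> I \<Longrightarrow> cmod (w i k) / q i \<le> 1"
    using wlim[of 1] unfolding eventually_sequentially by auto
  \<comment> \<open>The initial history is arbitrary, but only the finite window back to the largest
    delay is ever read. \<open>K1\<close> is the time after which the scaled perturbation stays
    below 1.\<close>
  obtain b0 where b0: "0 \<le> b0" "\<And>i t. i \<in> I \<Longrightarrow> - int \<kappa>m \<le> t \<Longrightarrow> t \<le> int K1 \<Longrightarrow> g i t \<le> b0"
  proof -
    let ?S = "(\<lambda>(i, t). g i t) ` (I \<times> {- int \<kappa>m..int K1})"
    have "finite ?S" using I by simp
    then have "bdd_above ?S" by (rule bdd_above_finite)
    then obtain b where "\<forall>x\<in>?S. x \<le> b" unfolding bdd_above_def by blast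
    then show ?thesis by (intro that[of "max 0 b"]) force+
  qed
  \<comment> \<open>\<open>1 / (1 - \<theta>)\<close> is the fixed point of the map
    \<open>b \<mapsto> \<theta> * b + 1\<close>, so any bound above it reproduces itself.\<close>
  define b1 where "b1 = max b0 (1 / (1 - \<theta>))"
  have b1: "0 \<le> b1" "\<theta> * b1 + 1 \<le> b1"
  proof -
    show "0 \<le> b1" using b0 by (simp add: b1_def)
    have "1 / (1 - \<theta>) \<le> b1" by (simp add: b1_def)
    then show "\<theta> * b1 + 1 \<le> b1" using \<theta> by (simp add: field_simps)
  qed
  have bd: "\<forall>i\<in>I. \<forall>t. - int \<kappa>m \<le> t \<and> t \<le> int k \<longrightarrow> g i t \<le> b1" for k
  proof (induction k)
    case 0
    then show ?case using b0 by (force simp: b1_def)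
  next
    case (Suc k)
    have "g i (int (Suc k)) \<le> b1" if i: "i \<in> I" for i
    proof (cases "K1 \<le> k")
      case True
      have "g i (int (Suc k)) \<le> \<theta> * b1 + cmod (w i k) / q i"
        using Suc \<kappa>m[OF i] by (intro step i b1) fastforce
      then show ?thesis using K1[OF True i] b1 by linarith
    next
      case False
      then have "g i (int (Suc k)) \<le> b0" by (intro b0 i) auto
      then show ?thesis by (simp add: b1_def)
    qed
    moreover have "t \<le> int k \<or> t = int (Suc k)" if "t \<le> int (Suc k)" for t using that by linarith
    ultimately show ?case using Suc by blast
  qed
  \<comment> \<open>One more round replaces the bound \<open>b\<close> by
    \<open>\<theta> * b + \<eta>\<close>; the summand \<open>\<eta> / (1 - \<theta>)\<close> is the
    fixed point of this map, so only the other summand shrinks.\<close>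
  have ev: "\<forall>\<^sub>F k in sequentially. \<forall>i\<in>I. g i (int k) \<le> \<theta> ^ m * b1 + \<eta> / (1 - \<theta>)" if \<eta>: "0 < \<eta>" for m \<eta>
  proof (induction m)
    case 0
    have "0 \<le> \<eta> / (1 - \<theta>)" using \<eta> \<theta> by simp
    then have "\<forall>i\<in>I. g i (int k) \<le> \<theta> ^ 0 * b1 + \<eta> / (1 - \<theta>)" for k
      using bd[of k] by fastforce
    then show ?case by simp
  next
    case (Suc m)
    let ?b = "\<theta> ^ m * b1 + \<eta> / (1 - \<theta>)"
    have b: "0 \<le> ?b" using \<eta> \<theta> b1 by simp
    obtain K where K: "\<And>k i. K \<le> k \<Longrightarrow> i \<in> I \<Longrightarrow> g i (int k) \<le> ?b"
      using Suc unfolding eventually_sequentially by auto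
    obtain K' where K': "\<And>k i. K' \<le> k \<Longrightarrow> i \<in> I \<Longrightarrow> cmod (w i k) / q i \<le> \<eta>"
      using wlim[OF \<eta>] unfolding eventually_sequentially by auto
    \<comment> \<open>Past \<open>K + K' + \<kappa>m\<close> every delayed time is at least
      \<open>K\<close>, where the previous bound holds, and the perturbation is below
      \<open>\<eta>\<close>.\<close>
    have "g i (int k') \<le> \<theta> ^ Suc m * b1 + \<eta> / (1 - \<theta>)" if k': "Suc (K + K' + \<kappa>m) \<le> k'" and i: "i \<in> I" for k' i
    proof -
      obtain k where k: "k' = Suc k" using k' by (cases k') auto
      have "g i (int (Suc k)) \<le> \<theta> * ?b + cmod (w i k) / q i"
      proof (rule step[OF i b])
        fix j assume j: "j \<in> I"
        have "int k - int (\<kappa> i j) = int (k - \<kappa> i j)" using \<kappa>m[OF i j] k k' by simp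
        then show "g j (int k - int (\<kappa> i j)) \<le> ?b" using K[of "k - \<kappa> i j" j] \<kappa>m[OF i j] j k k' by simp
      qed
      also have "\<dots> \<le> \<theta> * ?b + \<eta>" using K' k k' i by simp
      also have "\<theta> * ?b + \<eta> = \<theta> ^ Suc m * b1 + \<eta> / (1 - \<theta>)" using \<theta> by (simp add: field_simps)
      finally show ?thesis using k by simp
    qed
    then show ?case unfolding eventually_sequentially by blast
  qed
  have "(\<lambda>k. g i (int k)) \<longlonglongrightarrow> 0"
  proof (rule order_tendstoI)
    fix a :: real assume "a < 0"
    then show "\<forall>\<^sub>F k in sequentially. a < g i (int k)"
      using q[OF i] by (intro always_eventually) (auto simp: g_def intro: less_le_trans)
  next
    fix a :: real assume a: "0 < a"
    have "(\<lambda>m. \<theta> ^ m * b1) \<longlonglongrightarrow> 0 * b1"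
      using \<theta> by (intro tendsto_mult LIMSEQ_power_zero) auto
    then have "\<forall>\<^sub>F m in sequentially. \<theta> ^ m * b1 < a / 2" using a by (intro order_tendstoD) auto
    then obtain m where m: "\<theta> ^ m * b1 < a / 2" unfolding eventually_sequentially by auto
    \<comment> \<open>This value of \<open>\<eta>\<close> makes the constant summand
      \<open>a / 2\<close>.\<close>
    have "0 < a / 2 * (1 - \<theta>)" using a \<theta> by simp
    from ev[OF this, of m] show "\<forall>\<^sub>F k in sequentially. g i (int k) < a"
    proof (rule eventually_mono)
      fix k assume "\<forall>i\<in>I. g i (int k) \<le> \<theta> ^ m * b1 + a / 2 * (1 - \<theta>) / (1 - \<theta>)"
      then have "g i (int k) \<le> \<theta> ^ m * b1 + a / 2 * (1 - \<theta>) / (1 - \<theta>)" using i by blast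
      moreover have "a / 2 * (1 - \<theta>) / (1 - \<theta>) = a / 2" by (rule nonzero_mult_div_cancel_right) (use \<theta> in simp)
      ultimately have "g i (int k) \<le> \<theta> ^ m * b1 + a / 2" by argo
      then show "g i (int k) < a" using m by linarith
    qed
  qed
  then have "(\<lambda>k. g i (int k) * q i) \<longlonglongrightarrow> 0 * q i" by (intro tendsto_intros)
  then have "(\<lambda>k. cmod (f i (int k))) \<longlonglongrightarrow> 0" using fin[OF i] by simp
  then show ?thesis by (rule tendsto_norm_zero_cancel)
qed

text \<open>Polymorphic version of \<open>tendsto_zero_vec\<close>, needed because the triangular
  coordinates are complex.\<close>

definition vanishing :: "nat \<Rightarrow> (nat \<Rightarrow> 'a :: real_normed_field vec) \<Rightarrow> bool" where
  "vanishing d w \<longleftrightarrow> (\<forall>l<d. (\<lambda>k. w k $ l) \<longlonglongrightarrow> 0)"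

lemma vanishing_mult_mat_vec:
  assumes M: "M \<in> carrier_mat r d" and "\<And>k. w k \<in> carrier_vec d" and w: "vanishing d w"
  shows "vanishing r (\<lambda>k. M *v w k)"
  unfolding vanishing_def
proof (intro allI impI)
  fix l assume l: "l < r"
  have "(\<lambda>k. \<Sum>i<d. M $$ (l, i) * w k $ i) \<longlonglongrightarrow> (\<Sum>i<d. M $$ (l, i) * 0)"
    using w by (intro tendsto_intros) (auto simp: vanishing_def)
  then show "(\<lambda>k. (M *v w k) $ l) \<longlonglongrightarrow> 0"
    using mult_mat_vec_index[OF M assms(2) l] by simp
qed

lemma filterlim_int_diff:
  fixes f :: "int \<Rightarrow> 'a :: real_normed_vector"
  assumes "(\<lambda>k. f (int k)) \<longlonglongrightarrow> L"
  shows "(\<lambda>k. f (int k - int c)) \<longlonglongrightarrow> L"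
proof (rule LIMSEQ_offset[of _ c])
  show "(\<lambda>k. f (int (k + c) - int c)) \<longlonglongrightarrow> L" using assms by simp
qed

text \<open>Row \<open>l\<close> of an upper triangular \<open>T\<close> contains only coordinates
  from \<open>l\<close> on. Once the later ones vanish they are a vanishing perturbation of a scalar
  recursion with factor \<open>T $$ (l, l)\<close>. However large the entries above the diagonal
  are, the contraction has to beat only the diagonal.\<close>

lemma delayed_triangular_vanishing:
  fixes f :: "'i \<Rightarrow> int \<Rightarrow> complex vec" and \<kappa> :: "'i \<Rightarrow> 'i \<Rightarrow> nat"
  assumes I: "finite I" and D: "\<And>i j. i \<in> I \<Longrightarrow> j \<in> I \<Longrightarrow> 0 \<le> D i j"
    and q: "\<And>i. i \<in> I \<Longrightarrow> 0 < q i" and \<theta>: "0 \<le> \<theta>" "\<theta> < 1"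
    and T: "T \<in> carrier_mat d d" "upper_triangular T"
    and contr: "\<And>i l. i \<in> I \<Longrightarrow> l < d \<Longrightarrow> cmod (T $$ (l, l)) * (\<Sum>j\<in>I. D i j * q j) \<le> \<theta> * q i"
    and lim: "\<And>i. i \<in> I \<Longrightarrow> vanishing d (\<lambda>k. f i (int (Suc k)) -
      T *v wsum d I (\<lambda>j. of_real (D i j)) (\<lambda>j. f j (int k - int (\<kappa> i j))))"
    and f: "\<And>i t. i \<in> I \<Longrightarrow> f i t \<in> carrier_vec d"
  shows "\<forall>i\<in>I. vanishing d (\<lambda>k. f i (int k))"
proof -
  let ?s = "\<lambda>i k l. \<Sum>j\<in>I. of_real (D i j) * f j (int k - int (\<kappa> i j)) $ l"
  have "\<forall>i\<in>I. (\<lambda>k. f i (int k) $ l) \<longlonglongrightarrow> 0" if "l < d" for l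
    using that
  \<comment> \<open>From the last coordinate to the first.\<close>
  proof (induction "d - l" arbitrary: l rule: less_induct)
    case less
    have upper: "(\<lambda>k. ?s i k l') \<longlonglongrightarrow> 0" if "l < l'" "l' < d" "i \<in> I" for l' i
    proof -
      have "\<forall>j\<in>I. (\<lambda>k. f j (int k) $ l') \<longlonglongrightarrow> 0" using less.hyps[of l'] that less.prems by simp
      then have "(\<lambda>k. ?s i k l') \<longlonglongrightarrow> (\<Sum>j\<in>I. of_real (D i j) * 0)"
        using filterlim_int_diff[of "\<lambda>t. f _ t $ l'"] by (intro tendsto_intros) blast
      then show ?thesis by simp
    qed
    show ?case
    proof
      fix i assume i: "i \<in> I"
      show "(\<lambda>k. f i (int k) $ l) \<longlonglongrightarrow> 0"
      proof (rule delayed_contraction_tendsto_0[where f = "\<lambda>i t. f i t $ l" and q = q and \<theta> = \<theta>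
            and D = D and \<kappa> = \<kappa> and z = "T $$ (l, l)", OF I D q \<theta> _ _ i])
        fix i assume i: "i \<in> I"
        show "cmod (T $$ (l, l)) * (\<Sum>j\<in>I. D i j * q j) \<le> \<theta> * q i" by (rule contr[OF i less.prems])
        let ?w = "\<lambda>k. f i (int (Suc k)) - T *v wsum d I (\<lambda>j. of_real (D i j)) (\<lambda>j. f j (int k - int (\<kappa> i j)))"
        have eq: "f i (int (Suc k)) $ l - T $$ (l, l) * ?s i k l
            = ?w k $ l + (\<Sum>l'\<in>{l<..<d}. T $$ (l, l') * ?s i k l')" for k
        proof -
          have "(T *v wsum d I (\<lambda>j. of_real (D i j)) (\<lambda>j. f j (int k - int (\<kappa> i j)))) $ l
              = (\<Sum>l'<d. T $$ (l, l') * ?s i k l')"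
            using mult_mat_vec_index[OF T(1) wsum_carrier less.prems] by simp
          also have "\<dots> = (\<Sum>l'\<in>{l..<d}. T $$ (l, l') * ?s i k l')"
            using T less.prems by (intro sum.mono_neutral_right) (auto simp: upper_triangular_def)
          also have "\<dots> = T $$ (l, l) * ?s i k l + (\<Sum>l'\<in>{l<..<d}. T $$ (l, l') * ?s i k l')"
            using less.prems by (subst sum.remove[of _ l]) (auto intro!: sum.cong)
          finally show ?thesis using f[OF i] T less.prems by simp
        qed
        have "(\<lambda>k. ?w k $ l + (\<Sum>l'\<in>{l<..<d}. T $$ (l, l') * ?s i k l'))
            \<longlonglongrightarrow> 0 + (\<Sum>l'\<in>{l<..<d}. T $$ (l, l') * 0)"
          using lim[OF i] less.prems upper i by (intro tendsto_intros) (auto simp: vanishing_def)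
        then show "(\<lambda>k. f i (int (Suc k)) $ l - T $$ (l, l) * ?s i k l) \<longlonglongrightarrow> 0"
          unfolding eq by simp
      qed
    qed
  qed
  then show ?thesis by (auto simp: vanishing_def)
qed

section \<open>Reduction of real networks to complex triangular ones\<close>

abbreviation cmat :: "real mat \<Rightarrow> complex mat" where "cmat \<equiv> map_mat complex_of_real"
abbreviation cvec :: "real vec \<Rightarrow> complex vec" where "cvec \<equiv> map_vec complex_of_real"

lemma cvec_minus: "v \<in> carrier_vec d \<Longrightarrow> w \<in> carrier_vec d \<Longrightarrow> cvec (v - w) = cvec v - cvec w"
  by (intro eq_vecI) auto

lemma vanishing_cvec_iff:
  assumes "\<And>k. w k \<in> carrier_vec d"
  shows "vanishing d (\<lambda>k. cvec (w k)) \<longleftrightarrow> vanishing d w"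
proof -
  have "(\<lambda>k. cvec (w k) $ l) = (\<lambda>k. of_real (w k $ l))" if "l < d" for l
    using that carrier_vecD[OF assms] by auto
  moreover have "(\<lambda>k. of_real (w k $ l) :: complex) \<longlonglongrightarrow> 0 \<longleftrightarrow> (\<lambda>k. w k $ l) \<longlonglongrightarrow> 0" for l
    using tendsto_of_real_iff[of "\<lambda>k. w k $ l" 0 sequentially] by simp
  ultimately show ?thesis by (simp add: vanishing_def)
qed

lemma schur_triangularization:
  assumes A: "(A :: complex mat) \<in> carrier_mat d d"
  obtains T P Q where "T \<in> carrier_mat d d" "P \<in> carrier_mat d d" "Q \<in> carrier_mat d d"
    "upper_triangular T" "P * Q = 1\<^sub>m d" "Q * P = 1\<^sub>m d" "A = P * T * Q"
    "\<And>l. l < d \<Longrightarrow> eigenvalue A (T $$ (l, l))"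
proof -
  obtain es where es: "char_poly A = (\<Prod>a\<leftarrow>es. [:- a, 1:])" using char_poly_factorized[OF A] by blast
  obtain T P Q where TPQ: "schur_decomposition A es = (T, P, Q)" by (metis prod_cases3)
  from schur_decomposition[OF A es TPQ]
  have sim: "similar_mat_wit A T P Q" and ut: "upper_triangular T" and diag: "diag_mat T = es" by auto
  note w = similar_mat_witD2[OF A sim]
  have "eigenvalue A (T $$ (l, l))" if "l < d" for l
  proof -
    have "T $$ (l, l) \<in> set es" using that w(5) diag unfolding diag_mat_def by force
    then have "poly (char_poly A) (T $$ (l, l)) = 0" unfolding es by (induction es) auto
    then show ?thesis using eigenvalue_root_char_poly[OF A] by simp
  qed
  then show ?thesis using that[of T P Q] w ut by auto
qed

text \<open>The hypothesis \<open>contr\<close> weighs eigenvalues against the averaging instead of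
  bounding them separately. It thus covers both uses: eigenvalues in the closed disc with a strictly
  contracting \<open>D\<close>, and a Schur stable matrix with trivial averaging.\<close>

lemma delayed_network_vanishing:
  fixes e :: "'i \<Rightarrow> int \<Rightarrow> real vec" and \<kappa> :: "'i \<Rightarrow> 'i \<Rightarrow> nat"
  assumes I: "finite I" and D: "\<And>i j. i \<in> I \<Longrightarrow> j \<in> I \<Longrightarrow> 0 \<le> D i j"
    and q: "\<And>i. i \<in> I \<Longrightarrow> 0 < q i"
    and A: "A \<in> carrier_mat d d"
    and contr: "\<And>i z. i \<in> I \<Longrightarrow> eigenvalue (cmat A) z \<Longrightarrow> cmod z * (\<Sum>j\<in>I. D i j * q j) < q i"
    and lim: "\<And>i. i \<in> I \<Longrightarrow> vanishing d (\<lambda>k. e i (int (Suc k)) -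
      A *v wsum d I (D i) (\<lambda>j. e j (int k - int (\<kappa> i j))))"
    and e: "\<And>i t. i \<in> I \<Longrightarrow> e i t \<in> carrier_vec d"
    and i: "i \<in> I"
  shows "vanishing d (\<lambda>k. e i (int k))"
proof -
  have cA: "cmat A \<in> carrier_mat d d" using A by simp
  obtain T P Q where T: "T \<in> carrier_mat d d" "upper_triangular T"
    and P: "P \<in> carrier_mat d d" and Q: "Q \<in> carrier_mat d d"
    and PQ: "P * Q = 1\<^sub>m d" "Q * P = 1\<^sub>m d" and AT: "cmat A = P * T * Q"
    and ev: "\<And>l. l < d \<Longrightarrow> eigenvalue (cmat A) (T $$ (l, l))"
    using schur_triangularization[OF cA] by metis
  have QA: "Q * cmat A = T * Q"
  proof -
    have "Q * cmat A = (Q * P) * (T * Q)" 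
      unfolding AT using P Q T by (simp add: assoc_mult_mat[of _ d d _ d _ d])
    then show ?thesis using PQ T Q by simp
  qed
  \<comment> \<open>There are finitely many agents and diagonal entries, so the strict inequalities
    hold with a common factor below 1. Inserting 0 keeps the maximum meaningful for
    \<open>d = 0\<close> and makes it nonnegative.\<close>
  define \<theta> where "\<theta> = Max (insert 0 ((\<lambda>(i, l). cmod (T $$ (l, l)) * (\<Sum>j\<in>I. D i j * q j) / q i) ` (I \<times> {..<d})))"
  have \<theta>0: "0 \<le> \<theta>" unfolding \<theta>_def using I by (intro Max_ge) auto
  have \<theta>1: "\<theta> < 1" unfolding \<theta>_def using I contr ev q by (subst Max_less_iff) auto
  have \<theta>: "cmod (T $$ (l, l)) * (\<Sum>j\<in>I. D i j * q j) \<le> \<theta> * q i" if "i \<in> I" "l < d" for i l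
  proof -
    have "cmod (T $$ (l, l)) * (\<Sum>j\<in>I. D i j * q j) / q i \<le> \<theta>"
      unfolding \<theta>_def using I that by (intro Max_ge) force+
    then show ?thesis using q[OF that(1)] by (simp add: field_simps)
  qed
  define f where "f i t = Q *v cvec (e i t)" for i t
  have ce: "cvec (e i t) \<in> carrier_vec d" if "i \<in> I" for i t using e[OF that] by simp
  have f: "f i t \<in> carrier_vec d" if "i \<in> I" for i t using ce[OF that] Q by (simp add: f_def)
  have "\<forall>i\<in>I. vanishing d (\<lambda>k. f i (int k))"
  proof (rule delayed_triangular_vanishing[where D = D and \<kappa> = \<kappa>, OF I D q \<theta>0 \<theta>1 T \<theta> _ f])
    fix i assume i: "i \<in> I"
    let ?s = "\<lambda>k. wsum d I (D i) (\<lambda>j. e j (int k - int (\<kappa> i j)))"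
    let ?w = "\<lambda>k. e i (int (Suc k)) - A *v ?s k"
    have "f i (int (Suc k)) - T *v wsum d I (\<lambda>j. of_real (D i j)) (\<lambda>j. f j (int k - int (\<kappa> i j)))
        = Q *v cvec (?w k)" for k
    proof -
      \<comment> \<open>The averaging acts on the agent index by scalars, so it commutes with the
        change of coordinates \<open>Q\<close> in the state space.\<close>
      have "wsum d I (\<lambda>j. of_real (D i j)) (\<lambda>j. f j (int k - int (\<kappa> i j)))
          = Q *v wsum d I (\<lambda>j. of_real (D i j)) (\<lambda>j. cvec (e j (int k - int (\<kappa> i j))))"
        unfolding f_def by (rule mult_mat_vec_wsum[OF Q ce, symmetric])
      also have "wsum d I (\<lambda>j. of_real (D i j)) (\<lambda>j. cvec (e j (int k - int (\<kappa> i j)))) = cvec (?s k)"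
      proof (rule eq_vecI)
        fix l assume l: "l < dim_vec (cvec (?s k))"
        have "cvec (e j (int k - int (\<kappa> i j))) $ l = of_real (e j (int k - int (\<kappa> i j)) $ l)"
          if "j \<in> I" for j using e[OF that, of "int k - int (\<kappa> i j)"] l by (simp add: wsum_def)
        then show "wsum d I (\<lambda>j. of_real (D i j)) (\<lambda>j. cvec (e j (int k - int (\<kappa> i j)))) $ l
            = cvec (?s k) $ l"
          using l by (simp add: wsum_def cong: sum.cong)
      qed (simp add: wsum_def)
      finally have "T *v wsum d I (\<lambda>j. of_real (D i j)) (\<lambda>j. f j (int k - int (\<kappa> i j)))
          = (T * Q) *v cvec (?s k)" using T Q by simp
      also have "\<dots> = Q *v (cmat A *v cvec (?s k))"
        unfolding QA[symmetric] by (rule assoc_mult_mat_vec[OF Q cA]) simp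
      also have "cmat A *v cvec (?s k) = cvec (A *v ?s k)"
        by (rule of_real_hom.mult_mat_vec_hom[OF A wsum_carrier, symmetric])
      finally have *: "T *v wsum d I (\<lambda>j. of_real (D i j)) (\<lambda>j. f j (int k - int (\<kappa> i j)))
          = Q *v cvec (A *v ?s k)" .
      have As: "A *v ?s k \<in> carrier_vec d" by (rule mult_mat_vec_carrier[OF A]) simp
      have "cvec (?w k) = cvec (e i (int (Suc k))) - cvec (A *v ?s k)"
        by (rule cvec_minus[OF e[OF i] As])
      then show ?thesis unfolding * unfolding f_def
        using mult_minus_distrib_mat_vec[OF Q ce[OF i], of "cvec (A *v ?s k)"] As by simp
    qed
    moreover have "vanishing d (\<lambda>k. Q *v cvec (?w k))"
    proof (rule vanishing_mult_mat_vec[OF Q])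
      have w: "?w k \<in> carrier_vec d" for k
        using e[OF i] mult_mat_vec_carrier[OF A, of "?s k"] by simp
      then show "cvec (?w k) \<in> carrier_vec d" for k by simp
      show "vanishing d (\<lambda>k. cvec (?w k))" using lim[OF i] vanishing_cvec_iff[of ?w, OF w] by simp
    qed
    ultimately show "vanishing d (\<lambda>k. f i (int (Suc k)) -
        T *v wsum d I (\<lambda>j. of_real (D i j)) (\<lambda>j. f j (int k - int (\<kappa> i j))))" by simp
  qed
  then have "vanishing d (\<lambda>k. P *v f i (int k))"
    using i f by (intro vanishing_mult_mat_vec[OF P]) auto
  moreover have "P *v f i t = cvec (e i t)" for t
  proof -
    have "P *v f i t = (P * Q) *v cvec (e i t)" unfolding f_def
      by (rule assoc_mult_mat_vec[OF P Q ce[OF i], symmetric])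
    then show ?thesis using PQ ce[OF i] by simp
  qed
  ultimately have "vanishing d (\<lambda>k. cvec (e i (int k)))" by simp
  then show ?thesis using vanishing_cvec_iff[of "\<lambda>k. e i (int k)", OF e[OF i]] by simp
qed

section \<open>The network\<close>

definition coupling :: "nat \<Rightarrow> (nat \<Rightarrow> nat \<Rightarrow> real) \<Rightarrow> nat set \<Rightarrow> nat \<Rightarrow> nat \<Rightarrow> real" where
  "coupling N a \<C> i j = expanded_laplacian N a \<C> i j / (2 + in_degree N a i)"

definition averaging :: "nat \<Rightarrow> (nat \<Rightarrow> nat \<Rightarrow> real) \<Rightarrow> nat set \<Rightarrow> nat \<Rightarrow> nat \<Rightarrow> real" where
  "averaging N a \<C> i j = (if i = j then 1 else 0) - coupling N a \<C> i j"

lemma network_measurement_wsum: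
  "network_measurement d N a \<C> \<kappa> s i k =
    wsum d {1..N} (coupling N a \<C> i) (\<lambda>j. s j (int k - int (\<kappa> i j)))"
  by (rule eq_vecI)
    (simp_all add: network_measurement_def wsum_def coupling_def sum_distrib_left mult.assoc)

lemma in_degree_nonneg:
  assumes "weighted_digraph N a" "i \<in> {1..N}"
  shows "0 \<le> in_degree N a i"
  using assms unfolding weighted_digraph_def in_degree_def by (intro sum_nonneg) auto

text \<open>The diagonal entry of the expanded Laplacian exceeds the in-degree by at most 1, which
  the 2 in the denominator absorbs. Off the diagonal the Laplacian has the opposite sign of the
  weights.\<close>

lemma averaging_nonneg:
  assumes "weighted_digraph N a" "i \<in> {1..N}" "j \<in> {1..N}"
  shows "0 \<le> averaging N a \<C> i j"
proof -
  have d: "0 \<le> in_degree N a i" by (rule in_degree_nonneg[OF assms(1,2)])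
  have "expanded_laplacian N a \<C> i i \<le> 2 + in_degree N a i"
    by (simp add: expanded_laplacian_def laplacian_def in_degree_def)
  then show ?thesis
    using assms d unfolding weighted_digraph_def averaging_def coupling_def
    by (auto simp: expanded_laplacian_def laplacian_def divide_le_eq_1)
qed

text \<open>Written through differences across edges, a row can be estimated edge by edge.\<close>

lemma sum_expanded_laplacian:
  assumes "weighted_digraph N a" "i \<in> {1..N}"
  shows "(\<Sum>j=1..N. expanded_laplacian N a \<C> i j * q j) =
    (\<Sum>j=1..N. a i j * (q i - q j)) + (if i \<in> \<C> then q i else 0)"
proof -
  have "(\<Sum>j=1..N. expanded_laplacian N a \<C> i j * q j) =
    (\<Sum>j=1..N. (if i = j then in_degree N a i * q i + (if i \<in> \<C> then q i else 0) else 0) - a i j * q j)"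
    using assms unfolding weighted_digraph_def
    by (intro sum.cong) (auto simp: expanded_laplacian_def laplacian_def in_degree_def algebra_simps)
  also have "\<dots> = in_degree N a i * q i + (if i \<in> \<C> then q i else 0) - (\<Sum>j=1..N. a i j * q j)"
    using assms(2) by (subst sum_subtractf) (simp add: sum.delta')
  also have "in_degree N a i * q i = (\<Sum>j=1..N. a i j * q i)"
    by (simp add: in_degree_def sum_distrib_right)
  finally show ?thesis by (simp add: right_diff_distrib sum_subtractf)
qed

text \<open>\<open>\<delta>\<close> is the distance from the nearest root; the last edge of a
  shortest path starts at a closer agent.\<close>

lemma graph_set_rank:
  assumes "a \<in> graph_set \<C> N"
  obtains \<delta> :: "nat \<Rightarrow> nat" where
    "\<And>i. i \<in> {1..N} \<Longrightarrow> i \<in> \<C> \<or> (\<exists>j\<in>{1..N}. 0 < a i j \<and> \<delta> j < \<delta> i)"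
proof -
  define R where "R k i \<longleftrightarrow> (\<exists>r\<in>\<C>. (r, i) \<in> edges N a ^^ k)" for k i
  define \<delta> where "\<delta> i = (LEAST k. R k i)" for i
  have reach: "\<exists>k. R k i" if i: "i \<in> {1..N}" for i
  proof -
    obtain V E r where VE: "E \<subseteq> edges N a" "directed_tree V E r" "r \<in> \<C>" "i \<in> V"
      using assms i unfolding graph_set_def by blast
    then have "(r, i) \<in> E\<^sup>*" unfolding directed_tree_def by blast
    then have "(r, i) \<in> (edges N a)\<^sup>*" using rtrancl_mono[OF VE(1)] by blast
    then show ?thesis using VE(3) unfolding R_def rtrancl_power by blast
  qed
  show ?thesis
  proof (rule that[of \<delta>])
    fix i assume i: "i \<in> {1..N}"
    have Ri: "R (\<delta> i) i" unfolding \<delta>_def using reach[OF i] by (rule LeastI_ex)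
    show "i \<in> \<C> \<or> (\<exists>j\<in>{1..N}. 0 < a i j \<and> \<delta> j < \<delta> i)"
    proof (cases "\<delta> i")
      case 0
      then show ?thesis using Ri by (simp add: R_def)
    next
      case (Suc k)
      then obtain j where j: "R k j" "(j, i) \<in> edges N a"
        using Ri unfolding R_def by (auto elim: relpow_Suc_E)
      have "\<delta> j \<le> k" unfolding \<delta>_def using j(1) by (rule Least_le)
      then show ?thesis using Suc j(2) by (auto simp: edges_def)
    qed
  qed
qed

text \<open>Weights that increase so slowly away from the roots that one edge from a closer agent
  outweighs all edges from agents farther away.\<close>

lemma averaging_weights:
  assumes a: "a \<in> graph_set \<C> N"
  obtains q :: "nat \<Rightarrow> real" where "\<And>i. i \<in> {1..N} \<Longrightarrow> 0 < q i"
    "\<And>i. i \<in> {1..N} \<Longrightarrow> (\<Sum>j=1..N. averaging N a \<C> i j * q j) < q i"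
proof -
  have wd: "weighted_digraph N a" using a by (simp add: graph_set_def)
  have a0: "0 \<le> a i j" if "i \<in> {1..N}" "j \<in> {1..N}" for i j
    using wd that by (simp add: weighted_digraph_def)
  obtain \<delta> :: "nat \<Rightarrow> nat" where
    \<delta>: "\<And>i. i \<in> {1..N} \<Longrightarrow> i \<in> \<C> \<or> (\<exists>j\<in>{1..N}. 0 < a i j \<and> \<delta> j < \<delta> i)"
    using graph_set_rank[OF a] by metis
  \<comment> \<open>\<open>m\<close> is the least positive weight, capped at 1, which also covers a
    graph without edges. \<open>M\<close> exceeds each in-degree by at least 1.\<close>
  define m where "m = Min (insert 1 {a i j | i j. i \<in> {1..N} \<and> j \<in> {1..N} \<and> 0 < a i j})"
  define M where "M = (\<Sum>i=1..N. in_degree N a i) + 1"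
  have fin: "finite {a i j | i j. i \<in> {1..N} \<and> j \<in> {1..N} \<and> 0 < a i j}"
    by (rule finite_subset[of _ "(\<lambda>(i, j). a i j) ` ({1..N} \<times> {1..N})"]) auto
  have m0: "0 < m" and m1: "m \<le> 1" using fin by (auto simp: m_def)
  have m: "m \<le> a i j" if "i \<in> {1..N}" "j \<in> {1..N}" "0 < a i j" for i j
    unfolding m_def using fin that by (intro Min_le) auto
  have dM: "in_degree N a i + 1 \<le> M" if "i \<in> {1..N}" for i
    using member_le_sum[of i "{1..N}" "in_degree N a"] that in_degree_nonneg[OF wd] by (simp add: M_def)
  have M1: "1 \<le> M" 
    using sum_nonneg[of "{1..N}" "in_degree N a"] in_degree_nonneg[OF wd] by (simp add: M_def)
  \<comment> \<open>Chosen so that \<open>M * \<epsilon> = m / 2\<close>: crossing an edge towards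
    the roots gains a factor \<open>1 / \<epsilon>\<close>, which beats all other incoming edges
    together.\<close>
  define \<epsilon> where "\<epsilon> = m / (2 * M)"
  have "m < 2 * M" using m1 M1 by linarith
  then have e0: "0 < \<epsilon>" and e1: "\<epsilon> < 1" using m0 M1 by (auto simp: \<epsilon>_def)
  have em: "M * \<epsilon> = m / 2" using M1 by (simp add: \<epsilon>_def)
  \<comment> \<open>The exponent is at least 1 so that \<open>q\<close> is positive even at distance
    0.\<close>
  define q where "q i = 1 - \<epsilon> ^ Suc (\<delta> i)" for i
  have q0: "0 < q i" for i unfolding q_def using e0 e1 power_Suc_less_one[of \<epsilon>] by simp
  have q1: "q i < 1" for i unfolding q_def using e0 by simp
  have qe: "1 - \<epsilon> \<le> q i" for i
    unfolding q_def using e0 e1 power_decreasing[of 1 "Suc (\<delta> i)" \<epsilon>] by simp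
  have pos: "0 < (\<Sum>j=1..N. expanded_laplacian N a \<C> i j * q j)" if i: "i \<in> {1..N}" for i
  proof (cases "i \<in> \<C>")
    case True
    \<comment> \<open>At a root the edges lose at most \<open>M * \<epsilon> - \<epsilon>\<close>,
      while the root term contributes \<open>q i\<close>, which is at least
      \<open>1 - \<epsilon>\<close>.\<close>
    have "(\<Sum>j=1..N. a i j * (- \<epsilon>)) \<le> (\<Sum>j=1..N. a i j * (q i - q j))"
    proof (intro sum_mono mult_left_mono a0 i)
      fix j assume "j \<in> {1..N}"
      show "- \<epsilon> \<le> q i - q j" using qe[of i] q1[of j] by linarith
    qed
    moreover have "(\<Sum>j=1..N. a i j * (- \<epsilon>)) = - (in_degree N a i * \<epsilon>)"
      by (simp add: in_degree_def sum_distrib_right sum_negf)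
    moreover have "(in_degree N a i + 1) * \<epsilon> \<le> M * \<epsilon>" using dM[OF i] e0 by (simp add: mult_right_mono)
    ultimately show ?thesis
      unfolding sum_expanded_laplacian[OF wd i] using True qe[of i] em m1 m0
      by (simp add: algebra_simps)
  next
    case False
    then obtain j0 where j0: "j0 \<in> {1..N}" "0 < a i j0" "\<delta> j0 < \<delta> i" using \<delta>[OF i] by blast
    let ?p = "\<epsilon> ^ Suc (\<delta> i)"
    have p0: "0 < ?p" using e0 by simp
    have lower: "- ?p \<le> q i - q j" for j using q1[of j] by (simp add: q_def)
    \<comment> \<open>Being one step closer makes the defect \<open>1 - q j0\<close> larger than
      \<open>?p\<close> by a factor of at least \<open>1 / \<epsilon>\<close>.\<close>
    have "?p \<le> \<epsilon> * \<epsilon> ^ Suc (\<delta> j0)"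
      using power_decreasing[of "Suc (Suc (\<delta> j0))" "Suc (\<delta> i)" \<epsilon>] j0(3) e0 e1 by simp
    then have "?p / \<epsilon> - ?p \<le> q i - q j0" using e0 by (simp add: q_def field_simps)
    then have "m * (?p / \<epsilon> - ?p) \<le> a i j0 * (q i - q j0)"
      using m[OF i j0(1,2)] m0 e0 e1 p0 by (intro mult_mono) (auto simp: field_simps)
    moreover have "(\<Sum>j\<in>{1..N} - {j0}. a i j * (- ?p)) \<le> (\<Sum>j\<in>{1..N} - {j0}. a i j * (q i - q j))"
      using lower by (intro sum_mono mult_left_mono a0 i) auto
    moreover have "(\<Sum>j\<in>{1..N} - {j0}. a i j * (- ?p)) = - ((\<Sum>j\<in>{1..N} - {j0}. a i j) * ?p)"
      by (simp add: sum_distrib_right sum_negf)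
    moreover have "(\<Sum>j\<in>{1..N} - {j0}. a i j) * ?p \<le> (M - m) * ?p"
    proof (rule mult_right_mono)
      have "(\<Sum>j\<in>{1..N} - {j0}. a i j) = in_degree N a i - a i j0"
        using j0(1) by (simp add: in_degree_def sum_diff1)
      then show "(\<Sum>j\<in>{1..N} - {j0}. a i j) \<le> M - m"
        using dM[OF i] m[OF i j0(1,2)] by linarith
    qed (use p0 in simp)
    \<comment> \<open>Gain of the edge from \<open>j0\<close> minus the worst loss on the others;
      here \<open>m / \<epsilon> = 2 * M\<close> enters.\<close>
    moreover have "m * (?p / \<epsilon> - ?p) - (M - m) * ?p = M * ?p"
      using e0 em by (simp add: field_simps \<epsilon>_def)
    moreover have "0 < M * ?p" using M1 p0 by simp
    ultimately have "0 < a i j0 * (q i - q j0) + (\<Sum>j\<in>{1..N} - {j0}. a i j * (q i - q j))"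
      by linarith
    also have "\<dots> = (\<Sum>j=1..N. a i j * (q i - q j))"
      using j0(1) by (subst sum.remove[of "{1..N}" j0]) auto
    finally show ?thesis unfolding sum_expanded_laplacian[OF wd i] using False by simp
  qed
  show ?thesis
  proof (rule that[of q])
    fix i assume i: "i \<in> {1..N}"
    have d: "0 < 2 + in_degree N a i" using in_degree_nonneg[OF wd i] by simp
    have "(\<Sum>j=1..N. averaging N a \<C> i j * q j)
        = (\<Sum>j=1..N. (if i = j then q i else 0) - expanded_laplacian N a \<C> i j * q j / (2 + in_degree N a i))"
      by (intro sum.cong) (auto simp: averaging_def coupling_def algebra_simps)
    also have "\<dots> = q i - (\<Sum>j=1..N. expanded_laplacian N a \<C> i j * q j) / (2 + in_degree N a i)"
      using i by (simp add: sum_subtractf sum_divide_distrib)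
    also have "\<dots> < q i" using pos[OF i] d by simp
    finally show "(\<Sum>j=1..N. averaging N a \<C> i j * q j) < q i" .
  qed (rule q0)
qed

section \<open>Schur stability and the observer-based protocol\<close>

text \<open>From here on products of a matrix and a vector stay opaque, so that vector identities
  can be checked entrywise as linear identities between them.\<close>

declare index_mult_mat_vec [simp del]

lemma vanishing_eventually_0:
  assumes "\<And>k. K \<le> k \<Longrightarrow> w k = 0\<^sub>v d"
  shows "vanishing d w"
  unfolding vanishing_def
proof (intro allI impI tendsto_eventually)
  fix l assume l: "l < d"
  show "\<forall>\<^sub>F k in sequentially. w k $ l = 0"
    using eventually_ge_at_top[of K] by eventually_elim (simp add: assms l)
qed

lemma vanishing_add:
  assumes "vanishing d v" "vanishing d w" "\<And>k. w k \<in> carrier_vec d"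
  shows "vanishing d (\<lambda>k. v k + w k)"
  unfolding vanishing_def
proof (intro allI impI)
  fix l assume l: "l < d"
  have "(\<lambda>k. v k $ l + w k $ l) \<longlonglongrightarrow> 0 + 0"
    using assms l by (intro tendsto_add) (auto simp: vanishing_def)
  then show "(\<lambda>k. (v k + w k) $ l) \<longlonglongrightarrow> 0"
    using l carrier_vecD[OF assms(3)] by simp
qed

lemma vanishing_minus:
  assumes "vanishing d v" "vanishing d w" "\<And>k. w k \<in> carrier_vec d"
  shows "vanishing d (\<lambda>k. v k - w k)"
  unfolding vanishing_def
proof (intro allI impI)
  fix l assume l: "l < d"
  have "(\<lambda>k. v k $ l - w k $ l) \<longlonglongrightarrow> 0 - 0"
    using assms l by (intro tendsto_diff) (auto simp: vanishing_def)
  then show "(\<lambda>k. (v k - w k) $ l) \<longlonglongrightarrow> 0"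
    using l carrier_vecD[OF assms(3)] by simp
qed

text \<open>A network with a single node, averaging weight 1 and no delay. Allowing a vanishing
  input makes cascades of stable systems one application each.\<close>

lemma schur_stable_vanishing:
  assumes M: "M \<in> carrier_mat d d" and st: "schur_stable M"
    and x: "\<And>k. x k \<in> carrier_vec d"
    and lim: "vanishing d (\<lambda>k. x (Suc k) - M *v x k)"
  shows "vanishing d x"
proof -
  have one: "wsum d {()} (\<lambda>_. 1) (\<lambda>_. v) = v" if "v \<in> carrier_vec d" for v :: "real vec"
    using that by (intro eq_vecI) (auto simp: wsum_def)
  have "vanishing d (\<lambda>k. x (nat (int k)))"
    by (rule delayed_network_vanishing[where I = "{()}" and D = "\<lambda>_ _. 1" and q = "\<lambda>_. 1" and A = M
          and e = "\<lambda>_ t. x (nat t)" and \<kappa> = "\<lambda>_ _. 0"])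
      (use M x lim st in \<open>auto simp: one schur_stable_def nat_add_distrib\<close>)
  then show ?thesis by simp
qed

text \<open>An eigenvector \<open>v\<close> for \<open>z\<close> yields the complex trajectory
  \<open>z ^ k\<close> times \<open>v\<close>, whose real and imaginary parts are real trajectories.
  If these vanish, some power of \<open>cmod z\<close> is below 1. This turns the stability of the
  extended closed loops into statements about trajectories, without computing spectra.\<close>

lemma schur_stableI:
  assumes M: "M \<in> carrier_mat d d"
    and traj: "\<And>x. (\<And>k. x k \<in> carrier_vec d) \<Longrightarrow> (\<And>k. x (Suc k) = M *v x k) \<Longrightarrow> vanishing d x"
  shows "schur_stable M"
  unfolding schur_stable_def
proof (intro allI impI)
  fix z assume "eigenvalue (cmat M) z"
  then obtain v where v: "v \<in> carrier_vec d" "v \<noteq> 0\<^sub>v d" "cmat M *v v = z \<cdot>\<^sub>v v"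
    using M unfolding eigenvalue_def eigenvector_def by auto
  have eig: "(\<Sum>i<d. of_real (M $$ (l, i)) * v $ i) = z * v $ l" if l: "l < d" for l
  proof -
    have "(cmat M *v v) $ l = (\<Sum>i<d. cmat M $$ (l, i) * v $ i)"
      using M v(1) l by (intro mult_mat_vec_index) auto
    then show ?thesis using M v l by simp
  qed
  \<comment> \<open>\<open>h\<close> stands for \<open>Re\<close> and \<open>Im\<close>; only
    additivity and real homogeneity matter.\<close>
  have part: "vanishing d (\<lambda>k. vec d (\<lambda>l. h (z ^ k * v $ l)))"
    if h: "\<And>(S :: nat set) g. h (sum g S) = (\<Sum>i\<in>S. h (g i :: complex))" "\<And>r w. h (of_real r * w) = r * h w"
    for h :: "complex \<Rightarrow> real"
  proof (rule traj)
    fix k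
    show "vec d (\<lambda>l. h (z ^ Suc k * v $ l)) = M *v vec d (\<lambda>l. h (z ^ k * v $ l))"
    proof (rule eq_vecI)
      fix l assume "l < dim_vec (M *v vec d (\<lambda>l. h (z ^ k * v $ l)))"
      then have l: "l < d" using M by simp
      have "h (z ^ Suc k * v $ l) = h (z ^ k * (\<Sum>i<d. of_real (M $$ (l, i)) * v $ i))"
        unfolding eig[OF l] by (simp add: mult_ac)
      also have "\<dots> = (\<Sum>i<d. h (of_real (M $$ (l, i)) * (z ^ k * v $ i)))"
        by (simp add: sum_distrib_left h(1) mult.left_commute)
      also have "\<dots> = (\<Sum>i<d. M $$ (l, i) * h (z ^ k * v $ i))" by (simp add: h(2))
      also have "\<dots> = (M *v vec d (\<lambda>l. h (z ^ k * v $ l))) $ l"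
        using M l by (subst mult_mat_vec_index[of _ d d]) auto
      finally show "vec d (\<lambda>l. h (z ^ Suc k * v $ l)) $ l = (M *v vec d (\<lambda>l. h (z ^ k * v $ l))) $ l"
        using l by simp
    qed (use M in auto)
  qed simp
  obtain l where l: "l < d" "v $ l \<noteq> 0"
    using v(1,2) by (metis carrier_vecD eq_vecI index_zero_vec)
  have "(\<lambda>k. Re (z ^ k * v $ l)) \<longlonglongrightarrow> 0" "(\<lambda>k. Im (z ^ k * v $ l)) \<longlonglongrightarrow> 0"
    using part[of Re] part[of Im] l(1) by (simp_all add: vanishing_def)
  then have "(\<lambda>k. z ^ k * v $ l) \<longlonglongrightarrow> 0" by (simp add: tendsto_complex_iff)
  from tendsto_divide[OF this tendsto_const[of "v $ l"]] l(2) have "(\<lambda>k. z ^ k) \<longlonglongrightarrow> 0" by simp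
  then have "\<forall>\<^sub>F k in sequentially. cmod (z ^ k) < 1"
    using order_tendstoD(2)[OF tendsto_norm] by fastforce
  then obtain k where "cmod z ^ k < 1" unfolding eventually_sequentially norm_power by blast
  then show "cmod z < 1" using one_le_power[of "cmod z" k] by linarith
qed

lemma wsum_diff:
  assumes "\<And>j. j \<in> I \<Longrightarrow> s j \<in> carrier_vec d" "\<And>j. j \<in> I \<Longrightarrow> s' j \<in> carrier_vec d"
  shows "wsum d I c (\<lambda>j. s j - s' j) = wsum d I c s - wsum d I c s'"
  using carrier_vecD[OF assms(1)] carrier_vecD[OF assms(2)]
  by (intro eq_vecI) (auto simp: wsum_def right_diff_distrib simp flip: sum_subtractf)

lemma wsum_averaging:
  assumes "i \<in> {1..N}" "s i \<in> carrier_vec d"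
  shows "wsum d {1..N} (averaging N a \<C> i) s = s i - wsum d {1..N} (coupling N a \<C> i) s"
proof (rule eq_vecI)
  fix l assume "l < dim_vec (s i - wsum d {1..N} (coupling N a \<C> i) s)"
  then have l: "l < d" by (simp add: wsum_def)
  have "averaging N a \<C> i j * s j $ l = (if i = j then s j $ l else 0) - coupling N a \<C> i j * s j $ l" for j
    by (simp add: averaging_def algebra_simps)
  then show "wsum d {1..N} (averaging N a \<C> i) s $ l
      = (s i - wsum d {1..N} (coupling N a \<C> i) s) $ l"
    using l assms by (simp add: wsum_def sum_subtractf)
qed (use assms in \<open>simp add: wsum_def\<close>)

text \<open>Up to the vanishing observer error, the difference between an agent and its exchanged variable
  obeys the delayed averaging dynamics.\<close>

lemma observer_protocol_vanishing:
  fixes xt chi :: "nat \<Rightarrow> int \<Rightarrow> real vec" and xh :: "nat \<Rightarrow> nat \<Rightarrow> real vec"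
  assumes A: "A \<in> carrier_mat d d" and G: "G \<in> carrier_mat d d"
    and F: "F \<in> carrier_mat d p" and C: "C \<in> carrier_mat p d"
    and stG: "schur_stable (A - G)" and stF: "schur_stable (A - F * C)"
    and disc: "eigenvalues_in_closed_disc A"
    and a: "a \<in> graph_set \<C> N" and \<kappa>: "delays N \<kappa>"
    and xt: "\<And>i t. i \<in> {1..N} \<Longrightarrow> xt i t \<in> carrier_vec d"
    and chi: "\<And>i t. i \<in> {1..N} \<Longrightarrow> chi i t \<in> carrier_vec d"
    and xh: "\<And>i k. i \<in> {1..N} \<Longrightarrow> xh i k \<in> carrier_vec d"
    and xt_step: "\<And>i k. i \<in> {1..N} \<Longrightarrow>
      xt i (int (Suc k)) = A *v xt i (int k) - G *v chi i (int k)"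
    and \<zeta>: "\<And>i k. i \<in> {1..N} \<Longrightarrow> \<zeta> i k =
      wsum d {1..N} (coupling N a \<C> i) (\<lambda>j. chi j (int k - int (\<kappa> i j)))"
    and xh_step: "\<And>i k. i \<in> {1..N} \<Longrightarrow> (\<And>j. j \<in> {1..N} \<Longrightarrow> \<kappa> i j \<le> k) \<Longrightarrow>
      xh i (Suc k) = A *v xh i k - G *v \<zeta> i k + F *v (C *v
        wsum d {1..N} (coupling N a \<C> i) (\<lambda>j. xt j (int k - int (\<kappa> i j))) - C *v xh i k)"
    and chi_step: "\<And>i k. i \<in> {1..N} \<Longrightarrow> chi i (int (Suc k)) =
      A *v chi i (int k) - G *v chi i (int k) + A *v xh i k - A *v \<zeta> i k"
    and i: "i \<in> {1..N}"
  shows "vanishing d (\<lambda>k. xt i (int k))"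
proof -
  let ?m = "\<lambda>i. coupling N a \<C> i"
  define \<eta> where "\<eta> i k = wsum d {1..N} (?m i) (\<lambda>j. xt j (int k - int (\<kappa> i j)))" for i k
  have \<eta>c [simp]: "\<eta> i k \<in> carrier_vec d" for i k by (simp add: \<eta>_def)
  have \<zeta>c: "\<zeta> i k \<in> carrier_vec d" if "i \<in> {1..N}" for i k using \<zeta>[OF that] by simp
  have wd: "weighted_digraph N a" using a by (simp add: graph_set_def)
  obtain \<kappa>m where \<kappa>m: "\<And>i j. i \<in> {1..N} \<Longrightarrow> j \<in> {1..N} \<Longrightarrow> \<kappa> i j \<le> \<kappa>m"
    using delays_bounded[of "{1..N}" \<kappa>, OF finite_atLeastAtMost] by blast
  note [simp] = mult_minus_distrib_mat_vec[OF A] mult_minus_distrib_mat_vec[OF G]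
    mult_minus_distrib_mat_vec[OF F] mult_minus_distrib_mat_vec[OF C]
  have Ac: "A *v v \<in> carrier_vec d" and Gc: "G *v v \<in> carrier_vec d"
    and Cc: "C *v v \<in> carrier_vec p" if "v \<in> carrier_vec d" for v using that A G C by (meson mult_mat_vec_carrier)+
  \<comment> \<open>The measurement inherits the agent dynamics because \<open>A\<close> and
    \<open>G\<close> are common to all agents. This starts at the largest delay: before it, delayed
    times may be negative, where nothing ties the history to the dynamics.\<close>
  have \<eta>_step: "\<eta> i (Suc k) = A *v \<eta> i k - G *v \<zeta> i k" if i: "i \<in> {1..N}" and k: "\<kappa>m \<le> k" for i k
  proof -
    have "xt j (int (Suc k) - int (\<kappa> i j)) =
        A *v xt j (int k - int (\<kappa> i j)) - G *v chi j (int k - int (\<kappa> i j))" if j: "j \<in> {1..N}" for j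
    proof -
      have "int (Suc k) - int (\<kappa> i j) = int (Suc (k - \<kappa> i j))" "int k - int (\<kappa> i j) = int (k - \<kappa> i j)"
        using \<kappa>m[OF i j] k by auto
      then show ?thesis by (simp only: xt_step[OF j])
    qed
    then have "\<eta> i (Suc k) = wsum d {1..N} (?m i) (\<lambda>j. A *v xt j (int k - int (\<kappa> i j))
        - G *v chi j (int k - int (\<kappa> i j)))"
      unfolding \<eta>_def by (rule wsum_cong)
    also have "\<dots> = wsum d {1..N} (?m i) (\<lambda>j. A *v xt j (int k - int (\<kappa> i j)))
        - wsum d {1..N} (?m i) (\<lambda>j. G *v chi j (int k - int (\<kappa> i j)))"
      by (rule wsum_diff) (use xt chi Ac Gc in auto)
    also have "wsum d {1..N} (?m i) (\<lambda>j. A *v xt j (int k - int (\<kappa> i j))) = A *v \<eta> i k"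
      unfolding \<eta>_def by (rule mult_mat_vec_wsum[OF A xt, symmetric])
    also have "wsum d {1..N} (?m i) (\<lambda>j. G *v chi j (int k - int (\<kappa> i j))) = G *v \<zeta> i k"
      unfolding \<zeta>[OF i] by (rule mult_mat_vec_wsum[OF G chi, symmetric])
    finally show ?thesis .
  qed
  \<comment> \<open>Observer error. The injection of \<open>G *v \<zeta>\<close> cancels, leaving
    the autonomous dynamics of \<open>A - F * C\<close> after the initial delay.\<close>
  define eh where "eh i k = \<eta> i k - xh i k" for i k
  have ehc: "eh i k \<in> carrier_vec d" if "i \<in> {1..N}" for i k using xh[OF that] by (simp add: eh_def)
  have FC: "F * C \<in> carrier_mat d d" using F C by simp
  have eh_van: "vanishing d (eh i)" if i: "i \<in> {1..N}" for i
  proof (rule schur_stable_vanishing[OF _ stF ehc[OF i]])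
    show "A - F * C \<in> carrier_mat d d" by (rule minus_carrier_mat[OF FC])
    show "vanishing d (\<lambda>k. eh i (Suc k) - (A - F * C) *v eh i k)"
    proof (rule vanishing_eventually_0)
      fix k assume k: "\<kappa>m \<le> k"
      have xs: "xh i (Suc k) = A *v xh i k - G *v \<zeta> i k + F *v (C *v \<eta> i k - C *v xh i k)"
        unfolding \<eta>_def using \<kappa>m[OF i] k by (intro xh_step[OF i]) (auto intro: le_trans)
      have "(A - F * C) *v eh i k = A *v eh i k - F *v (C *v eh i k)"
        using minus_mult_distrib_mat_vec[OF A FC ehc[OF i]] F C ehc[OF i] by simp
      then show "eh i (Suc k) - (A - F * C) *v eh i k = 0\<^sub>v d"
        using Cc[OF \<eta>c, of i k] Cc[OF xh[OF i], of k] xh[OF i, of k] A F G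
        unfolding eh_def \<eta>_step[OF i k] xs
        by (intro eq_vecI) auto
    qed
  qed
  define e where "e i t = xt i t - chi i t" for i t
  have ec: "e i t \<in> carrier_vec d" if "i \<in> {1..N}" for i t using xt[OF that] chi[OF that] by (simp add: e_def)
  obtain q :: "nat \<Rightarrow> real" where q: "\<And>i. i \<in> {1..N} \<Longrightarrow> 0 < q i"
    "\<And>i. i \<in> {1..N} \<Longrightarrow> (\<Sum>j=1..N. averaging N a \<C> i j * q j) < q i"
    using averaging_weights[OF a] by metis
  have e_van: "vanishing d (\<lambda>k. e i (int k))" if "i \<in> {1..N}" for i
  proof (rule delayed_network_vanishing[where I = "{1..N}" and D = "averaging N a \<C>" and q = q
        and A = A and \<kappa> = \<kappa>])
    fix i j assume "i \<in> {1..N}" "j \<in> {1..N}"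
    then show "0 \<le> averaging N a \<C> i j" by (rule averaging_nonneg[OF wd])
  next
    fix i z assume i: "i \<in> {1..N}" and z: "eigenvalue (cmat A) z"
    have "0 \<le> (\<Sum>j=1..N. averaging N a \<C> i j * q j)"
      using averaging_nonneg[OF wd i] q(1) by (intro sum_nonneg mult_nonneg_nonneg) (auto simp: less_imp_le)
    moreover have "cmod z \<le> 1" using disc z by (simp add: eigenvalues_in_closed_disc_def)
    ultimately have "cmod z * (\<Sum>j=1..N. averaging N a \<C> i j * q j) \<le> (\<Sum>j=1..N. averaging N a \<C> i j * q j)"
      by (simp add: mult_left_le_one_le)
    then show "cmod z * (\<Sum>j=1..N. averaging N a \<C> i j * q j) < q i" using q(2)[OF i] by linarith
  next
    fix i assume i: "i \<in> {1..N}"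
    \<comment> \<open>Agent and exchanged variable receive the same term in \<open>G\<close>, which
      drops out of \<open>e\<close>. The remaining \<open>\<zeta>\<close> and \<open>xh\<close>
      would form the averaging exactly if \<open>xh\<close> were \<open>\<eta>\<close>, so the
      defect is \<open>A *v eh\<close>.\<close>
    have "e i (int (Suc k)) - A *v wsum d {1..N} (averaging N a \<C> i) (\<lambda>j. e j (int k - int (\<kappa> i j)))
        = A *v eh i k" for k
    proof -
      \<comment> \<open>Without self-delay the identity part of \<open>D\<close> reads the current
        value of \<open>e i\<close>.\<close>
      have k0: "\<kappa> i i = 0" using \<kappa> i by (simp add: delays_def)
      have "wsum d {1..N} (averaging N a \<C> i) (\<lambda>j. e j (int k - int (\<kappa> i j)))
          = e i (int k) - wsum d {1..N} (?m i) (\<lambda>j. e j (int k - int (\<kappa> i j)))"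
        using wsum_averaging[OF i, of "\<lambda>j. e j (int k - int (\<kappa> i j))"] ec[OF i] k0 by simp
      also have "wsum d {1..N} (?m i) (\<lambda>j. e j (int k - int (\<kappa> i j))) = \<eta> i k - \<zeta> i k"
        unfolding e_def \<eta>_def \<zeta>[OF i] by (rule wsum_diff) (use xt chi in auto)
      finally have *: "wsum d {1..N} (averaging N a \<C> i) (\<lambda>j. e j (int k - int (\<kappa> i j)))
          = e i (int k) - (\<eta> i k - \<zeta> i k)" .
      show ?thesis
        using xt[OF i, of "int k"] chi[OF i, of "int k"] xh[OF i, of k] \<zeta>c[OF i, of k] A G
        unfolding * unfolding e_def eh_def xt_step[OF i] chi_step[OF i]
        by (intro eq_vecI) auto
    qed
    then show "vanishing d (\<lambda>k. e i (int (Suc k)) -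
        A *v wsum d {1..N} (averaging N a \<C> i) (\<lambda>j. e j (int k - int (\<kappa> i j))))"
      using vanishing_mult_mat_vec[OF A ehc[OF i] eh_van[OF i]] by simp
  qed (use q A ec that in auto)
  show ?thesis
  proof (rule schur_stable_vanishing[OF _ stG])
    show "A - G \<in> carrier_mat d d" by (rule minus_carrier_mat[OF G])
    show "xt i (int k) \<in> carrier_vec d" for k by (rule xt[OF i])
    \<comment> \<open>Feedback of the exchanged variable is state feedback up to
      \<open>G *v e\<close>.\<close>
    have "xt i (int (Suc k)) - (A - G) *v xt i (int k) = G *v e i (int k)" for k
      using xt[OF i, of "int k"] chi[OF i, of "int k"] A G
      unfolding e_def xt_step[OF i] minus_mult_distrib_mat_vec[OF A G xt[OF i]]
      by (intro eq_vecI) auto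
    then show "vanishing d (\<lambda>k. xt i (int (Suc k)) - (A - G) *v xt i (int k))"
      using vanishing_mult_mat_vec[OF G ec[OF i] e_van[OF i]] by simp
  qed
qed

section \<open>The extended plant\<close>

lemma vanishing_appendI:
  assumes "vanishing a x" "vanishing b y" "\<And>k. x k \<in> carrier_vec a" "\<And>k. y k \<in> carrier_vec b"
  shows "vanishing (a + b) (\<lambda>k. x k @\<^sub>v y k)"
  unfolding vanishing_def
proof (intro allI impI)
  fix l assume l: "l < a + b"
  have "(x k @\<^sub>v y k) $ l = (if l < a then x k $ l else y k $ (l - a))" for k
    using carrier_vecD[OF assms(3)] carrier_vecD[OF assms(4)] l by simp
  then show "(\<lambda>k. (x k @\<^sub>v y k) $ l) \<longlonglongrightarrow> 0"
    using assms(1,2) l by (cases "l < a") (auto simp: vanishing_def)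
qed

lemma vanishing_appendD:
  assumes "vanishing (a + b) (\<lambda>k. x k @\<^sub>v y k)" "\<And>k. x k \<in> carrier_vec a"
  shows "vanishing a x"
  unfolding vanishing_def
proof (intro allI impI)
  fix l assume l: "l < a"
  then have "(\<lambda>k. (x k @\<^sub>v y k) $ l) \<longlonglongrightarrow> 0" using assms(1) by (simp add: vanishing_def)
  moreover have "(x k @\<^sub>v y k) $ l = x k $ l" for k
    using carrier_vecD[OF assms(2)] l by (simp add: append_vec_def)
  ultimately show "(\<lambda>k. x k $ l) \<longlonglongrightarrow> 0" by simp
qed

lemma vanishing_cong:
  assumes "vanishing d v" "\<And>k. K \<le> k \<Longrightarrow> v k = w k"
  shows "vanishing d w"
  unfolding vanishing_def
proof (intro allI impI)
  fix l assume "l < d"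
  then have "(\<lambda>k. v k $ l) \<longlonglongrightarrow> 0" using assms(1) by (simp add: vanishing_def)
  moreover have "\<forall>\<^sub>F k in sequentially. v k $ l = w k $ l"
    using eventually_ge_at_top[of K] by eventually_elim (simp add: assms(2))
  ultimately show "(\<lambda>k. w k $ l) \<longlonglongrightarrow> 0" by (simp add: tendsto_cong)
qed

text \<open>A fixed point is a constant trajectory, which vanishes only if it is zero.\<close>

lemma schur_stable_fixpoint:
  assumes "M \<in> carrier_mat d d" "schur_stable M" "v \<in> carrier_vec d" "M *v v = v"
  shows "v = 0\<^sub>v d"
proof -
  have "vanishing d (\<lambda>_. v)"
    by (rule schur_stable_vanishing[OF assms(1,2)]) (use assms in \<open>auto simp: vanishing_def\<close>)
  then show ?thesis using assms(3)
    by (intro eq_vecI) (auto simp: vanishing_def LIMSEQ_const_iff)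
qed

locale extended_plant =
  fixes n m p \<nu> :: nat and A B C \<Gamma>\<^sub>1 \<Gamma>\<^sub>2 :: "real mat"
  assumes A: "A \<in> carrier_mat n n" and B: "B \<in> carrier_mat n m" and C: "C \<in> carrier_mat p n"
    and \<Gamma>\<^sub>1: "\<Gamma>\<^sub>1 \<in> carrier_mat m \<nu>" and \<Gamma>\<^sub>2: "\<Gamma>\<^sub>2 \<in> carrier_mat m (m - \<nu>)" and \<nu>: "\<nu> \<le> m"
begin

lemma ext_A: "ext_A n \<nu> A B \<Gamma>\<^sub>1 \<in> carrier_mat (n + \<nu>) (n + \<nu>)"
  unfolding ext_A_def using A by simp

lemma ext_B: "ext_B n m \<nu> B \<Gamma>\<^sub>2 \<in> carrier_mat (n + \<nu>) m"
  unfolding ext_B_def using four_block_carrier_mat[of "B * \<Gamma>\<^sub>2" n "m - \<nu>" "1\<^sub>m \<nu>" \<nu> \<nu>] B \<Gamma>\<^sub>2 \<nu> by simp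

lemma ext_C: "ext_C p \<nu> C \<in> carrier_mat p (n + \<nu>)"
  unfolding ext_C_def using C by (simp add: append_cols_carrier)

lemma ext_A_mult:
  assumes x: "x \<in> carrier_vec n" and z: "z \<in> carrier_vec \<nu>"
  shows "ext_A n \<nu> A B \<Gamma>\<^sub>1 *v (x @\<^sub>v z) = (A *v x + B *v (\<Gamma>\<^sub>1 *v z)) @\<^sub>v z"
proof -
  have "ext_A n \<nu> A B \<Gamma>\<^sub>1 *v (x @\<^sub>v z) = (A *v x + (B * \<Gamma>\<^sub>1) *v z) @\<^sub>v (0\<^sub>m \<nu> n *v x + 1\<^sub>m \<nu> *v z)"
    unfolding ext_A_def by (rule four_block_mat_mult_vec) (use A B \<Gamma>\<^sub>1 x z in auto)
  then show ?thesis using assoc_mult_mat_vec[OF B \<Gamma>\<^sub>1 z] x z by simp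
qed

lemma ext_B_mult:
  assumes v: "v \<in> carrier_vec (m - \<nu>)" and w: "w \<in> carrier_vec \<nu>"
  shows "ext_B n m \<nu> B \<Gamma>\<^sub>2 *v (v @\<^sub>v w) = (B *v (\<Gamma>\<^sub>2 *v v)) @\<^sub>v w"
proof -
  have "ext_B n m \<nu> B \<Gamma>\<^sub>2 *v (v @\<^sub>v w)
      = ((B * \<Gamma>\<^sub>2) *v v + 0\<^sub>m n \<nu> *v w) @\<^sub>v (0\<^sub>m \<nu> (m - \<nu>) *v v + 1\<^sub>m \<nu> *v w)"
    unfolding ext_B_def by (rule four_block_mat_mult_vec) (use B \<Gamma>\<^sub>2 v w in auto)
  then show ?thesis using assoc_mult_mat_vec[OF B \<Gamma>\<^sub>2 v] B \<Gamma>\<^sub>2 v w by simp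
qed

lemma ext_C_mult:
  "x \<in> carrier_vec n \<Longrightarrow> z \<in> carrier_vec \<nu> \<Longrightarrow> ext_C p \<nu> C *v (x @\<^sub>v z) = C *v x"
  unfolding ext_C_def by (rule projection_append_mult[OF C])

text \<open>Block triangularity: the integrators add only the eigenvalue 1, still in the closed
  disc.\<close>

lemma ext_A_disc:
  assumes "eigenvalues_in_closed_disc A"
  shows "eigenvalues_in_closed_disc (ext_A n \<nu> A B \<Gamma>\<^sub>1)"
  unfolding eigenvalues_in_closed_disc_def
proof (intro allI impI)
  fix z assume z: "eigenvalue (cmat (ext_A n \<nu> A B \<Gamma>\<^sub>1)) z"
  have zero_one: "cmat (0\<^sub>m \<nu> n) = 0\<^sub>m \<nu> n" "cmat (1\<^sub>m \<nu>) = 1\<^sub>m \<nu>" by (intro eq_matI; simp)+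
  have blocks: "cmat (ext_A n \<nu> A B \<Gamma>\<^sub>1) = four_block_mat (cmat A) (cmat (B * \<Gamma>\<^sub>1)) (0\<^sub>m \<nu> n) (1\<^sub>m \<nu>)"
    unfolding ext_A_def
    by (subst map_four_block_mat[of A n n _ \<nu> _ \<nu>]) (use A B \<Gamma>\<^sub>1 in \<open>auto simp: zero_one\<close>)
  have cA: "cmat A \<in> carrier_mat n n" and cE: "cmat (ext_A n \<nu> A B \<Gamma>\<^sub>1) \<in> carrier_mat (n + \<nu>) (n + \<nu>)"
    using A ext_A by auto
  have "char_poly (cmat (ext_A n \<nu> A B \<Gamma>\<^sub>1)) = char_poly (cmat A) * char_poly (1\<^sub>m \<nu>)"
    by (rule char_poly_0_block[OF blocks])
      (use char_poly_factorized[OF cA] char_poly_factorized[OF one_carrier_mat] B \<Gamma>\<^sub>1 cA in auto)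
  then have "eigenvalue (cmat A) z \<or> eigenvalue (1\<^sub>m \<nu> :: complex mat) z"
    using z unfolding eigenvalue_root_char_poly[OF cE] eigenvalue_root_char_poly[OF cA]
      eigenvalue_root_char_poly[OF one_carrier_mat] by simp
  then show "cmod z \<le> 1"
  proof
    assume "eigenvalue (cmat A) z"
    then show ?thesis using assms by (simp add: eigenvalues_in_closed_disc_def)
  next
    assume "eigenvalue (1\<^sub>m \<nu> :: complex mat) z"
    then obtain v where v: "v \<in> carrier_vec \<nu>" "v \<noteq> 0\<^sub>v \<nu>" "v = z \<cdot>\<^sub>v v"
      unfolding eigenvalue_def eigenvector_def by auto
    then obtain l where l: "l < \<nu>" "v $ l \<noteq> 0" by (metis carrier_vecD eq_vecI index_zero_vec)
    have "v $ l = z * v $ l" using arg_cong[OF v(3), of "\<lambda>u. u $ l"] l v(1) by simp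
    then show ?thesis using l by simp
  qed
qed

text \<open>With \<open>\<Gamma>\<^sub>1 g\<^sub>1 + \<Gamma>\<^sub>2 g\<^sub>2 = K\<^sub>0\<close>, feed \<open>g\<^sub>2\<close> back directly and steer the integrator state to
  \<open>- g\<^sub>1 x\<close> in one step; from then on the input is \<open>- K\<^sub>0 x\<close>.\<close>

lemma ext_stabilizable:
  assumes K0: "K\<^sub>0 \<in> carrier_mat m n" and st: "schur_stable (A - B * K\<^sub>0)"
    and inv: "invertible_mat (\<Gamma>\<^sub>1 @\<^sub>c \<Gamma>\<^sub>2)"
  obtains K where "K \<in> carrier_mat m (n + \<nu>)"
    "schur_stable (ext_A n \<nu> A B \<Gamma>\<^sub>1 - ext_B n m \<nu> B \<Gamma>\<^sub>2 * K)"
proof -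
  have G12: "\<Gamma>\<^sub>1 @\<^sub>c \<Gamma>\<^sub>2 \<in> carrier_mat m m" using append_cols_carrier[OF \<Gamma>\<^sub>1 \<Gamma>\<^sub>2] \<nu> by simp
  \<comment> \<open>Expanding the columns of \<open>K\<^sub>0\<close> in the basis given by
    \<open>\<Gamma>\<^sub>1\<close> and \<open>\<Gamma>\<^sub>2\<close> yields \<open>G1\<close> and
    \<open>G2\<close>.\<close>
  obtain W where W: "W \<in> carrier_mat m m" "(\<Gamma>\<^sub>1 @\<^sub>c \<Gamma>\<^sub>2) * W = 1\<^sub>m m"
    using inv G12 unfolding invertible_mat_def inverts_mat_def
    by (metis carrier_matD carrier_mat_triv index_mult_mat(2,3) index_one_mat(2,3))
  define E1 :: "real mat" where "E1 = 1\<^sub>m \<nu> @\<^sub>c 0\<^sub>m \<nu> (m - \<nu>)"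
  define E2 :: "real mat" where "E2 = 0\<^sub>m (m - \<nu>) \<nu> @\<^sub>c 1\<^sub>m (m - \<nu>)"
  have E1: "E1 \<in> carrier_mat \<nu> m" and E2: "E2 \<in> carrier_mat (m - \<nu>) m"
    using append_cols_carrier[of "1\<^sub>m \<nu> :: real mat" \<nu> \<nu> "0\<^sub>m \<nu> (m - \<nu>)" "m - \<nu>"]
      append_cols_carrier[of "0\<^sub>m (m - \<nu>) \<nu> :: real mat" "m - \<nu>" \<nu> "1\<^sub>m (m - \<nu>)" "m - \<nu>"] \<nu>
    by (simp_all add: E1_def E2_def)
  define G1 where "G1 = E1 * (W * K\<^sub>0)"
  define G2 where "G2 = E2 * (W * K\<^sub>0)"
  have WK: "W * K\<^sub>0 \<in> carrier_mat m n" using W K0 by simp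
  have G1: "G1 \<in> carrier_mat \<nu> n" and G2: "G2 \<in> carrier_mat (m - \<nu>) n"
    using E1 E2 WK by (auto simp: G1_def G2_def)
  have split: "\<Gamma>\<^sub>1 *v (G1 *v x) + \<Gamma>\<^sub>2 *v (G2 *v x) = K\<^sub>0 *v x" if x: "x \<in> carrier_vec n" for x
  proof -
    have "(W * K\<^sub>0) *v x \<in> carrier_vec (\<nu> + (m - \<nu>))" using mult_mat_vec_carrier[OF WK x] \<nu> by simp
    then obtain g1 g2 where g: "g1 \<in> carrier_vec \<nu>" "g2 \<in> carrier_vec (m - \<nu>)"
      "(W * K\<^sub>0) *v x = g1 @\<^sub>v g2" by (elim carrier_vec_splitE)
    have 1: "G1 *v x = g1"
      using projection_append_mult[OF one_carrier_mat g(1,2)] g(1)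
      unfolding G1_def assoc_mult_mat_vec[OF E1 WK x] g(3) by (simp add: E1_def)
    have 2: "G2 *v x = g2"
      using projection_append_mult_right[OF one_carrier_mat g(1,2)] g(2)
      unfolding G2_def assoc_mult_mat_vec[OF E2 WK x] g(3) by (simp add: E2_def)
    have "\<Gamma>\<^sub>1 *v (G1 *v x) + \<Gamma>\<^sub>2 *v (G2 *v x) = (\<Gamma>\<^sub>1 @\<^sub>c \<Gamma>\<^sub>2) *v (W *v (K\<^sub>0 *v x))"
      unfolding 1 2 using append_cols_mult_vec[OF \<Gamma>\<^sub>1 \<Gamma>\<^sub>2 g(1,2)] g(3) W K0 x by simp
    also have "\<dots> = ((\<Gamma>\<^sub>1 @\<^sub>c \<Gamma>\<^sub>2) * W) *v (K\<^sub>0 *v x)"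
      by (rule assoc_mult_mat_vec[symmetric, OF G12 W(1)]) (use K0 x in simp)
    finally show ?thesis using W K0 x by simp
  qed
  \<comment> \<open>The second block row is \<open>z + G1 *v x'\<close> with \<open>x'\<close> the
    next plant state. Subtracting it from the integrator state \<open>z\<close> leaves
    \<open>- (G1 *v x')\<close>.\<close>
  define K where "K = four_block_mat G2 (0\<^sub>m (m - \<nu>) \<nu>)
    (G1 * (A - B * \<Gamma>\<^sub>2 * G2)) (1\<^sub>m \<nu> + G1 * (B * \<Gamma>\<^sub>1))"
  have BG2: "B * \<Gamma>\<^sub>2 * G2 \<in> carrier_mat n n"
    by (rule mult_carrier_mat[OF mult_carrier_mat[OF B \<Gamma>\<^sub>2] G2])
  have M1: "A - B * \<Gamma>\<^sub>2 * G2 \<in> carrier_mat n n" by (rule minus_carrier_mat[OF BG2])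
  have K: "K \<in> carrier_mat m (n + \<nu>)"
    unfolding K_def using four_block_carrier_mat[of G2 "m - \<nu>" n "1\<^sub>m \<nu> + G1 * (B * \<Gamma>\<^sub>1)" \<nu> \<nu>] G1 G2 B \<Gamma>\<^sub>1 \<nu>
    by simp
  let ?E = "ext_A n \<nu> A B \<Gamma>\<^sub>1" and ?F = "ext_B n m \<nu> B \<Gamma>\<^sub>2"
  have step: "(?E - ?F * K) *v (x @\<^sub>v z) = x' @\<^sub>v (- (G1 *v x'))"
    if x: "x \<in> carrier_vec n" and z: "z \<in> carrier_vec \<nu>"
      and x': "x' = A *v x + B *v (\<Gamma>\<^sub>1 *v z) - B *v (\<Gamma>\<^sub>2 *v (G2 *v x))" for x z x'
  proof -
    have c: "A *v x \<in> carrier_vec n" "B *v (\<Gamma>\<^sub>1 *v z) \<in> carrier_vec n" "G2 *v x \<in> carrier_vec (m - \<nu>)"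
      "B *v (\<Gamma>\<^sub>2 *v (G2 *v x)) \<in> carrier_vec n" "x' \<in> carrier_vec n"
      using A B \<Gamma>\<^sub>1 \<Gamma>\<^sub>2 G2 x z x' by auto
    have "K *v (x @\<^sub>v z) = (G2 *v x + 0\<^sub>m (m - \<nu>) \<nu> *v z) @\<^sub>v
        ((G1 * (A - B * \<Gamma>\<^sub>2 * G2)) *v x + (1\<^sub>m \<nu> + G1 * (B * \<Gamma>\<^sub>1)) *v z)"
      unfolding K_def by (rule four_block_mat_mult_vec[OF G2 zero_carrier_mat mult_carrier_mat[OF G1 M1]
        add_carrier_mat[OF mult_carrier_mat[OF G1 mult_carrier_mat[OF B \<Gamma>\<^sub>1]]] x z])
    also have "G2 *v x + 0\<^sub>m (m - \<nu>) \<nu> *v z = G2 *v x" using G2 x z by (intro eq_vecI) auto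
    also have "(G1 * (A - B * \<Gamma>\<^sub>2 * G2)) *v x = G1 *v (A *v x - B *v (\<Gamma>\<^sub>2 *v (G2 *v x)))"
      unfolding assoc_mult_mat_vec[OF G1 M1 x] minus_mult_distrib_mat_vec[OF A BG2 x]
        assoc_mult_mat_vec[OF mult_carrier_mat[OF B \<Gamma>\<^sub>2] G2 x] assoc_mult_mat_vec[OF B \<Gamma>\<^sub>2 c(3)] ..
    also have "(1\<^sub>m \<nu> + G1 * (B * \<Gamma>\<^sub>1)) *v z = z + G1 *v (B *v (\<Gamma>\<^sub>1 *v z))"
      unfolding add_mult_distrib_mat_vec[OF one_carrier_mat mult_carrier_mat[OF G1 mult_carrier_mat[OF B \<Gamma>\<^sub>1]] z]
        assoc_mult_mat_vec[OF G1 mult_carrier_mat[OF B \<Gamma>\<^sub>1] z] assoc_mult_mat_vec[OF B \<Gamma>\<^sub>1 z]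
      using z by simp
    finally have Kxz: "K *v (x @\<^sub>v z) = (G2 *v x) @\<^sub>v (G1 *v (A *v x - B *v (\<Gamma>\<^sub>2 *v (G2 *v x)))
        + (z + G1 *v (B *v (\<Gamma>\<^sub>1 *v z))))" (is "_ = _ @\<^sub>v ?w") .
    have w: "?w = z + G1 *v x'"
      unfolding x' mult_minus_distrib_mat_vec[OF G1 c(1,4)]
        mult_minus_distrib_mat_vec[OF G1 add_carrier_vec[OF c(1,2)] c(4)] mult_add_distrib_mat_vec[OF G1 c(1,2)]
      using G1 z by (intro eq_vecI) auto
    have wc: "z + G1 *v x' \<in> carrier_vec \<nu>" using z G1 c by simp
    have xz: "x @\<^sub>v z \<in> carrier_vec (n + \<nu>)" using x z by simp
    have "(?E - ?F * K) *v (x @\<^sub>v z) = ?E *v (x @\<^sub>v z) - ?F *v (K *v (x @\<^sub>v z))"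
      using minus_mult_distrib_mat_vec[OF ext_A _ xz, of "?F * K"] ext_B K
        assoc_mult_mat_vec[OF ext_B K xz] by simp
    also have "\<dots> = ((A *v x + B *v (\<Gamma>\<^sub>1 *v z)) @\<^sub>v z) - ((B *v (\<Gamma>\<^sub>2 *v (G2 *v x))) @\<^sub>v (z + G1 *v x'))"
      unfolding Kxz w ext_A_mult[OF x z] ext_B_mult[OF c(3) wc] ..
    also have "\<dots> = x' @\<^sub>v (- (G1 *v x'))"
      unfolding x' using c z G1 A B by (intro eq_vecI) auto
    finally show ?thesis .
  qed
  have EK: "?E - ?F * K \<in> carrier_mat (n + \<nu>) (n + \<nu>)"
    by (rule minus_carrier_mat[OF mult_carrier_mat[OF ext_B K]])
  have "schur_stable (?E - ?F * K)"
  proof (rule schur_stableI[OF EK])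
    fix X assume X: "\<And>k. X k \<in> carrier_vec (n + \<nu>)" and XS: "\<And>k. X (Suc k) = (?E - ?F * K) *v X k"
    define x where "x k = vec_first (X k) n" for k
    define z where "z k = vec_last (X k) \<nu>" for k
    have x: "x k \<in> carrier_vec n" and z: "z k \<in> carrier_vec \<nu>" and Xk: "X k = x k @\<^sub>v z k" for k
      using X[of k] by (simp_all add: x_def z_def)
    define x' where "x' k = A *v x k + B *v (\<Gamma>\<^sub>1 *v z k) - B *v (\<Gamma>\<^sub>2 *v (G2 *v x k))" for k
    have x'c: "x' k \<in> carrier_vec n" for k
      unfolding x'_def using A B \<Gamma>\<^sub>1 \<Gamma>\<^sub>2 G2 x[of k] z[of k] by simp
    have eq: "x (Suc k) = x' k \<and> z (Suc k) = - (G1 *v x' k)" for k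
    proof -
      have "x (Suc k) @\<^sub>v z (Suc k) = x' k @\<^sub>v (- (G1 *v x' k))"
        using step[OF x z x'_def, of k] XS[of k] by (simp add: Xk)
      then show ?thesis using append_vec_eq[OF x x'c] by blast
    qed
    have "vanishing n x"
    proof (rule schur_stable_vanishing[OF _ st x])
      show "A - B * K\<^sub>0 \<in> carrier_mat n n" by (rule minus_carrier_mat[OF mult_carrier_mat[OF B K0]])
      show "vanishing n (\<lambda>k. x (Suc k) - (A - B * K\<^sub>0) *v x k)"
      proof (rule vanishing_eventually_0)
        \<comment> \<open>At time 0 the integrator state is still arbitrary.\<close>
        fix k :: nat assume "1 \<le> k"
        then obtain j where j: "k = Suc j" by (cases k) auto
        have zk: "z k = - (G1 *v x k)" using eq[of j] j by simp
        let ?x = "x k"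
        have c: "G1 *v ?x \<in> carrier_vec \<nu>" "G2 *v ?x \<in> carrier_vec (m - \<nu>)" using G1 G2 x[of k] by auto
        have c': "\<Gamma>\<^sub>1 *v (G1 *v ?x) \<in> carrier_vec m" "\<Gamma>\<^sub>2 *v (G2 *v ?x) \<in> carrier_vec m" using \<Gamma>\<^sub>1 \<Gamma>\<^sub>2 c by auto
        have "\<Gamma>\<^sub>1 *v z k = - (\<Gamma>\<^sub>1 *v (G1 *v ?x))"
          unfolding zk by (rule mult_mat_vec_uminus[OF \<Gamma>\<^sub>1 c(1)])
        moreover have "B *v (- (\<Gamma>\<^sub>1 *v (G1 *v ?x))) = - (B *v (\<Gamma>\<^sub>1 *v (G1 *v ?x)))"
          by (rule mult_mat_vec_uminus[OF B c'(1)])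
        moreover have "(A - B * K\<^sub>0) *v ?x = A *v ?x - (B *v (\<Gamma>\<^sub>1 *v (G1 *v ?x)) + B *v (\<Gamma>\<^sub>2 *v (G2 *v ?x)))"
          using minus_mult_distrib_mat_vec[OF A _ x, of "B * K\<^sub>0" k] B K0 assoc_mult_mat_vec[OF B K0 x]
            split[OF x, of k] mult_add_distrib_mat_vec[OF B c'] by simp
        ultimately show "x (Suc k) - (A - B * K\<^sub>0) *v ?x = 0\<^sub>v n"
          using eq[of k] A B x[of k] unfolding x'_def
          by (intro eq_vecI) auto
      qed
    qed
    moreover have "vanishing \<nu> z"
    proof -
      have "vanishing \<nu> (\<lambda>k. (- G1) *v x k)"
        by (rule vanishing_mult_mat_vec[OF _ x \<open>vanishing n x\<close>]) (use G1 in simp)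
      moreover have "(- G1) *v x k = z k" if k: "1 \<le> k" for k
      proof -
        obtain j where j: "k = Suc j" using k by (cases k) auto
        have "z k = - (G1 *v x k)" using eq[of j] j by simp
        then show ?thesis using uminus_mult_mat_vec[of "x k" G1] x[of k] G1 by simp
      qed
      ultimately show ?thesis by (rule vanishing_cong)
    qed
    ultimately have "vanishing (n + \<nu>) (\<lambda>k. x k @\<^sub>v z k)" by (rule vanishing_appendI[OF _ _ x z])
    then show "vanishing (n + \<nu>) X" by (simp flip: Xk)
  qed
  then show ?thesis using that K by blast
qed

text \<open>Output injection by \<open>F\<^sub>0\<close> decouples \<open>e = x - T z\<close> from the integrator state \<open>z\<close>, which the
  output then shows through the injective \<open>C T\<close>.\<close>

lemma ext_detectable:
  assumes F0: "F\<^sub>0 \<in> carrier_mat n p" and st: "schur_stable (A - F\<^sub>0 * C)"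
    and inj: "\<And>x z. x \<in> carrier_vec n \<Longrightarrow> z \<in> carrier_vec \<nu> \<Longrightarrow>
      A *v x + B *v (\<Gamma>\<^sub>1 *v z) = x \<Longrightarrow> C *v x = 0\<^sub>v p \<Longrightarrow> z = 0\<^sub>v \<nu>"
  obtains F where "F \<in> carrier_mat (n + \<nu>) p"
    "schur_stable (ext_A n \<nu> A B \<Gamma>\<^sub>1 - F * ext_C p \<nu> C)"
proof -
  define A0 where "A0 = A - F\<^sub>0 * C"
  have st: "schur_stable A0" using st by (simp add: A0_def)
  have FC: "F\<^sub>0 * C \<in> carrier_mat n n" using F0 C by simp
  have A0c: "A0 \<in> carrier_mat n n" unfolding A0_def by (rule minus_carrier_mat[OF FC])
  have IA0: "1\<^sub>m n - A0 \<in> carrier_mat n n" by (rule minus_carrier_mat[OF A0c])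
  have A0v: "A0 *v v = A *v v - F\<^sub>0 *v (C *v v)" if "v \<in> carrier_vec n" for v
    unfolding A0_def using minus_mult_distrib_mat_vec[OF A FC that] assoc_mult_mat_vec[OF F0 C that] by simp
  have IA0v: "(1\<^sub>m n - A0) *v v = v - A0 *v v" if "v \<in> carrier_vec n" for v
    using minus_mult_distrib_mat_vec[OF one_carrier_mat A0c that] that by simp
  \<comment> \<open>\<open>1\<^sub>m n - A0\<close> is invertible since the stable \<open>A0\<close>
    has no nonzero fixed point.\<close>
  obtain W where W: "W \<in> carrier_mat n n" "W * (1\<^sub>m n - A0) = 1\<^sub>m n" "(1\<^sub>m n - A0) * W = 1\<^sub>m n"
  proof (rule injective_square_inverse[OF IA0])
    show "\<forall>v\<in>carrier_vec n. (1\<^sub>m n - A0) *v v = 0\<^sub>v n \<longrightarrow> v = 0\<^sub>v n"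
    proof (intro ballI impI)
      fix v assume v: "v \<in> carrier_vec n" and "(1\<^sub>m n - A0) *v v = 0\<^sub>v n"
      then have z: "v - A0 *v v = 0\<^sub>v n" using IA0v by simp
      have "A0 *v v = v"
      proof (rule eq_vecI)
        fix l assume l: "l < dim_vec v"
        have "(v - A0 *v v) $ l = 0" using z l v by simp
        then show "(A0 *v v) $ l = v $ l" using l v A0c by simp
      qed (use A0c v in simp)
      then show "v = 0\<^sub>v n" by (rule schur_stable_fixpoint[OF A0c st v])
    qed
  qed
  \<comment> \<open>\<open>T\<close> solves \<open>T = A0 * T + B * \<Gamma>\<^sub>1\<close>: it
    gives the equilibrium that a constant integrator state produces under output injection.\<close>
  define T where "T = W * (B * \<Gamma>\<^sub>1)"
  have T: "T \<in> carrier_mat n \<nu>" using W B \<Gamma>\<^sub>1 by (simp add: T_def)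
  have Tz: "T *v z = A0 *v (T *v z) + B *v (\<Gamma>\<^sub>1 *v z)" if z: "z \<in> carrier_vec \<nu>" for z
  proof -
    have bz: "B *v (\<Gamma>\<^sub>1 *v z) \<in> carrier_vec n" and tz: "T *v z \<in> carrier_vec n" using B \<Gamma>\<^sub>1 T z by auto
    have "T *v z = W *v (B *v (\<Gamma>\<^sub>1 *v z))" 
      unfolding T_def assoc_mult_mat_vec[OF W(1) mult_carrier_mat[OF B \<Gamma>\<^sub>1] z]
        assoc_mult_mat_vec[OF B \<Gamma>\<^sub>1 z] ..
    then have "(1\<^sub>m n - A0) *v (T *v z) = ((1\<^sub>m n - A0) * W) *v (B *v (\<Gamma>\<^sub>1 *v z))"
      using assoc_mult_mat_vec[OF IA0 W(1) bz] by simp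
    then have eq: "T *v z - A0 *v (T *v z) = B *v (\<Gamma>\<^sub>1 *v z)" using W bz IA0v[OF tz] by simp
    show ?thesis unfolding eq[symmetric] using tz A0c T by (intro eq_vecI) auto
  qed
  have CT: "C * T \<in> carrier_mat p \<nu>" using C T by simp
  \<comment> \<open>If the output of \<open>T *v z\<close> is zero, the injection is inactive there
    and \<open>T *v z\<close> with \<open>z\<close> is a steady state of the plant with zero output,
    which \<open>inj\<close> excludes.\<close>
  have "injective_mat (C * T)"
    unfolding injective_mat_iff[OF CT]
  proof (intro ballI impI)
    fix z assume z: "z \<in> carrier_vec \<nu>" and 0: "C * T *v z = 0\<^sub>v p"
    have tz: "T *v z \<in> carrier_vec n" using T z by simp
    have c0: "C *v (T *v z) = 0\<^sub>v p" using 0 assoc_mult_mat_vec[OF C T z] by simp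
    have "A0 *v (T *v z) = A *v (T *v z)"
      unfolding A0v[OF tz] c0 mult_mat_vec_0[OF F0] using A T tz by simp
    then have "A *v (T *v z) + B *v (\<Gamma>\<^sub>1 *v z) = T *v z" using Tz[OF z] by simp
    then show "z = 0\<^sub>v \<nu>" using inj[OF tz z] c0 by simp
  qed
  then obtain G where G: "G \<in> carrier_mat \<nu> p" "G * (C * T) = 1\<^sub>m \<nu>"
    using injective_left_inverse[OF CT] by metis
  \<comment> \<open>\<open>G\<close> corrects the integrator state from the output. The summand
    \<open>T * G\<close> applies the matching correction to \<open>x\<close>, so that
    \<open>x - T *v z\<close> does not feel it.\<close>
  define F where "F = (F\<^sub>0 + T * G) @\<^sub>r G"
  have TG: "T * G \<in> carrier_mat n p" using T G by simp
  have F1: "F\<^sub>0 + T * G \<in> carrier_mat n p" using F0 TG by simp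
  have F: "F \<in> carrier_mat (n + \<nu>) p" unfolding F_def using F1 G by simp
  let ?E = "ext_A n \<nu> A B \<Gamma>\<^sub>1" and ?C = "ext_C p \<nu> C"
  have Fy: "F *v y = (F\<^sub>0 *v y + T *v (G *v y)) @\<^sub>v (G *v y)" if y: "y \<in> carrier_vec p" for y
    unfolding F_def mat_mult_append[OF F1 G(1) y] add_mult_distrib_mat_vec[OF F0 TG y]
      assoc_mult_mat_vec[OF T G(1) y] ..
  have EF: "?E - F * ?C \<in> carrier_mat (n + \<nu>) (n + \<nu>)"
    by (rule minus_carrier_mat[OF mult_carrier_mat[OF F ext_C]])
  have "schur_stable (?E - F * ?C)"
  proof (rule schur_stableI[OF EF])
    fix X assume X: "\<And>k. X k \<in> carrier_vec (n + \<nu>)" and XS: "\<And>k. X (Suc k) = (?E - F * ?C) *v X k"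
    define x where "x k = vec_first (X k) n" for k
    define z where "z k = vec_last (X k) \<nu>" for k
    have x: "x k \<in> carrier_vec n" and z: "z k \<in> carrier_vec \<nu>" and Xk: "X k = x k @\<^sub>v z k" for k
      using X[of k] by (simp_all add: x_def z_def)
    let ?g = "\<lambda>k. G *v (C *v x k)"
    have Cx: "C *v x k \<in> carrier_vec p" and g: "?g k \<in> carrier_vec \<nu>" for k
      using C G x[of k] by auto
    have eq: "x (Suc k) = A *v x k + B *v (\<Gamma>\<^sub>1 *v z k) - (F\<^sub>0 *v (C *v x k) + T *v ?g k)
        \<and> z (Suc k) = z k - ?g k" for k
    proof -
      have "X (Suc k) = ?E *v (x k @\<^sub>v z k) - F *v (C *v x k)"
        using XS[of k] minus_mult_distrib_mat_vec[OF ext_A mult_carrier_mat[OF F ext_C] X]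
          assoc_mult_mat_vec[OF F ext_C X] ext_C_mult[OF x z] by (simp add: Xk)
      also have "\<dots> = ((A *v x k + B *v (\<Gamma>\<^sub>1 *v z k)) @\<^sub>v z k)
          - ((F\<^sub>0 *v (C *v x k) + T *v ?g k) @\<^sub>v ?g k)"
        unfolding Fy[OF Cx] ext_A_mult[OF x z] ..
      also have "\<dots> = (A *v x k + B *v (\<Gamma>\<^sub>1 *v z k) - (F\<^sub>0 *v (C *v x k) + T *v ?g k)) @\<^sub>v (z k - ?g k)"
        (is "_ = ?x @\<^sub>v ?z")
        using A B T F0 G z[of k] by (intro eq_vecI) auto
      finally have "x (Suc k) @\<^sub>v z (Suc k) = ?x @\<^sub>v ?z" by (simp add: Xk)
      moreover have "A *v x k + B *v (\<Gamma>\<^sub>1 *v z k) - (F\<^sub>0 *v (C *v x k) + T *v ?g k) \<in> carrier_vec n"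
        using A B \<Gamma>\<^sub>1 F0 T x[of k] z[of k] Cx[of k] g[of k] by simp
      ultimately show ?thesis using append_vec_eq[OF x] by blast
    qed
    define e where "e k = x k - T *v z k" for k
    have tz: "T *v z k \<in> carrier_vec n" for k using T z[of k] by simp
    have e: "e k \<in> carrier_vec n" for k using x[of k] tz[of k] by (simp add: e_def)
    have e_step: "e (Suc k) = A0 *v e k" for k
    proof -
      have 1: "T *v (z k - ?g k) = T *v z k - T *v ?g k" by (rule mult_minus_distrib_mat_vec[OF T z g])
      have 2: "A0 *v e k = (A *v x k - F\<^sub>0 *v (C *v x k)) - A0 *v (T *v z k)"
        unfolding e_def mult_minus_distrib_mat_vec[OF A0c x tz] A0v[OF x] ..
      have "e (Suc k) = A *v x k + B *v (\<Gamma>\<^sub>1 *v z k) - (F\<^sub>0 *v (C *v x k) + T *v ?g k)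
          - (T *v z k - T *v ?g k)"
        using eq[of k] 1 by (simp add: e_def)
      also have "\<dots> = A *v x k + B *v (\<Gamma>\<^sub>1 *v z k) - (F\<^sub>0 *v (C *v x k) + T *v ?g k)
          - ((A0 *v (T *v z k) + B *v (\<Gamma>\<^sub>1 *v z k)) - T *v ?g k)"
        using Tz[OF z, of k] by simp
      also have "\<dots> = A0 *v e k"
        unfolding 2 using A B \<Gamma>\<^sub>1 F0 T A0c by (intro eq_vecI) auto
      finally show ?thesis .
    qed
    have "vanishing n e"
      by (rule schur_stable_vanishing[OF A0c st e])
        (use e_step A0c e in \<open>auto simp: vanishing_def\<close>)
    \<comment> \<open>Since \<open>G * (C * T)\<close> is the identity, the correction removes the
      old integrator state completely in one step.\<close>
    have "z (Suc k) = (- G) *v (C *v e k)" for k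
    proof -
      have ce: "C *v e k \<in> carrier_vec p" using C e[of k] by simp
      have "G *v (C *v e k) = ?g k - G *v (C *v (T *v z k))"
        unfolding e_def mult_minus_distrib_mat_vec[OF C x tz]
        by (rule mult_minus_distrib_mat_vec[OF G(1) Cx]) (use C tz in simp)
      also have "G *v (C *v (T *v z k)) = z k"
        using assoc_mult_mat_vec[OF G(1) CT z, of k] assoc_mult_mat_vec[OF C T z, of k] G(2) z[of k] by simp
      finally have gce: "G *v (C *v e k) = ?g k - z k" .
      have "(- G) *v (C *v e k) = - (?g k - z k)"
        unfolding gce[symmetric] by (rule uminus_mult_mat_vec) (use C G(1) in simp)
      then show ?thesis using eq[of k] z[of k] G(1) by (intro eq_vecI) auto
    qed
    moreover have "vanishing \<nu> (\<lambda>k. (- G) *v (C *v e k))"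
      by (intro vanishing_mult_mat_vec[of _ \<nu> p] vanishing_mult_mat_vec[OF C e \<open>vanishing n e\<close>])
        (use G C e in auto)
    ultimately have "vanishing \<nu> (\<lambda>k. z (Suc k))" by simp
    then have zv: "vanishing \<nu> z" by (auto simp: vanishing_def intro: LIMSEQ_imp_Suc)
    have "vanishing n (\<lambda>k. e k + T *v z k)"
      by (rule vanishing_add[OF \<open>vanishing n e\<close> vanishing_mult_mat_vec[OF T z zv] tz])
    moreover have "e k + T *v z k = x k" for k
      unfolding e_def using x[of k] T by (intro eq_vecI) auto
    ultimately have "vanishing n x" by simp
    from vanishing_appendI[OF this zv x z] show "vanishing (n + \<nu>) X" by (simp flip: Xk)
  qed
  then show ?thesis using that F by blast
qed

end

section \<open>Existence of the design matrices\<close>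

lemma regulator_block_mult:
  assumes A: "(A :: real mat) \<in> carrier_mat n n" and M: "M \<in> carrier_mat n c" and C: "C \<in> carrier_mat p n"
    and x: "x \<in> carrier_vec n" and z: "z \<in> carrier_vec c"
  shows "four_block_mat (A - 1\<^sub>m n) M C (0\<^sub>m p c) *v (x @\<^sub>v z) = (A *v x + M *v z - x) @\<^sub>v (C *v x)"
proof -
  have "four_block_mat (A - 1\<^sub>m n) M C (0\<^sub>m p c) *v (x @\<^sub>v z)
      = ((A - 1\<^sub>m n) *v x + M *v z) @\<^sub>v (C *v x + 0\<^sub>m p c *v z)"
    by (rule four_block_mat_mult_vec) (use A M C x z in \<open>auto intro: minus_carrier_mat\<close>)
  moreover have "(A - 1\<^sub>m n) *v x + M *v z = A *v x + M *v z - x"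
    unfolding minus_mult_distrib_mat_vec[OF A one_carrier_mat[of n] x] one_mult_mat_vec[OF x]
    using A M x by (intro eq_vecI) auto
  moreover have "C *v x + 0\<^sub>m p c *v z = C *v x"
    using C z by (intro eq_vecI) auto
  ultimately show ?thesis by simp
qed

lemma minus_eq_0_vec_iff:
  assumes "v \<in> carrier_vec d" "w \<in> carrier_vec d"
  shows "v - w = 0\<^sub>v d \<longleftrightarrow> v = (w :: real vec)"
proof
  assume *: "v - w = 0\<^sub>v d"
  show "v = w"
  proof (rule eq_vecI)
    fix i assume "i < dim_vec w"
    then show "v $ i = w $ i" using arg_cong[OF *, of "\<lambda>u. u $ i"] assms by simp
  qed (use assms in simp)
qed (use assms in simp)

lemma regulator_block_kernel:
  assumes A: "(A :: real mat) \<in> carrier_mat n n" and M: "M \<in> carrier_mat n c" and C: "C \<in> carrier_mat p n"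
    and x: "x \<in> carrier_vec n" and z: "z \<in> carrier_vec c"
  shows "four_block_mat (A - 1\<^sub>m n) M C (0\<^sub>m p c) *v (x @\<^sub>v z) = 0\<^sub>v (n + p) \<longleftrightarrow>
    A *v x + M *v z = x \<and> C *v x = 0\<^sub>v p"
proof -
  have c: "A *v x + M *v z \<in> carrier_vec n"
    by (rule add_carrier_vec[OF mult_mat_vec_carrier[OF A x] mult_mat_vec_carrier[OF M z]])
  have 0: "0\<^sub>v (n + p) = 0\<^sub>v n @\<^sub>v (0\<^sub>v p :: real vec)" by (intro eq_vecI) auto
  show ?thesis
    unfolding regulator_block_mult[OF assms] 0 append_vec_eq[OF minus_carrier_vec[OF c x] zero_carrier_vec]
      minus_eq_0_vec_iff[OF c x] ..
qed

lemma regulator_block_carrier: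
  assumes "(A :: real mat) \<in> carrier_mat n n"
  shows "four_block_mat (A - 1\<^sub>m n) M C (0\<^sub>m p c) \<in> carrier_mat (n + p) (n + c)"
  by (rule four_block_carrier_mat[OF minus_carrier_mat[OF one_carrier_mat] zero_carrier_mat])

lemma image_append_Collect:
  "f ` {v \<in> carrier_vec (a + b). P v} =
    {w. \<exists>x \<in> carrier_vec a. \<exists>y \<in> carrier_vec b. P (x @\<^sub>v y) \<and> f (x @\<^sub>v y) = w}"
  by (auto elim!: carrier_vec_splitE)

lemma regulable_outputs_subspace:
  assumes A: "A \<in> carrier_mat n n" and B: "B \<in> carrier_mat n m" and C: "C \<in> carrier_mat p n"
  shows "vec_subspace p (regulable_outputs n m p A B C)"
proof -
  \<comment> \<open>An output matrix with no rows leaves only the steady-state equation in the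
    kernel.\<close>
  let ?M = "four_block_mat (A - 1\<^sub>m n) B (0\<^sub>m 0 n) (0\<^sub>m 0 m)"
  have M: "?M *v (x @\<^sub>v u) = 0\<^sub>v n \<longleftrightarrow> A *v x + B *v u = x"
    if "x \<in> carrier_vec n" "u \<in> carrier_vec m" for x u
    using regulator_block_kernel[OF A B zero_carrier_mat[of 0] that] by (auto intro: eq_vecI)
  have "regulable_outputs n m p A B C = (\<lambda>v. (C @\<^sub>c 0\<^sub>m p m) *v v) ` {v \<in> carrier_vec (n + m). ?M *v v = 0\<^sub>v n}"
    unfolding image_append_Collect regulable_outputs_def
    using mult_mat_vec_carrier[OF C] by (auto simp: M projection_append_mult[OF C])
  moreover have "vec_subspace (n + m) {v \<in> carrier_vec (n + m). ?M *v v = 0\<^sub>v n}"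
    by (rule vec_subspace_kernel) (use regulator_block_carrier[OF A, of B "0\<^sub>m 0 n" 0 m] in simp)
  ultimately show ?thesis using vec_subspace_image[OF append_cols_carrier[OF C zero_carrier_mat]] by simp
qed

text \<open>The ambiguity of steady-state inputs: two inputs that sustain the same output differ by
  such an element.\<close>

definition output_zeroing_inputs ::
  "nat \<Rightarrow> nat \<Rightarrow> nat \<Rightarrow> real mat \<Rightarrow> real mat \<Rightarrow> real mat \<Rightarrow> real vec set" where
  "output_zeroing_inputs n m p A B C = {u \<in> carrier_vec m.
    \<exists>x \<in> carrier_vec n. A *v x + B *v u = x \<and> C *v x = 0\<^sub>v p}"

lemma output_zeroing_inputs_subspace:
  assumes A: "A \<in> carrier_mat n n" and B: "B \<in> carrier_mat n m" and C: "C \<in> carrier_mat p n"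
  shows "vec_subspace m (output_zeroing_inputs n m p A B C)"
proof -
  let ?M = "four_block_mat (A - 1\<^sub>m n) B C (0\<^sub>m p m)"
  have P: "(0\<^sub>m m n @\<^sub>c 1\<^sub>m m) *v (x @\<^sub>v u) = u" if "x \<in> carrier_vec n" "u \<in> carrier_vec m"
    for x u :: "real vec"
    using projection_append_mult_right[OF one_carrier_mat that] that(2) by simp
  have "output_zeroing_inputs n m p A B C =
      (\<lambda>v. (0\<^sub>m m n @\<^sub>c 1\<^sub>m m) *v v) ` {v \<in> carrier_vec (n + m). ?M *v v = 0\<^sub>v (n + p)}"
    unfolding image_append_Collect output_zeroing_inputs_def
    by (auto simp: P regulator_block_kernel[OF A B C])
  then show ?thesis
    using vec_subspace_image[OF append_cols_carrier[OF zero_carrier_mat one_carrier_mat]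
      vec_subspace_kernel[OF regulator_block_carrier[OF A]]] by simp
qed

lemma ex_design_R:
  assumes "A \<in> carrier_mat n n" "B \<in> carrier_mat n m" "C \<in> carrier_mat p n"
  shows "\<exists>R. design_R n m p A B C R"
proof -
  obtain c R where "R \<in> carrier_mat p c" "injective_mat R" "mat_image R = regulable_outputs n m p A B C"
    using subspace_image[OF regulable_outputs_subspace[OF assms]] .
  then show ?thesis unfolding design_R_def by auto
qed

text \<open>Given detectability, the rank condition says that the integrator input \<open>\<Gamma> w\<close> of a steady state
  with zero output vanishes.\<close>

lemma regulator_rank_iff:
  assumes A: "A \<in> carrier_mat n n" and B: "B \<in> carrier_mat n m" and C: "C \<in> carrier_mat p n"
    and \<Gamma>: "\<Gamma> \<in> carrier_mat m r" and J: "J \<in> carrier_mat m (vec_space.rank m \<Gamma>)"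
    and Ji: "injective_mat J" and JI: "mat_image J = mat_image \<Gamma>"
    and det: "\<And>x. x \<in> carrier_vec n \<Longrightarrow> A *v x = x \<Longrightarrow> C *v x = 0\<^sub>v p \<Longrightarrow> x = 0\<^sub>v n"
  shows "vec_space.rank (n + p) (four_block_mat (A - 1\<^sub>m n) (B * \<Gamma>) C (0\<^sub>m p r))
      = n + vec_space.rank m \<Gamma> \<longleftrightarrow>
    (\<forall>x\<in>carrier_vec n. \<forall>z\<in>carrier_vec (vec_space.rank m \<Gamma>).
      A *v x + B *v (J *v z) = x \<and> C *v x = 0\<^sub>v p \<longrightarrow> z = 0\<^sub>v (vec_space.rank m \<Gamma>))"
proof -
  let ?\<nu> = "vec_space.rank m \<Gamma>"
  let ?M = "four_block_mat (A - 1\<^sub>m n) (B * \<Gamma>) C (0\<^sub>m p r)"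
  let ?N = "four_block_mat (A - 1\<^sub>m n) (B * J) C (0\<^sub>m p ?\<nu>)"
  have M: "?M \<in> carrier_mat (n + p) (n + r)" and N: "?N \<in> carrier_mat (n + p) (n + ?\<nu>)"
    by (rule regulator_block_carrier[OF A])+
  have Mv: "?M *v (x @\<^sub>v w) = (A *v x + B *v (\<Gamma> *v w) - x) @\<^sub>v (C *v x)"
    if "x \<in> carrier_vec n" "w \<in> carrier_vec r" for x w
    using regulator_block_mult[OF A mult_carrier_mat[OF B \<Gamma>] C that] assoc_mult_mat_vec[OF B \<Gamma> that(2)] by simp
  have Nv: "?N *v (x @\<^sub>v w) = (A *v x + B *v (J *v w) - x) @\<^sub>v (C *v x)"
    if "x \<in> carrier_vec n" "w \<in> carrier_vec ?\<nu>" for x w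
    using regulator_block_mult[OF A mult_carrier_mat[OF B J] C that] assoc_mult_mat_vec[OF B J that(2)] by simp
  \<comment> \<open>Replacing \<open>\<Gamma>\<close> by a basis \<open>J\<close> of its image keeps
    the column space and leaves \<open>n\<close> plus rank of \<open>\<Gamma>\<close> columns, so
    the rank condition becomes injectivity.\<close>
  have "mat_image ?M = mat_image ?N"
  proof (intro subset_antisym subsetI)
    fix v assume "v \<in> mat_image ?M"
    then obtain u where u: "u \<in> carrier_vec (n + r)" "v = ?M *v u" using M by (auto simp: mat_image_def)
    obtain x w where xw: "x \<in> carrier_vec n" "w \<in> carrier_vec r" "u = x @\<^sub>v w"
      using u(1) by (elim carrier_vec_splitE)
    have "\<Gamma> *v w \<in> mat_image J" unfolding JI using \<Gamma> xw(2) by (intro mat_imageI) simp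
    then obtain z where z: "z \<in> carrier_vec ?\<nu>" "\<Gamma> *v w = J *v z" using J by (auto simp: mat_image_def)
    have "v = ?N *v (x @\<^sub>v z)" using u(2) xw(3) Mv[OF xw(1,2)] Nv[OF xw(1) z(1)] z(2) by simp
    then show "v \<in> mat_image ?N" using mat_imageI[of "x @\<^sub>v z" ?N] N xw(1) z(1) by auto
  next
    fix v assume "v \<in> mat_image ?N"
    then obtain u where u: "u \<in> carrier_vec (n + ?\<nu>)" "v = ?N *v u" using N by (auto simp: mat_image_def)
    obtain x z where xz: "x \<in> carrier_vec n" "z \<in> carrier_vec ?\<nu>" "u = x @\<^sub>v z"
      using u(1) by (elim carrier_vec_splitE)
    have "J *v z \<in> mat_image \<Gamma>" unfolding JI[symmetric] using J xz(2) by (intro mat_imageI) simp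
    then obtain w where w: "w \<in> carrier_vec r" "J *v z = \<Gamma> *v w" using \<Gamma> by (auto simp: mat_image_def)
    have "v = ?M *v (x @\<^sub>v w)" using u(2) xz(3) Mv[OF xz(1) w(1)] Nv[OF xz(1,2)] w(2) by simp
    then show "v \<in> mat_image ?M" using mat_imageI[of "x @\<^sub>v w" ?M] M xz(1) w(1) by auto
  qed
  then have "vec_space.rank (n + p) ?M = n + ?\<nu> \<longleftrightarrow> injective_mat ?N"
    using rank_cong_image[OF M N] rank_eq_dim_col_iff[OF N] by simp
  also have "\<dots> \<longleftrightarrow> (\<forall>x\<in>carrier_vec n. \<forall>z\<in>carrier_vec ?\<nu>.
      A *v x + B *v (J *v z) = x \<and> C *v x = 0\<^sub>v p \<longrightarrow> x @\<^sub>v z = 0\<^sub>v (n + ?\<nu>))"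
  proof -
    have "?N *v (x @\<^sub>v z) = 0\<^sub>v (n + p) \<longleftrightarrow> A *v x + B *v (J *v z) = x \<and> C *v x = 0\<^sub>v p"
      if x: "x \<in> carrier_vec n" and z: "z \<in> carrier_vec ?\<nu>" for x z
      unfolding regulator_block_kernel[OF A mult_carrier_mat[OF B J] C x z] assoc_mult_mat_vec[OF B J z] ..
    then show ?thesis unfolding injective_mat_iff[OF N] all_vec_append by simp
  qed
  also have "\<dots> \<longleftrightarrow> (\<forall>x\<in>carrier_vec n. \<forall>z\<in>carrier_vec ?\<nu>.
      A *v x + B *v (J *v z) = x \<and> C *v x = 0\<^sub>v p \<longrightarrow> z = 0\<^sub>v ?\<nu>)"
  proof -
    \<comment> \<open>With \<open>z\<close> zero, \<open>x\<close> is an unobservable fixed point of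
      \<open>A\<close>, excluded by \<open>det\<close>.\<close>
    have "x @\<^sub>v z = 0\<^sub>v (n + ?\<nu>) \<longleftrightarrow> z = 0\<^sub>v ?\<nu>"
      if x: "x \<in> carrier_vec n" and z: "z \<in> carrier_vec ?\<nu>"
        and eq: "A *v x + B *v (J *v z) = x" "C *v x = 0\<^sub>v p" for x z
    proof -
      have 0: "0\<^sub>v (n + ?\<nu>) = 0\<^sub>v n @\<^sub>v (0\<^sub>v ?\<nu> :: real vec)" by (intro eq_vecI) auto
      have "x = 0\<^sub>v n" if "z = 0\<^sub>v ?\<nu>"
      proof (rule det[OF x])
        show "A *v x = x"
          using eq(1) A x unfolding that mult_mat_vec_0[OF J] mult_mat_vec_0[OF B] by simp
      qed (rule eq(2))
      then show ?thesis unfolding 0 using append_vec_eq[OF x zero_carrier_vec] by blast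
    qed
    then show ?thesis by blast
  qed
  finally show ?thesis .
qed

text \<open>Any steady states producing the columns of \<open>R\<close> solve the linear equations,
  but the rank condition may fail for them. Removing from each input its orthogonal projection onto
  \<open>output_zeroing_inputs\<close> does not alter the output, and it makes the image of
  \<open>\<Gamma>\<close> orthogonal to that subspace.\<close>

lemma ex_design_regulator:
  assumes A: "A \<in> carrier_mat n n" and B: "B \<in> carrier_mat n m" and C: "C \<in> carrier_mat p n"
    and det: "\<And>x. x \<in> carrier_vec n \<Longrightarrow> A *v x = x \<Longrightarrow> C *v x = 0\<^sub>v p \<Longrightarrow> x = 0\<^sub>v n"
    and R: "design_R n m p A B C R"
  shows "\<exists>\<Pi>\<^sub>0 \<Gamma>. design_regulator n m p A B C R \<Pi>\<^sub>0 \<Gamma>"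
proof -
  let ?U = "output_zeroing_inputs n m p A B C"
  obtain r where Rc: "R \<in> carrier_mat p r" and RI: "mat_image R = regulable_outputs n m p A B C"
    using R unfolding design_R_def by blast
  have Rr: "dim_col R = r" using Rc by simp
  obtain c Z where Z: "Z \<in> carrier_mat m c" "injective_mat Z" "mat_image Z = ?U"
    using subspace_image[OF output_zeroing_inputs_subspace[OF A B C]] .
  obtain L where L: "L \<in> carrier_mat c m" "L * Z = 1\<^sub>m c"
    and orth: "\<forall>v\<in>carrier_vec m. \<forall>w\<in>carrier_vec c. (v - Z *v (L *v v)) \<bullet> (Z *v w) = 0"
    using injective_left_inverse[OF Z(1,2)] .
  have "\<exists>x u. x \<in> carrier_vec n \<and> u \<in> carrier_vec m \<and> A *v x + B *v u = x \<and> C *v x = col R j \<and>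
      (\<forall>z\<in>?U. u \<bullet> z = 0)" if j: "j < r" for j
  proof -
    have "col R j = R *v unit_vec r j" using j Rc by (intro eq_vecI) (auto simp: index_mult_mat_vec)
    then have "col R j \<in> regulable_outputs n m p A B C"
      unfolding RI[symmetric] using mat_imageI[of "unit_vec r j" R] Rr by simp
    then obtain x u where xu: "x \<in> carrier_vec n" "u \<in> carrier_vec m" "A *v x + B *v u = x" "C *v x = col R j"
      unfolding regulable_outputs_def by blast
    \<comment> \<open>The projection of \<open>u\<close> belongs to a steady state \<open>x'\<close>
      with zero output, so subtracting the pair keeps both equations.\<close>
    let ?z = "Z *v (L *v u)"
    have Lu: "L *v u \<in> carrier_vec c" using L(1) xu(2) by simp
    have zc: "?z \<in> carrier_vec m" using Z(1) Lu by simp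
    have "?z \<in> ?U" unfolding Z(3)[symmetric] using Lu Z(1) by (intro mat_imageI) simp
    then obtain x' where x': "x' \<in> carrier_vec n" "A *v x' + B *v ?z = x'" "C *v x' = 0\<^sub>v p"
      unfolding output_zeroing_inputs_def by blast
    have "A *v (x - x') + B *v (u - ?z) = (A *v x + B *v u) - (A *v x' + B *v ?z)"
      unfolding mult_minus_distrib_mat_vec[OF A xu(1) x'(1)] mult_minus_distrib_mat_vec[OF B xu(2) zc]
      using A B by (intro eq_vecI) auto
    then have "A *v (x - x') + B *v (u - ?z) = x - x'" unfolding xu(3) x'(2) .
    moreover have "C *v (x - x') = col R j"
      unfolding mult_minus_distrib_mat_vec[OF C xu(1) x'(1)] xu(4) x'(3) using Rc by (intro eq_vecI) auto
    moreover have "\<forall>z\<in>?U. (u - ?z) \<bullet> z = 0"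
      unfolding Z(3)[symmetric] using bspec[OF orth xu(2)] Z(1) by (auto simp: mat_image_def)
    moreover have "x - x' \<in> carrier_vec n" "u - ?z \<in> carrier_vec m" using xu x' zc by auto
    ultimately show ?thesis by blast
  qed
  then obtain x u where xu: "\<And>j. j < r \<Longrightarrow> x j \<in> carrier_vec n" "\<And>j. j < r \<Longrightarrow> u j \<in> carrier_vec m"
    "\<And>j. j < r \<Longrightarrow> A *v x j + B *v u j = x j" "\<And>j. j < r \<Longrightarrow> C *v x j = col R j"
    "\<And>j z. j < r \<Longrightarrow> z \<in> ?U \<Longrightarrow> u j \<bullet> z = 0"
    by metis
  define \<Pi>\<^sub>0 where "\<Pi>\<^sub>0 = mat n r (\<lambda>(i, j). x j $ i)"
  define \<Gamma> where "\<Gamma> = mat m r (\<lambda>(i, j). u j $ i)"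
  have \<Pi>c: "\<Pi>\<^sub>0 \<in> carrier_mat n r" and \<Gamma>c: "\<Gamma> \<in> carrier_mat m r" by (simp_all add: \<Pi>\<^sub>0_def \<Gamma>_def)
  have col\<Pi>: "col \<Pi>\<^sub>0 j = x j" and col\<Gamma>: "col \<Gamma> j = u j" if "j < r" for j
    using that xu(1,2)[OF that] by (auto simp: \<Pi>\<^sub>0_def \<Gamma>_def intro!: eq_vecI)
  let ?M = "four_block_mat (A - 1\<^sub>m n) B C (0\<^sub>m p m)"
  have M: "?M \<in> carrier_mat (n + p) (n + m)" by (rule regulator_block_carrier[OF A])
  have eq: "?M * (\<Pi>\<^sub>0 @\<^sub>r \<Gamma>) = 0\<^sub>m n r @\<^sub>r R"
  proof (rule mat_col_eqI)
    have c: "\<Pi>\<^sub>0 @\<^sub>r \<Gamma> \<in> carrier_mat (n + m) r" "0\<^sub>m n r @\<^sub>r R \<in> carrier_mat (n + p) r"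
      using \<Pi>c \<Gamma>c Rc by auto
    show "dim_row (?M * (\<Pi>\<^sub>0 @\<^sub>r \<Gamma>)) = dim_row (0\<^sub>m n r @\<^sub>r R)"
      "dim_col (?M * (\<Pi>\<^sub>0 @\<^sub>r \<Gamma>)) = dim_col (0\<^sub>m n r @\<^sub>r R)"
      using c M by auto
    fix j assume "j < dim_col (0\<^sub>m n r @\<^sub>r R)"
    then have j: "j < r" using c by simp
    have app: "col (P @\<^sub>r Q) j = col P j @\<^sub>v col Q j"
      if "P \<in> carrier_mat a r" "Q \<in> carrier_mat b r" for P Q :: "real mat" and a b
      using that j by (intro eq_vecI) (auto simp: append_rows_def)
    have "col (?M * (\<Pi>\<^sub>0 @\<^sub>r \<Gamma>)) j = ?M *v col (\<Pi>\<^sub>0 @\<^sub>r \<Gamma>) j"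
      using c M j by (intro col_mult2) auto
    also have "\<dots> = ?M *v (x j @\<^sub>v u j)" using app[OF \<Pi>c \<Gamma>c] col\<Pi>[OF j] col\<Gamma>[OF j] by simp
    also have "\<dots> = 0\<^sub>v n @\<^sub>v col R j"
      using regulator_block_mult[OF A B C xu(1,2)[OF j]] xu(1,3,4)[OF j] by simp
    also have "\<dots> = col (0\<^sub>m n r @\<^sub>r R) j" using app[OF _ Rc, of "0\<^sub>m n r" n] j by simp
    finally show "col (?M * (\<Pi>\<^sub>0 @\<^sub>r \<Gamma>)) j = col (0\<^sub>m n r @\<^sub>r R) j" .
  qed
  have orth\<Gamma>: "(\<Gamma> *v w) \<bullet> z = 0" if w: "w \<in> carrier_vec r" and z: "z \<in> ?U" for w z
  proof -
    have zc: "z \<in> carrier_vec m" using z by (simp add: output_zeroing_inputs_def)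
    have t: "transpose_mat \<Gamma> *v z = 0\<^sub>v r"
    proof (rule eq_vecI)
      fix j assume "j < dim_vec (0\<^sub>v r :: real vec)"
      then have j: "j < r" by simp
      then show "(transpose_mat \<Gamma> *v z) $ j = 0\<^sub>v r $ j"
        using \<Gamma>c col\<Gamma>[OF j] xu(5)[OF j z] by (simp add: index_mult_mat_vec)
    qed (use \<Gamma>c in simp)
    have "(\<Gamma> *v w) \<bullet> z = z \<bullet> (\<Gamma> *v w)" using \<Gamma>c w zc by (intro comm_scalar_prod[of _ m]) auto
    also have "\<dots> = (transpose_mat \<Gamma> *v z) \<bullet> w" using transpose_vec_mult_scalar[OF \<Gamma>c w zc] by simp
    also have "\<dots> = 0" unfolding t using w by simp
    finally show ?thesis .
  qed
  obtain J where J: "J \<in> carrier_mat m (vec_space.rank m \<Gamma>)" "injective_mat J" "mat_image J = mat_image \<Gamma>"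
    using rank_factor[OF \<Gamma>c] .
  have "z = 0\<^sub>v (vec_space.rank m \<Gamma>)"
    if x: "x \<in> carrier_vec n" and z: "z \<in> carrier_vec (vec_space.rank m \<Gamma>)"
      and eq: "A *v x + B *v (J *v z) = x" "C *v x = 0\<^sub>v p" for x z
  proof -
    have Jz: "J *v z \<in> carrier_vec m" using J z by simp
    have "J *v z \<in> mat_image \<Gamma>" unfolding J(3)[symmetric] using J z by (intro mat_imageI) simp
    then obtain w where w: "w \<in> carrier_vec r" "J *v z = \<Gamma> *v w" using \<Gamma>c by (auto simp: mat_image_def)
    \<comment> \<open>\<open>J *v z\<close> lies both in the image of \<open>\<Gamma>\<close> and in
      its orthogonal partner, hence is orthogonal to itself.\<close>
    have "J *v z \<in> ?U" unfolding output_zeroing_inputs_def using Jz x eq by blast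
    then have "(J *v z) \<bullet> (J *v z) = 0" using orth\<Gamma>[OF w(1)] w(2) by simp
    then have "J *v z = 0\<^sub>v m" by (rule scalar_prod_self_eq_0[OF Jz])
    then show ?thesis using J(2) z unfolding injective_mat_iff[OF J(1)] by blast
  qed
  then have "vec_space.rank (n + p) (four_block_mat (A - 1\<^sub>m n) (B * \<Gamma>) C (0\<^sub>m p r)) = n + vec_space.rank m \<Gamma>"
    using regulator_rank_iff[OF A B C \<Gamma>c J det] by blast
  then show ?thesis unfolding design_regulator_def Rr using \<Pi>c \<Gamma>c eq by blast
qed

text \<open>\<open>\<Gamma>\<^sub>2\<close> is a basis of the orthogonal complement of the image of
  \<open>\<Gamma>\<^sub>1\<close>. Its number of columns is not known beforehand; it follows from
  the combined matrix being injective with full image, hence square.\<close>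

lemma ex_design_inputs:
  assumes \<Gamma>: "\<Gamma> \<in> carrier_mat m r"
  shows "\<exists>\<Gamma>\<^sub>1 \<Gamma>\<^sub>2. design_inputs m (vec_space.rank m \<Gamma>) \<Gamma> \<Gamma>\<^sub>1 \<Gamma>\<^sub>2"
proof -
  let ?\<nu> = "vec_space.rank m \<Gamma>"
  obtain G where G: "G \<in> carrier_mat m ?\<nu>" "injective_mat G" "mat_image G = mat_image \<Gamma>"
    using rank_factor[OF \<Gamma>] .
  obtain L where L: "L \<in> carrier_mat ?\<nu> m" "L * G = 1\<^sub>m ?\<nu>"
    and orth: "\<forall>v\<in>carrier_vec m. \<forall>w\<in>carrier_vec ?\<nu>. (v - G *v (L *v v)) \<bullet> (G *v w) = 0"
    using injective_left_inverse[OF G(1,2)] .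
  define W where "W = {v \<in> carrier_vec m. \<forall>w\<in>carrier_vec ?\<nu>. v \<bullet> (G *v w) = 0}"
  have Gw: "G *v w \<in> carrier_vec m" if "w \<in> carrier_vec ?\<nu>" for w using G that by simp
  have "vec_subspace m W"
    unfolding vec_subspace_def W_def
    using Gw by (auto simp: add_scalar_prod_distrib[of _ m])
  then obtain c J where J: "J \<in> carrier_mat m c" "injective_mat J" "mat_image J = W"
    using subspace_image by metis
  let ?N = "G @\<^sub>c J"
  have N: "?N \<in> carrier_mat m (?\<nu> + c)" by (rule append_cols_carrier[OF G(1) J(1)])
  have Nv: "?N *v (a @\<^sub>v b) = G *v a + J *v b" if "a \<in> carrier_vec ?\<nu>" "b \<in> carrier_vec c" for a b
    by (rule append_cols_mult_vec[OF G(1) J(1) that])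
  have inj: "injective_mat ?N"
    unfolding injective_mat_iff[OF N] all_vec_append
  proof (intro ballI impI)
    fix a b assume a: "a \<in> carrier_vec ?\<nu>" and b: "b \<in> carrier_vec c" and "?N *v (a @\<^sub>v b) = 0\<^sub>v m"
    then have eq: "G *v a + J *v b = 0\<^sub>v m" using Nv by simp
    have Jb: "J *v b \<in> carrier_vec m" using J b by simp
    have "J *v b \<in> W" unfolding J(3)[symmetric] using J(1) b by (intro mat_imageI) simp
    then have "(J *v b) \<bullet> (G *v a) = 0" using a by (simp add: W_def)
    then have "(G *v a) \<bullet> (G *v a) = (G *v a + J *v b) \<bullet> (G *v a)"
      using add_scalar_prod_distrib[OF Gw[OF a] Jb Gw[OF a]] by simp
    also have "\<dots> = 0" unfolding eq using Gw[OF a] by simp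
    finally have Ga: "G *v a = 0\<^sub>v m" by (rule scalar_prod_self_eq_0[OF Gw[OF a]])
    then have a0: "a = 0\<^sub>v ?\<nu>" using G(2) a unfolding injective_mat_iff[OF G(1)] by blast
    have "J *v b = 0\<^sub>v m" using eq Jb unfolding Ga by simp
    then have "b = 0\<^sub>v c" using J(2) b unfolding injective_mat_iff[OF J(1)] by blast
    then show "a @\<^sub>v b = 0\<^sub>v (?\<nu> + c)" unfolding a0 by (intro eq_vecI) auto
  qed
  have "mat_image ?N = mat_image (1\<^sub>m m)"
  proof (intro subset_antisym subsetI)
    fix v assume "v \<in> mat_image ?N"
    then show "v \<in> mat_image (1\<^sub>m m)" using N mult_mat_vec_carrier[OF N] by (force simp: mat_image_def)
  next
    fix v assume "v \<in> mat_image (1\<^sub>m m :: real mat)"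
    then have v: "v \<in> carrier_vec m" by (auto simp: mat_image_def)
    have Lv: "L *v v \<in> carrier_vec ?\<nu>" using L(1) v by simp
    have "v - G *v (L *v v) \<in> W" unfolding W_def using bspec[OF orth v] v Gw[OF Lv] by simp
    then obtain b where b: "b \<in> carrier_vec c" "v - G *v (L *v v) = J *v b"
      unfolding J(3)[symmetric] using J(1) by (auto simp: mat_image_def)
    have "?N *v ((L *v v) @\<^sub>v b) = G *v (L *v v) + (v - G *v (L *v v))"
      using Nv[OF Lv b(1)] b(2) by simp
    also have "\<dots> = v" using v G by (intro eq_vecI) auto
    finally show "v \<in> mat_image ?N" using mat_imageI[of "(L *v v) @\<^sub>v b" ?N] N Lv b(1) by auto
  qed
  then have "vec_space.rank m ?N = vec_space.rank m (1\<^sub>m m :: real mat)"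
    by (rule rank_cong_image[OF N one_carrier_mat])
  moreover have "vec_space.rank m (1\<^sub>m m :: real mat) = m"
    by (subst rank_eq_dim_col_iff[of _ m m]) (auto simp: injective_mat_iff[of _ m m])
  ultimately have dim: "?\<nu> + c = m" using inj rank_eq_dim_col_iff[OF N] by simp
  have Nsq: "?N \<in> carrier_mat m m" using N dim by simp
  obtain V where "V \<in> carrier_mat m m" "V * ?N = 1\<^sub>m m" "?N * V = 1\<^sub>m m"
    using injective_square_inverse[OF Nsq] inj unfolding injective_mat_iff[OF Nsq] by blast
  then have "invertible_mat ?N"
    using Nsq unfolding invertible_mat_def inverts_mat_def by auto
  moreover have "J \<in> carrier_mat m (m - ?\<nu>)" using J(1) dim by auto
  ultimately show ?thesis unfolding design_inputs_def using G by blast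
qed

section \<open>Convergence and realization of the designed protocol\<close>

lemma tendsto_zero_vec_vanishing: "tendsto_zero_vec d w \<longleftrightarrow> vanishing d w"
  by (simp add: tendsto_zero_vec_def vanishing_def)

context extended_plant
begin

text \<open>The stacked vector of \<open>xr\<close> and \<open>zr\<close> is a fixed point of the
  extended plant with output \<open>y\<^sub>0\<close>. The measurement \<open>y - y\<^sub>0\<close>
  is the output of the deviation from it, so tracking becomes convergence of the deviation to zero,
  and synchronization follows since all agents approach the same \<open>xr\<close>.\<close>

lemma designed_protocol_synchronized:
  fixes x u pc xh v :: "nat \<Rightarrow> nat \<Rightarrow> real vec" and y chi :: "nat \<Rightarrow> int \<Rightarrow> real vec"
  assumes disc: "eigenvalues_in_closed_disc A"
    and gains: "design_gains n m p \<nu> A B C \<Gamma>\<^sub>1 \<Gamma>\<^sub>2 K F"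
    and xr: "xr \<in> carrier_vec n" and zr: "zr \<in> carrier_vec \<nu>"
    and steady: "A *v xr + B *v (\<Gamma>\<^sub>1 *v zr) = xr" "C *v xr = y\<^sub>0"
    and a: "a \<in> graph_set \<C> N" and \<kappa>: "delays N \<kappa>"
    and ag: "agents n m p A B C N x u y"
    and prot: "designed_protocol n m p \<nu> A B C \<Gamma>\<^sub>1 \<Gamma>\<^sub>2 K F N a \<C> \<kappa> y\<^sub>0 u y pc xh chi v"
  shows "synchronized n p N y\<^sub>0 x y"
proof -
  let ?d = "n + \<nu>" and ?A = "ext_A n \<nu> A B \<Gamma>\<^sub>1" and ?B = "ext_B n m \<nu> B \<Gamma>\<^sub>2" and ?C = "ext_C p \<nu> C"
  let ?G = "?B * K"
  let ?r = "xr @\<^sub>v zr"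
  have K: "K \<in> carrier_mat m ?d" and F: "F \<in> carrier_mat ?d p"
    and stK: "schur_stable (?A - ?G)" and stF: "schur_stable (?A - F * ?C)"
    using gains by (auto simp: design_gains_def)
  have G: "?G \<in> carrier_mat ?d ?d" by (rule mult_carrier_mat[OF ext_B K])
  have r: "?r \<in> carrier_vec ?d" using xr zr by simp
  have Ar: "?A *v ?r = ?r" unfolding ext_A_mult[OF xr zr] steady ..
  have Cr: "?C *v ?r = y\<^sub>0" unfolding ext_C_mult[OF xr zr] steady ..
  have x: "x i k \<in> carrier_vec n" "u i k \<in> carrier_vec m" and y: "y i t \<in> carrier_vec p"
    and x_step: "x i (Suc k) = A *v x i k + B *v u i k" and yC: "y i (int k) = C *v x i k"
    if "i \<in> {1..N}" for i k t
    using ag that unfolding agents_def by blast+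
  let ?\<zeta>' = "\<lambda>i k. network_measurement p N a \<C> \<kappa> (\<lambda>j t. y j t - y\<^sub>0) i k"
  let ?\<zeta> = "\<lambda>i k. network_measurement ?d N a \<C> \<kappa> chi i k"
  have pc: "pc i k \<in> carrier_vec \<nu>" and xh: "xh i k \<in> carrier_vec ?d" and chi: "chi i t \<in> carrier_vec ?d"
    and pc_step: "pc i (Suc k) = pc i k + (0\<^sub>m \<nu> (m - \<nu>) @\<^sub>c 1\<^sub>m \<nu>) *v v i k"
    and u: "u i k = \<Gamma>\<^sub>1 *v pc i k + (\<Gamma>\<^sub>2 @\<^sub>c 0\<^sub>m m \<nu>) *v v i k"
    and xh_step: "xh i (Suc k) = ?A *v xh i k - ?G *v ?\<zeta> i k + F *v (?\<zeta>' i k - ?C *v xh i k)"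
    and chi_step: "chi i (int (Suc k)) = ?A *v chi i (int k) + ?B *v v i k + ?A *v xh i k - ?A *v ?\<zeta> i k"
    and v: "v i k = - (K *v chi i (int k))"
    if "i \<in> {1..N}" for i k t
    using prot that unfolding designed_protocol_def Let_def by blast+
  \<comment> \<open>At negative times the state is frozen at its initial value. This need not match
    the history of \<open>y\<close>, but the observer equation is required only once no delayed time
    is negative.\<close>
  define xt where "xt i t = (x i (nat t) @\<^sub>v pc i (nat t)) - ?r" for i t
  have xp: "x i k @\<^sub>v pc i k \<in> carrier_vec ?d" if "i \<in> {1..N}" for i k using x(1)[OF that] pc[OF that] by simp
  have xtc: "xt i t \<in> carrier_vec ?d" if "i \<in> {1..N}" for i t using xp[OF that] r by (simp add: xt_def)
  have Bv: "?B *v v i k = - (?G *v chi i (int k))" if i: "i \<in> {1..N}" for i k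
  proof -
    have "K *v chi i (int k) \<in> carrier_vec m" using K chi[OF i] by (rule mult_mat_vec_carrier)
    then show ?thesis
      unfolding v[OF i] assoc_mult_mat_vec[OF ext_B K chi[OF i]] by (rule mult_mat_vec_uminus[OF ext_B])
  qed
  have xp_step: "x i (Suc k) @\<^sub>v pc i (Suc k) = ?A *v (x i k @\<^sub>v pc i k) + ?B *v v i k"
    if i: "i \<in> {1..N}" for i k
  proof -
    have "v i k \<in> carrier_vec ((m - \<nu>) + \<nu>)"
      unfolding v[OF i] using mult_mat_vec_carrier[OF K chi[OF i], of "int k"] \<nu> by simp
    then obtain v1 v2 where vs: "v1 \<in> carrier_vec (m - \<nu>)" "v2 \<in> carrier_vec \<nu>" "v i k = v1 @\<^sub>v v2"
      by (elim carrier_vec_splitE)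
    have p: "pc i (Suc k) = pc i k + v2"
      unfolding pc_step[OF i] vs(3) projection_append_mult_right[OF one_carrier_mat vs(1,2)]
      using vs(2) by simp
    have "u i k = \<Gamma>\<^sub>1 *v pc i k + \<Gamma>\<^sub>2 *v v1"
      unfolding u[OF i] vs(3) projection_append_mult[OF \<Gamma>\<^sub>2 vs(1,2)] ..
    then have xs: "x i (Suc k) = A *v x i k + (B *v (\<Gamma>\<^sub>1 *v pc i k) + B *v (\<Gamma>\<^sub>2 *v v1))"
      unfolding x_step[OF i]
      using mult_add_distrib_mat_vec[OF B mult_mat_vec_carrier[OF \<Gamma>\<^sub>1 pc[OF i]] mult_mat_vec_carrier[OF \<Gamma>\<^sub>2 vs(1)]]
      by simp
    show ?thesis
      unfolding p xs vs(3) ext_A_mult[OF x(1)[OF i] pc[OF i]] ext_B_mult[OF vs(1,2)]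
      using A B pc[OF i, of k] vs(2) by (intro eq_vecI) auto
  qed
  have van: "vanishing ?d (\<lambda>k. xt i (int k))" if "i \<in> {1..N}" for i
  proof (rule observer_protocol_vanishing[OF ext_A G F ext_C stK stF ext_A_disc[OF disc] a \<kappa> xtc chi xh,
        where \<zeta> = ?\<zeta>])
    fix i k assume i: "i \<in> {1..N}"
    have "xt i (int (Suc k)) = ?A *v (x i k @\<^sub>v pc i k) + ?B *v v i k - ?r"
      unfolding xt_def nat_int xp_step[OF i] ..
    also have "\<dots> = (?A *v (x i k @\<^sub>v pc i k) - ?A *v ?r) - ?G *v chi i (int k)"
      unfolding Bv[OF i] Ar using xr zr ext_A ext_B by (intro eq_vecI) auto
    also have "?A *v (x i k @\<^sub>v pc i k) - ?A *v ?r = ?A *v xt i (int k)"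
      unfolding xt_def nat_int by (rule mult_minus_distrib_mat_vec[OF ext_A xp[OF i] r, symmetric])
    finally show "xt i (int (Suc k)) = ?A *v xt i (int k) - ?G *v chi i (int k)" .
    show "?\<zeta> i k = wsum ?d {1..N} (coupling N a \<C> i) (\<lambda>j. chi j (int k - int (\<kappa> i j)))"
      by (rule network_measurement_wsum)
    show "chi i (int (Suc k)) = ?A *v chi i (int k) - ?G *v chi i (int k) + ?A *v xh i k - ?A *v ?\<zeta> i k"
      unfolding chi_step[OF i] Bv[OF i]
      using ext_A ext_B by (intro eq_vecI) auto
  next
    fix i k assume i: "i \<in> {1..N}" and k: "\<And>j. j \<in> {1..N} \<Longrightarrow> \<kappa> i j \<le> k"
    have "y j (int k - int (\<kappa> i j)) - y\<^sub>0 = ?C *v xt j (int k - int (\<kappa> i j))" if j: "j \<in> {1..N}" for j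
    proof -
      have t: "int k - int (\<kappa> i j) = int (k - \<kappa> i j)" using k[OF j] by simp
      show ?thesis
        unfolding t yC[OF j] xt_def nat_int mult_minus_distrib_mat_vec[OF ext_C xp[OF j] r] Cr
          ext_C_mult[OF x(1)[OF j] pc[OF j]] ..
    qed
    then have "?\<zeta>' i k = wsum p {1..N} (coupling N a \<C> i) (\<lambda>j. ?C *v xt j (int k - int (\<kappa> i j)))"
      unfolding network_measurement_wsum by (rule wsum_cong)
    also have "\<dots> = ?C *v wsum ?d {1..N} (coupling N a \<C> i) (\<lambda>j. xt j (int k - int (\<kappa> i j)))"
      by (rule mult_mat_vec_wsum[OF ext_C xtc, symmetric])
    finally show "xh i (Suc k) = ?A *v xh i k - ?G *v ?\<zeta> i k + F *v (?C *v
        wsum ?d {1..N} (coupling N a \<C> i) (\<lambda>j. xt j (int k - int (\<kappa> i j))) - ?C *v xh i k)"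
      unfolding xh_step[OF i] by simp
  qed (use that in auto)
  have xdev: "vanishing n (\<lambda>k. x i k - xr)" if i: "i \<in> {1..N}" for i
  proof (rule vanishing_appendD)
    have "xt i (int k) = (x i k - xr) @\<^sub>v (pc i k - zr)" for k
      unfolding xt_def nat_int by (rule append_vec_minus[OF x(1)[OF i] xr pc[OF i] zr])
    then show "vanishing (n + \<nu>) (\<lambda>k. (x i k - xr) @\<^sub>v (pc i k - zr))" using van[OF i] by simp
    show "x i k - xr \<in> carrier_vec n" for k using x(1)[OF i] xr by simp
  qed
  show ?thesis
    unfolding synchronized_def tendsto_zero_vec_vanishing
  proof (intro conjI ballI)
    fix i assume i: "i \<in> {1..N}"
    have "vanishing p (\<lambda>k. C *v (x i k - xr))"
      by (rule vanishing_mult_mat_vec[OF C _ xdev[OF i]]) (use x(1)[OF i] xr in simp)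
    then show "vanishing p (\<lambda>k. y i (int k) - y\<^sub>0)"
      unfolding yC[OF i] steady(2)[symmetric] mult_minus_distrib_mat_vec[OF C x(1)[OF i] xr] .
  next
    fix i j assume i: "i \<in> {1..N}" and j: "j \<in> {1..N}"
    have "vanishing n (\<lambda>k. (x i k - xr) - (x j k - xr))"
      by (rule vanishing_minus[OF xdev[OF i] xdev[OF j]]) (use x(1)[OF j] xr in simp)
    moreover have "(x i k - xr) - (x j k - xr) = x i k - x j k" for k
      using x(1)[OF i, of k] x(1)[OF j, of k] xr by (intro eq_vecI) auto
    ultimately show "vanishing n (\<lambda>k. x i k - x j k)" by simp
  qed
qed

text \<open>The protocol state stacks the precompensator state, the estimate and the exchanged variable.\<close>

lemma designed_protocol_linear:
  assumes gains: "design_gains n m p \<nu> A B C \<Gamma>\<^sub>1 \<Gamma>\<^sub>2 K F"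
  obtains c q A\<^sub>c B\<^sub>c\<^sub>1 B\<^sub>c\<^sub>2 F\<^sub>c H\<^sub>c where
    "A\<^sub>c \<in> carrier_mat c c" "B\<^sub>c\<^sub>1 \<in> carrier_mat c p" "B\<^sub>c\<^sub>2 \<in> carrier_mat c q"
    "F\<^sub>c \<in> carrier_mat m c" "H\<^sub>c \<in> carrier_mat q c"
    "\<forall>N a \<C> \<kappa> y\<^sub>0 u y x\<^sub>c \<xi>. linear_protocol p c q A\<^sub>c B\<^sub>c\<^sub>1 B\<^sub>c\<^sub>2 F\<^sub>c H\<^sub>c N a \<C> \<kappa> y\<^sub>0 u y x\<^sub>c \<xi> \<longrightarrow>
      (\<exists>pc xh v. designed_protocol n m p \<nu> A B C \<Gamma>\<^sub>1 \<Gamma>\<^sub>2 K F N a \<C> \<kappa> y\<^sub>0 u y pc xh \<xi> v)"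
proof -
  let ?d = "n + \<nu>" and ?A = "ext_A n \<nu> A B \<Gamma>\<^sub>1" and ?B = "ext_B n m \<nu> B \<Gamma>\<^sub>2" and ?C = "ext_C p \<nu> C"
  have K: "K \<in> carrier_mat m ?d" and F: "F \<in> carrier_mat ?d p"
    using gains by (auto simp: design_gains_def)
  define G where "G = ?B * K"
  have G: "G \<in> carrier_mat ?d ?d" unfolding G_def by (rule mult_carrier_mat[OF ext_B K])
  define E where "E = (0\<^sub>m \<nu> (m - \<nu>) @\<^sub>c 1\<^sub>m \<nu> :: real mat)"
  have E: "E \<in> carrier_mat \<nu> m"
    unfolding E_def using append_cols_carrier[of "0\<^sub>m \<nu> (m - \<nu>) :: real mat" \<nu> "m - \<nu>" "1\<^sub>m \<nu>" \<nu>] \<nu> by simp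
  define H where "H = \<Gamma>\<^sub>2 @\<^sub>c 0\<^sub>m m \<nu>"
  have H: "H \<in> carrier_mat m m"
    unfolding H_def using append_cols_carrier[OF \<Gamma>\<^sub>2 zero_carrier_mat, of \<nu>] \<nu> by simp
  have FC: "F * ?C \<in> carrier_mat ?d ?d" by (rule mult_carrier_mat[OF F ext_C])
  have EK: "- (E * K) \<in> carrier_mat \<nu> ?d" and HK: "- (H * K) \<in> carrier_mat m ?d"
    using E H K by auto
  \<comment> \<open>Blocks for estimate and exchanged variable. Substituting
    \<open>v = - (K *v chi)\<close> puts \<open>- G\<close> here and \<open>- (E * K)\<close>,
    \<open>- (H * K)\<close> into the precompensator and the input.\<close>
  define M1 where "M1 = four_block_mat (?A - F * ?C) (0\<^sub>m ?d ?d) ?A (?A - G)"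
  define A\<^sub>c where "A\<^sub>c = four_block_mat (1\<^sub>m \<nu>) (0\<^sub>m \<nu> ?d @\<^sub>c - (E * K)) (0\<^sub>m (?d + ?d) \<nu>) M1"
  define B\<^sub>c\<^sub>1 where "B\<^sub>c\<^sub>1 = 0\<^sub>m \<nu> p @\<^sub>r (F @\<^sub>r 0\<^sub>m ?d p)"
  define B\<^sub>c\<^sub>2 where "B\<^sub>c\<^sub>2 = 0\<^sub>m \<nu> ?d @\<^sub>r (- G @\<^sub>r - ?A)"
  define F\<^sub>c where "F\<^sub>c = \<Gamma>\<^sub>1 @\<^sub>c (0\<^sub>m m ?d @\<^sub>c - (H * K))"
  define H\<^sub>c :: "real mat" where "H\<^sub>c = 0\<^sub>m ?d \<nu> @\<^sub>c (0\<^sub>m ?d ?d @\<^sub>c 1\<^sub>m ?d)"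
  let ?c = "\<nu> + (?d + ?d)"
  have AF: "?A - F * ?C \<in> carrier_mat ?d ?d" and AG: "?A - G \<in> carrier_mat ?d ?d"
    by (rule minus_carrier_mat[OF FC], rule minus_carrier_mat[OF G])
  have M1: "M1 \<in> carrier_mat (?d + ?d) (?d + ?d)"
    unfolding M1_def by (rule four_block_carrier_mat[OF AF AG])
  have EKc: "0\<^sub>m \<nu> ?d @\<^sub>c - (E * K) \<in> carrier_mat \<nu> (?d + ?d)" by (rule append_cols_carrier[OF zero_carrier_mat EK])
  have HKc: "0\<^sub>m m ?d @\<^sub>c - (H * K) \<in> carrier_mat m (?d + ?d)" by (rule append_cols_carrier[OF zero_carrier_mat HK])
  have Ic: "0\<^sub>m ?d ?d @\<^sub>c 1\<^sub>m ?d \<in> carrier_mat ?d (?d + ?d)"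
    by (rule append_cols_carrier[OF zero_carrier_mat one_carrier_mat])
  have Ac: "A\<^sub>c \<in> carrier_mat ?c ?c" unfolding A\<^sub>c_def by (rule four_block_carrier_mat[OF one_carrier_mat M1])
  have F0: "F @\<^sub>r 0\<^sub>m ?d p \<in> carrier_mat (?d + ?d) p" by (rule carrier_append_rows[OF F zero_carrier_mat])
  have Bc1: "B\<^sub>c\<^sub>1 \<in> carrier_mat ?c p" unfolding B\<^sub>c\<^sub>1_def by (rule carrier_append_rows[OF zero_carrier_mat F0])
  have mG: "- G \<in> carrier_mat ?d ?d" and mA: "- ?A \<in> carrier_mat ?d ?d" using G ext_A by auto
  have GA: "- G @\<^sub>r - ?A \<in> carrier_mat (?d + ?d) ?d" by (rule carrier_append_rows[OF mG mA])
  have Bc2: "B\<^sub>c\<^sub>2 \<in> carrier_mat ?c ?d" unfolding B\<^sub>c\<^sub>2_def by (rule carrier_append_rows[OF zero_carrier_mat GA])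
  have Fc: "F\<^sub>c \<in> carrier_mat m ?c" unfolding F\<^sub>c_def by (rule append_cols_carrier[OF \<Gamma>\<^sub>1 HKc])
  have Hc: "H\<^sub>c \<in> carrier_mat ?d ?c" unfolding H\<^sub>c_def by (rule append_cols_carrier[OF zero_carrier_mat Ic])
  have realize: "\<exists>pc xh v. designed_protocol n m p \<nu> A B C \<Gamma>\<^sub>1 \<Gamma>\<^sub>2 K F N a \<C> \<kappa> y\<^sub>0 u y pc xh \<xi> v"
    if lin: "linear_protocol p ?c ?d A\<^sub>c B\<^sub>c\<^sub>1 B\<^sub>c\<^sub>2 F\<^sub>c H\<^sub>c N a \<C> \<kappa> y\<^sub>0 u y x\<^sub>c \<xi>" for N a \<C> \<kappa> y\<^sub>0 u y x\<^sub>c \<xi>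
  proof -
    let ?\<zeta>' = "\<lambda>i k. network_measurement p N a \<C> \<kappa> (\<lambda>j t. y j t - y\<^sub>0) i k"
    let ?\<zeta> = "\<lambda>i k. network_measurement ?d N a \<C> \<kappa> \<xi> i k"
    have xc: "x\<^sub>c i k \<in> carrier_vec ?c" and \<xi>: "\<xi> i t \<in> carrier_vec ?d"
      and xc_step: "x\<^sub>c i (Suc k) = A\<^sub>c *v x\<^sub>c i k + B\<^sub>c\<^sub>1 *v ?\<zeta>' i k + B\<^sub>c\<^sub>2 *v ?\<zeta> i k"
      and u: "u i k = F\<^sub>c *v x\<^sub>c i k" and \<xi>H: "\<xi> i (int k) = H\<^sub>c *v x\<^sub>c i k"
      if "i \<in> {1..N}" for i k t
      using lin that unfolding linear_protocol_def Let_def by blast+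
    define pc where "pc i k = vec_first (x\<^sub>c i k) \<nu>" for i k
    define xh where "xh i k = vec_first (vec_last (x\<^sub>c i k) (?d + ?d)) ?d" for i k
    define ch where "ch i k = vec_last (vec_last (x\<^sub>c i k) (?d + ?d)) ?d" for i k
    define v where "v i k = - (K *v \<xi> i (int k))" for i k
    have pc: "pc i k \<in> carrier_vec \<nu>" and xh: "xh i k \<in> carrier_vec ?d" and ch: "ch i k \<in> carrier_vec ?d" for i k
      by (simp_all add: pc_def xh_def ch_def)
    have xc_eq: "x\<^sub>c i k = pc i k @\<^sub>v (xh i k @\<^sub>v ch i k)" if "i \<in> {1..N}" for i k
    proof -
      have "vec_last (x\<^sub>c i k) (?d + ?d) = xh i k @\<^sub>v ch i k"
        unfolding xh_def ch_def by (rule vec_first_last_append[symmetric]) simp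
      then show ?thesis unfolding pc_def using vec_first_last_append[OF xc[OF that]] by metis
    qed
    have xch: "xh i k @\<^sub>v ch i k \<in> carrier_vec (?d + ?d)" for i k using xh ch by simp
    have ch\<xi>: "ch i k = \<xi> i (int k)" if i: "i \<in> {1..N}" for i k
      unfolding \<xi>H[OF i] xc_eq[OF i] H\<^sub>c_def projection_append_mult_right[OF Ic pc xch]
        projection_append_mult_right[OF one_carrier_mat xh ch] using ch by simp
    have Kv: "(- (M * K)) *v ch i k = M *v v i k" if i: "i \<in> {1..N}" and M: "M \<in> carrier_mat r m" for i k r M
    proof -
      have Kc: "K *v ch i k \<in> carrier_vec m" by (rule mult_mat_vec_carrier[OF K ch])
      have "(- (M * K)) *v ch i k = - ((M * K) *v ch i k)"
        by (rule uminus_mult_mat_vec) (use carrier_vecD[OF ch, of i k] K in simp)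
      also have "\<dots> = M *v (- (K *v ch i k))"
        unfolding assoc_mult_mat_vec[OF M K ch] by (rule mult_mat_vec_uminus[OF M Kc, symmetric])
      finally show ?thesis unfolding v_def ch\<xi>[OF i] .
    qed
    have \<zeta>c: "?\<zeta> i k \<in> carrier_vec ?d" "?\<zeta>' i k \<in> carrier_vec p" for i k
      by (simp_all add: network_measurement_wsum)
    have "designed_protocol n m p \<nu> A B C \<Gamma>\<^sub>1 \<Gamma>\<^sub>2 K F N a \<C> \<kappa> y\<^sub>0 u y pc xh \<xi> v"
      unfolding designed_protocol_def Let_def
    proof (intro ballI conjI allI)
      fix i k assume i: "i \<in> {1..N}"
      let ?p = "pc i k" and ?x = "xh i k" and ?h = "ch i k" and ?v = "v i k"
      have 1: "A\<^sub>c *v x\<^sub>c i k = (?p + E *v ?v) @\<^sub>v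
          (((?A - F * ?C) *v ?x) @\<^sub>v (?A *v ?x + (?A - G) *v ?h))"
      proof -
        have "A\<^sub>c *v x\<^sub>c i k = (1\<^sub>m \<nu> *v ?p + (0\<^sub>m \<nu> ?d @\<^sub>c - (E * K)) *v (?x @\<^sub>v ?h)) @\<^sub>v
            (0\<^sub>m (?d + ?d) \<nu> *v ?p + M1 *v (?x @\<^sub>v ?h))"
          unfolding A\<^sub>c_def xc_eq[OF i]
          by (rule four_block_mat_mult_vec[OF one_carrier_mat EKc zero_carrier_mat M1 pc xch])
        also have "(0\<^sub>m \<nu> ?d @\<^sub>c - (E * K)) *v (?x @\<^sub>v ?h) = E *v ?v"
          unfolding projection_append_mult_right[OF EK xh ch] by (rule Kv[OF i E])
        also have "M1 *v (?x @\<^sub>v ?h) = ((?A - F * ?C) *v ?x + 0\<^sub>m ?d ?d *v ?h) @\<^sub>v (?A *v ?x + (?A - G) *v ?h)"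
          unfolding M1_def by (rule four_block_mat_mult_vec[OF AF zero_carrier_mat ext_A AG xh ch])
        also have "(?A - F * ?C) *v ?x + 0\<^sub>m ?d ?d *v ?h = (?A - F * ?C) *v ?x"
          unfolding zero_mat_mult_vec[OF ch] by (rule right_zero_vec[OF mult_mat_vec_carrier[OF AF xh]])
        finally show ?thesis
          unfolding zero_mat_mult_vec[OF pc] one_mult_mat_vec[OF pc]
          using left_zero_vec[of "((?A - F * ?C) *v ?x) @\<^sub>v (?A *v ?x + (?A - G) *v ?h)" "?d + ?d"]
            mult_mat_vec_carrier[OF AF xh, of i k] mult_mat_vec_carrier[OF ext_A xh, of i k]
            mult_mat_vec_carrier[OF AG ch, of i k] by (metis add_carrier_vec append_carrier_vec)
      qed
      have 2: "B\<^sub>c\<^sub>1 *v ?\<zeta>' i k = 0\<^sub>v \<nu> @\<^sub>v ((F *v ?\<zeta>' i k) @\<^sub>v 0\<^sub>v ?d)"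
        unfolding B\<^sub>c\<^sub>1_def mat_mult_append[OF zero_carrier_mat F0 \<zeta>c(2)]
          mat_mult_append[OF F zero_carrier_mat \<zeta>c(2)] zero_mat_mult_vec[OF \<zeta>c(2)] ..
      have 3: "B\<^sub>c\<^sub>2 *v ?\<zeta> i k = 0\<^sub>v \<nu> @\<^sub>v ((- (G *v ?\<zeta> i k)) @\<^sub>v (- (?A *v ?\<zeta> i k)))"
        unfolding B\<^sub>c\<^sub>2_def mat_mult_append[OF zero_carrier_mat GA \<zeta>c(1)]
          mat_mult_append[OF mG mA \<zeta>c(1)] zero_mat_mult_vec[OF \<zeta>c(1)]
        using uminus_mult_mat_vec[of "?\<zeta> i k" G] uminus_mult_mat_vec[of "?\<zeta> i k" ?A]
          carrier_vecD[OF \<zeta>c(1)[of i k]] G ext_A by simp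
      have AFx: "(?A - F * ?C) *v ?x = ?A *v ?x - F *v (?C *v ?x)"
        unfolding minus_mult_distrib_mat_vec[OF ext_A FC xh] assoc_mult_mat_vec[OF F ext_C xh] ..
      have AGh: "(?A - G) *v ?h = ?A *v ?h - G *v ?h"
        by (rule minus_mult_distrib_mat_vec[OF ext_A G ch])
      have Gh: "?B *v ?v = - (G *v ?h)"
        unfolding G_def v_def ch\<xi>[OF i] assoc_mult_mat_vec[OF ext_B K \<xi>[OF i]]
        by (rule mult_mat_vec_uminus[OF ext_B mult_mat_vec_carrier[OF K \<xi>[OF i]]])
      have Cx: "?C *v ?x \<in> carrier_vec p" by (rule mult_mat_vec_carrier[OF ext_C xh])
      have Fd: "F *v (?\<zeta>' i k - ?C *v ?x) = F *v ?\<zeta>' i k - F *v (?C *v ?x)"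
        by (rule mult_minus_distrib_mat_vec[OF F \<zeta>c(2) Cx])
      have eqs: "pc i (Suc k) @\<^sub>v (xh i (Suc k) @\<^sub>v ch i (Suc k)) = (?p + E *v ?v) @\<^sub>v
          ((?A *v ?x - G *v ?\<zeta> i k + F *v (?\<zeta>' i k - ?C *v ?x)) @\<^sub>v
           (?A *v ?h + ?B *v ?v + ?A *v ?x - ?A *v ?\<zeta> i k))"
        unfolding xc_eq[OF i, symmetric] xc_step[OF i] 1 2 3 AFx AGh Gh Fd
        using pc[of i k] E G F ext_A by (intro eq_vecI) auto
      have "?v \<in> carrier_vec m"
        unfolding v_def using mult_mat_vec_carrier[OF K \<xi>[OF i]] by simp
      then have c1: "?p + E *v ?v \<in> carrier_vec \<nu>" by (rule add_carrier_vec[OF pc mult_mat_vec_carrier[OF E]])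
      have c2: "?A *v ?x - G *v ?\<zeta> i k + F *v (?\<zeta>' i k - ?C *v ?x) \<in> carrier_vec ?d"
        by (rule add_carrier_vec[OF minus_carrier_vec[OF mult_mat_vec_carrier[OF ext_A xh]
          mult_mat_vec_carrier[OF G \<zeta>c(1)]] mult_mat_vec_carrier[OF F minus_carrier_vec[OF \<zeta>c(2) Cx]]])
      have steps: "pc i (Suc k) = ?p + E *v ?v"
        "xh i (Suc k) = ?A *v ?x - G *v ?\<zeta> i k + F *v (?\<zeta>' i k - ?C *v ?x)"
        "ch i (Suc k) = ?A *v ?h + ?B *v ?v + ?A *v ?x - ?A *v ?\<zeta> i k"
        using eqs unfolding append_vec_eq[OF pc c1] append_vec_eq[OF xh c2] by blast+
      show "pc i k \<in> carrier_vec \<nu>" "xh i k \<in> carrier_vec ?d" by (fact pc xh)+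
      show "\<xi> i t \<in> carrier_vec ?d" for t by (rule \<xi>[OF i])
      show "pc i (Suc k) = ?p + (0\<^sub>m \<nu> (m - \<nu>) @\<^sub>c 1\<^sub>m \<nu>) *v ?v" using steps(1) by (simp add: E_def)
      show "u i k = \<Gamma>\<^sub>1 *v ?p + (\<Gamma>\<^sub>2 @\<^sub>c 0\<^sub>m m \<nu>) *v ?v"
        unfolding u[OF i] xc_eq[OF i] F\<^sub>c_def append_cols_mult_vec[OF \<Gamma>\<^sub>1 HKc pc xch]
          projection_append_mult_right[OF HK xh ch] Kv[OF i H] by (simp add: H_def)
      show "xh i (Suc k) = ?A *v ?x - (?B * K) *v ?\<zeta> i k + F *v (?\<zeta>' i k - ?C *v ?x)"
        using steps(2) by (simp add: G_def)
      show "\<xi> i (int (Suc k)) = ?A *v \<xi> i (int k) + ?B *v ?v + ?A *v ?x - ?A *v ?\<zeta> i k"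
        using steps(3) unfolding ch\<xi>[OF i] .
      show "v i k = - (K *v \<xi> i (int k))" by (rule v_def)
    qed
    then show ?thesis by blast
  qed
  show ?thesis by (rule that[OF Ac Bc1 Bc2 Fc Hc]) (use realize in blast)
qed

end

section \<open>Necessity\<close>

lemma wsum_add:
  assumes "\<And>j. j \<in> I \<Longrightarrow> s j \<in> carrier_vec d" "\<And>j. j \<in> I \<Longrightarrow> s' j \<in> carrier_vec d"
  shows "wsum d I c (\<lambda>j. s j + s' j) = wsum d I c s + wsum d I c s'"
  using carrier_vecD[OF assms(1)] carrier_vecD[OF assms(2)]
  by (intro eq_vecI) (auto simp: wsum_def distrib_left sum.distrib)

lemma wsum_append:
  assumes "\<And>j. j \<in> I \<Longrightarrow> u j \<in> carrier_vec a" "\<And>j. j \<in> I \<Longrightarrow> v j \<in> carrier_vec b"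
  shows "wsum (a + b) I c (\<lambda>j. u j @\<^sub>v v j) = wsum a I c u @\<^sub>v wsum b I c v"
  using carrier_vecD[OF assms(1)] carrier_vecD[OF assms(2)]
  by (intro eq_vecI) (auto simp: wsum_def intro!: sum.cong)

text \<open>Below, \<open>P\<close>, \<open>Q\<close> and \<open>S\<close> combine the plant and an
  arbitrary protocol of one agent into a single system, and \<open>S\<close> outputs
  \<open>y\<close> together with the exchanged variable. There is no delay, so agents and network
  act as commuting operators.\<close>

locale linear_network =
  fixes d r :: nat and P Q S :: "real mat" and I :: "'i set" and W :: "'i \<Rightarrow> 'i \<Rightarrow> real"
  assumes P: "P \<in> carrier_mat d d" and Q: "Q \<in> carrier_mat d r" and S: "S \<in> carrier_mat r d"
begin

definition trajectory :: "real vec \<Rightarrow> ('i \<Rightarrow> nat \<Rightarrow> real vec) \<Rightarrow> bool" where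
  "trajectory \<rho> z \<longleftrightarrow> (\<forall>i\<in>I. \<forall>k. z i k \<in> carrier_vec d \<and>
    z i (Suc k) = P *v z i k + Q *v wsum r I (W i) (\<lambda>j. S *v z j k - \<rho>))"

lemma trajectoryD:
  assumes "trajectory \<rho> z" "i \<in> I"
  shows "z i k \<in> carrier_vec d"
    "z i (Suc k) = P *v z i k + Q *v wsum r I (W i) (\<lambda>j. S *v z j k - \<rho>)"
  using assms unfolding trajectory_def by blast+

text \<open>Solvability speaks about all trajectories and would say nothing without one; the zero
  initial state starts one.\<close>

lemma ex_trajectory: "\<exists>z. trajectory \<rho> z"
proof -
  define z where "z = rec_nat (\<lambda>i::'i. 0\<^sub>v d)
    (\<lambda>k z i. P *v z i + Q *v wsum r I (W i) (\<lambda>j. S *v z j - \<rho>))"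
  have step: "z (Suc k) i = P *v z k i + Q *v wsum r I (W i) (\<lambda>j. S *v z k j - \<rho>)" for k i
    by (simp add: z_def)
  have "z k i \<in> carrier_vec d" for k i
    by (induction k arbitrary: i) (use P Q in \<open>auto simp: step\<close>, simp add: z_def)
  then have "trajectory \<rho> (\<lambda>i k. z k i)" unfolding trajectory_def by (auto simp: step)
  then show ?thesis by blast
qed

text \<open>Increments satisfy the homogeneous dynamics, and identical agents without delays make \<open>W\<close> map
  homogeneous trajectories to homogeneous trajectories.\<close>

lemma trajectory_coupled_increments:
  assumes t: "trajectory \<rho> z" and \<rho>: "\<rho> \<in> carrier_vec r"
  shows "trajectory \<rho> (\<lambda>i k. z i k + wsum d I (W i) (\<lambda>j. z j (Suc k) - z j k))"
proof -
  define e where "e i k = wsum d I (W i) (\<lambda>j. z j (Suc k) - z j k)" for i k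
  define w where "w i k = wsum r I (W i) (\<lambda>j. S *v z j k - \<rho>)" for i k
  note zc = trajectoryD(1)[OF t]
  have dz: "z j (Suc k) - z j k \<in> carrier_vec d" if "j \<in> I" for j k using zc[OF that] by simp
  have ec: "e i k \<in> carrier_vec d" and wc: "w i k \<in> carrier_vec r" for i k by (simp_all add: e_def w_def)
  have Sz: "S *v z j k - \<rho> \<in> carrier_vec r" if "j \<in> I" for j k
    by (rule minus_carrier_vec[OF mult_mat_vec_carrier[OF S zc[OF that]] \<rho>])
  have Se: "S *v e j k \<in> carrier_vec r" for j k by (rule mult_mat_vec_carrier[OF S ec])
  have w_step: "w i (Suc k) - w i k = S *v e i k" for i k
  proof -
    have "w i (Suc k) - w i k = wsum r I (W i) (\<lambda>j. (S *v z j (Suc k) - \<rho>) - (S *v z j k - \<rho>))"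
      unfolding w_def by (rule wsum_diff[OF Sz Sz, symmetric])
    also have "\<dots> = wsum r I (W i) (\<lambda>j. S *v (z j (Suc k) - z j k))"
    proof (rule wsum_cong)
      fix j assume "j \<in> I"
      then show "(S *v z j (Suc k) - \<rho>) - (S *v z j k - \<rho>) = S *v (z j (Suc k) - z j k)"
        using mult_minus_distrib_mat_vec[OF S zc zc] \<rho> S
        by (intro eq_vecI) auto
    qed
    also have "\<dots> = S *v e i k" unfolding e_def by (rule mult_mat_vec_wsum[OF S dz, symmetric])
    finally show ?thesis .
  qed
  have dz_step: "z j (Suc (Suc k)) - z j (Suc k) = P *v (z j (Suc k) - z j k) + Q *v (S *v e j k)"
    if j: "j \<in> I" for j k
  proof -
    have "z j (Suc (Suc k)) - z j (Suc k) = (P *v z j (Suc k) + Q *v w j (Suc k)) - (P *v z j k + Q *v w j k)"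
      unfolding w_def trajectoryD(2)[OF t j, symmetric] ..
    also have "\<dots> = P *v (z j (Suc k) - z j k) + Q *v (w j (Suc k) - w j k)"
      unfolding mult_minus_distrib_mat_vec[OF P zc[OF j] zc[OF j]] mult_minus_distrib_mat_vec[OF Q wc wc]
      using P Q by (intro eq_vecI) auto
    finally show ?thesis unfolding w_step .
  qed
  have e_step: "e i (Suc k) = P *v e i k + Q *v wsum r I (W i) (\<lambda>j. S *v e j k)" for i k
  proof -
    have "e i (Suc k) = wsum d I (W i) (\<lambda>j. P *v (z j (Suc k) - z j k) + Q *v (S *v e j k))"
      unfolding e_def[of i "Suc k"] by (rule wsum_cong) (rule dz_step)
    also have "\<dots> = wsum d I (W i) (\<lambda>j. P *v (z j (Suc k) - z j k)) + wsum d I (W i) (\<lambda>j. Q *v (S *v e j k))"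
      by (rule wsum_add[OF mult_mat_vec_carrier[OF P dz] mult_mat_vec_carrier[OF Q Se]])
    also have "wsum d I (W i) (\<lambda>j. P *v (z j (Suc k) - z j k)) = P *v e i k"
      unfolding e_def by (rule mult_mat_vec_wsum[OF P dz, symmetric])
    also have "wsum d I (W i) (\<lambda>j. Q *v (S *v e j k)) = Q *v wsum r I (W i) (\<lambda>j. S *v e j k)"
      by (rule mult_mat_vec_wsum[OF Q Se, symmetric])
    finally show ?thesis .
  qed
  have "trajectory \<rho> (\<lambda>i k. z i k + e i k)"
    unfolding trajectory_def
  proof (intro ballI allI conjI)
    fix i k assume i: "i \<in> I"
    show "z i k + e i k \<in> carrier_vec d" using zc[OF i] ec by simp
    have "wsum r I (W i) (\<lambda>j. S *v (z j k + e j k) - \<rho>)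
        = wsum r I (W i) (\<lambda>j. (S *v z j k - \<rho>) + S *v e j k)"
    proof (rule wsum_cong)
      fix j assume "j \<in> I"
      then show "S *v (z j k + e j k) - \<rho> = (S *v z j k - \<rho>) + S *v e j k"
        using mult_add_distrib_mat_vec[OF S zc ec] \<rho> S
        by (intro eq_vecI) auto
    qed
    also have "\<dots> = w i k + wsum r I (W i) (\<lambda>j. S *v e j k)" unfolding w_def by (rule wsum_add[OF Sz Se])
    finally have sum: "wsum r I (W i) (\<lambda>j. S *v (z j k + e j k) - \<rho>)
        = w i k + wsum r I (W i) (\<lambda>j. S *v e j k)" .
    show "z i (Suc k) + e i (Suc k) = P *v (z i k + e i k) +
        Q *v wsum r I (W i) (\<lambda>j. S *v (z j k + e j k) - \<rho>)"
      unfolding sum e_step trajectoryD(2)[OF t i, folded w_def] mult_add_distrib_mat_vec[OF P zc[OF i] ec]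
        mult_add_distrib_mat_vec[OF Q wc wsum_carrier]
      using P Q by (intro eq_vecI) auto
  qed
  then show ?thesis by (simp only: e_def)
qed

end

text \<open>Adding the coupled increments \<open>W (x(k+1) - x(k))\<close> to a trajectory gives another trajectory. Where
  the row sums of \<open>W\<close> differ, synchronization of both forces the increments to vanish.\<close>

lemma increments_tendsto_0:
  fixes x :: "'i \<Rightarrow> nat \<Rightarrow> real"
  assumes I: "i \<in> I" "j \<in> I" "finite I"
    and sync: "\<And>i j. i \<in> I \<Longrightarrow> j \<in> I \<Longrightarrow> (\<lambda>k. x i k - x j k) \<longlonglongrightarrow> 0"
    and sync': "(\<lambda>k. (x i k + (\<Sum>l\<in>I. W i l * (x l (Suc k) - x l k))) -
      (x j k + (\<Sum>l\<in>I. W j l * (x l (Suc k) - x l k)))) \<longlonglongrightarrow> 0"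
    and rows: "(\<Sum>l\<in>I. W i l) \<noteq> (\<Sum>l\<in>I. W j l)"
  shows "(\<lambda>k. x i (Suc k) - x i k) \<longlonglongrightarrow> 0"
proof -
  let ?d = "\<lambda>l k. x l (Suc k) - x l k"
  let ?s = "(\<Sum>l\<in>I. W i l) - (\<Sum>l\<in>I. W j l)"
  have d: "(\<lambda>k. ?d l k - ?d i k) \<longlonglongrightarrow> 0" if "l \<in> I" for l
  proof -
    have "(\<lambda>k. (x l (Suc k) - x i (Suc k)) - (x l k - x i k)) \<longlonglongrightarrow> 0 - 0"
      using sync[OF that I(1)] by (intro tendsto_diff LIMSEQ_Suc)
    then show ?thesis by (simp add: algebra_simps)
  qed
  \<comment> \<open>By synchronization all agents have asymptotically the same increment. Replacing
    each by that of \<open>i\<close> leaves the difference of the row sums times this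
    increment.\<close>
  have "(\<lambda>k. ((x i k + (\<Sum>l\<in>I. W i l * ?d l k)) - (x j k + (\<Sum>l\<in>I. W j l * ?d l k))) - (x i k - x j k)
      - (\<Sum>l\<in>I. (W i l - W j l) * (?d l k - ?d i k))) \<longlonglongrightarrow> 0 - 0 - (\<Sum>l\<in>I. (W i l - W j l) * 0)"
    by (intro tendsto_diff tendsto_sum tendsto_mult tendsto_const sync' sync I(1,2) d)
  moreover have "((x i k + (\<Sum>l\<in>I. W i l * ?d l k)) - (x j k + (\<Sum>l\<in>I. W j l * ?d l k))) - (x i k - x j k)
      - (\<Sum>l\<in>I. (W i l - W j l) * (?d l k - ?d i k)) = ?s * ?d i k" for k
  proof -
    have "(\<Sum>l\<in>I. (W i l - W j l) * (?d l k - ?d i k))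
        = (\<Sum>l\<in>I. W i l * ?d l k) - (\<Sum>l\<in>I. W j l * ?d l k) - ?s * ?d i k"
      unfolding left_diff_distrib right_diff_distrib sum_subtractf sum_distrib_right by simp
    then show ?thesis by simp
  qed
  ultimately have "(\<lambda>k. ?s * ?d i k) \<longlonglongrightarrow> 0" by simp
  from tendsto_mult[OF tendsto_const[of "inverse ?s"] this] rows show ?thesis by simp
qed

text \<open>The Laplacian annihilates constant vectors, so only the root indicator survives in the
  row sum.\<close>

lemma sum_coupling:
  assumes "weighted_digraph N a" "i \<in> {1..N}"
  shows "(\<Sum>j=1..N. coupling N a \<C> i j) = (if i \<in> \<C> then 1 / (2 + in_degree N a i) else 0)"
  using sum_expanded_laplacian[OF assms, of \<C> "\<lambda>_. 1"]
  by (simp add: coupling_def flip: sum_divide_distrib)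

text \<open>A root together with one other agent is a tree with a single edge.\<close>

lemma complete_graph_in_graph_set:
  assumes C: "\<C> \<subseteq> {1..N}" "\<C> \<noteq> {}"
  shows "(\<lambda>i j. if i = j then 0 else 1) \<in> graph_set \<C> N"
  unfolding graph_set_def
proof (intro CollectI conjI ballI)
  let ?a = "\<lambda>i j :: nat. if i = j then 0 else 1 :: real"
  show "weighted_digraph N ?a" by (simp add: weighted_digraph_def)
  show "\<C> \<subseteq> {1..N}" by (rule C)
  fix i assume i: "i \<in> {1..N}"
  obtain r where r: "r \<in> \<C>" using C by blast
  show "\<exists>V E r. V \<subseteq> {1..N} \<and> E \<subseteq> edges N ?a \<and> directed_tree V E r \<and> r \<in> \<C> \<and> i \<in> V"
  proof (cases "i = r")
    case True
    have "directed_tree {i} {} i" by (simp add: directed_tree_def)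
    then show ?thesis using r i True by (intro exI[of _ "{i}"] exI[of _ "{}"] exI[of _ i]) simp
  next
    case False
    have "directed_tree {r, i} {(r, i)} r" using False by (auto simp: directed_tree_def)
    then show ?thesis using r i C False
      by (intro exI[of _ "{r, i}"] exI[of _ "{(r, i)}"] exI[of _ r]) (auto simp: edges_def)
  qed
qed

lemma solvable_imp_regulable:
  assumes A: "A \<in> carrier_mat n n" and B: "B \<in> carrier_mat n m" and C: "C \<in> carrier_mat p n"
    and \<C>: "finite \<C>" "\<C> \<noteq> {}" "0 \<notin> \<C>" and yr: "y\<^sub>r \<in> carrier_vec p"
    and solv: "scalable_sync_solvable n m p A B C y\<^sub>r \<C>"
  shows "y\<^sub>r \<in> regulable_outputs n m p A B C"
proof -
  obtain c q A\<^sub>c B\<^sub>c\<^sub>1 B\<^sub>c\<^sub>2 F\<^sub>c H\<^sub>c where mats: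
    "A\<^sub>c \<in> carrier_mat c c" "B\<^sub>c\<^sub>1 \<in> carrier_mat c p" "B\<^sub>c\<^sub>2 \<in> carrier_mat c q"
    "F\<^sub>c \<in> carrier_mat m c" "H\<^sub>c \<in> carrier_mat q c"
    and all: "\<forall>N. \<forall>a \<in> graph_set \<C> N. \<forall>\<kappa>. delays N \<kappa> \<longrightarrow>
      (\<forall>x u y x\<^sub>c \<xi>. agents n m p A B C N x u y \<and>
        linear_protocol p c q A\<^sub>c B\<^sub>c\<^sub>1 B\<^sub>c\<^sub>2 F\<^sub>c H\<^sub>c N a \<C> \<kappa> y\<^sub>r u y x\<^sub>c \<xi> \<longrightarrow> synchronized n p N y\<^sub>r x y)"
    using solv unfolding scalable_sync_solvable_def by blast
  have sync: "synchronized n p N y\<^sub>r x y" if "a \<in> graph_set \<C> N" "delays N \<kappa>" "agents n m p A B C N x u y"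
    "linear_protocol p c q A\<^sub>c B\<^sub>c\<^sub>1 B\<^sub>c\<^sub>2 F\<^sub>c H\<^sub>c N a \<C> \<kappa> y\<^sub>r u y x\<^sub>c \<xi>" for N a \<kappa> x u y x\<^sub>c \<xi>
    using all that by blast
  \<comment> \<open>One agent beyond the largest root, so that agent \<open>N\<close> is not a root
    and its row of \<open>W\<close> sums to 0, unlike that of the root \<open>g\<close>.\<close>
  define N where "N = Suc (Max \<C>)"
  define a :: "nat \<Rightarrow> nat \<Rightarrow> real" where "a = (\<lambda>i j. if i = j then 0 else 1)"
  define W where "W = coupling N a \<C>"
  define g where "g = Max \<C>"
  have sub: "\<C> \<subseteq> {1..g}"
  proof
    fix i assume "i \<in> \<C>"
    then show "i \<in> {1..g}" using \<C> Max_ge[OF \<C>(1)] by (cases i) (auto simp: g_def)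
  qed
  have gC: "g \<in> \<C>" unfolding g_def by (rule Max_in[OF \<C>(1,2)])
  have g: "g \<in> {1..N}" and N: "N \<in> {1..N}" "N \<notin> \<C>" using sub gC by (auto simp: N_def g_def)
  have ag: "a \<in> graph_set \<C> N"
    unfolding a_def
  proof (rule complete_graph_in_graph_set[OF _ \<C>(2)])
    show "\<C> \<subseteq> {1..N}" by (rule subset_trans[OF sub]) (simp add: N_def g_def)
  qed
  have wd: "weighted_digraph N a" using ag by (simp add: graph_set_def)
  define P where "P = four_block_mat A (B * F\<^sub>c) (0\<^sub>m c n) A\<^sub>c"
  define Q where "Q = four_block_mat (0\<^sub>m n p) (0\<^sub>m n q) B\<^sub>c\<^sub>1 B\<^sub>c\<^sub>2"
  define S where "S = four_block_mat C (0\<^sub>m p c) (0\<^sub>m q n) H\<^sub>c"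
  \<comment> \<open>Only the output is compared with a reference, not the exchanged
    variable.\<close>
  let ?\<rho> = "y\<^sub>r @\<^sub>v 0\<^sub>v q"
  interpret linear_network "n + c" "p + q" P Q S "{1..N}" W
    by unfold_locales
      (auto simp: P_def Q_def S_def intro!: four_block_carrier_mat A C mats zero_carrier_mat)
  have sums: "v + 0\<^sub>m r s *v w = v" "0\<^sub>m r s *v w + v = v"
    if "v \<in> carrier_vec r" "w \<in> carrier_vec s" for r s and v w :: "real vec"
    using that by (intro eq_vecI; auto)+
  have steps: "z i k \<in> carrier_vec (n + c)" "x i k \<in> carrier_vec n" "s i k \<in> carrier_vec c"
    "z i k = x i k @\<^sub>v s i k" "x i (Suc k) = A *v x i k + B *v (F\<^sub>c *v s i k)"
    "s i (Suc k) = A\<^sub>c *v s i k + B\<^sub>c\<^sub>1 *v wsum p {1..N} (W i) (\<lambda>j. C *v x j k - y\<^sub>r) +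
      B\<^sub>c\<^sub>2 *v wsum q {1..N} (W i) (\<lambda>j. H\<^sub>c *v s j k)"
    if t: "trajectory ?\<rho> z" and xd: "x = (\<lambda>i k. vec_first (z i k) n)" and sd: "s = (\<lambda>i k. vec_last (z i k) c)"
      and i: "i \<in> {1..N}" for z x s i k
  proof -
    have xc: "x j k \<in> carrier_vec n" and sc: "s j k \<in> carrier_vec c" for j k by (simp_all add: xd sd)
    have zx: "z j k = x j k @\<^sub>v s j k" if "j \<in> {1..N}" for j k
      unfolding xd sd using trajectoryD(1)[OF t that] by simp
    have Fs: "F\<^sub>c *v s j k \<in> carrier_vec m" and Cx: "C *v x j k \<in> carrier_vec p"
      and Hs: "H\<^sub>c *v s j k \<in> carrier_vec q" for j k
      by (rule mult_mat_vec_carrier[OF mats(4) sc] mult_mat_vec_carrier[OF C xc] mult_mat_vec_carrier[OF mats(5) sc])+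
    have Ax: "A *v x j k + B *v (F\<^sub>c *v s j k) \<in> carrier_vec n" for j k
      by (rule add_carrier_vec[OF mult_mat_vec_carrier[OF A xc] mult_mat_vec_carrier[OF B Fs]])
    have Pz: "P *v z i k = (A *v x i k + B *v (F\<^sub>c *v s i k)) @\<^sub>v (A\<^sub>c *v s i k)"
      unfolding P_def zx[OF i] four_block_mat_mult_vec[OF A mult_carrier_mat[OF B mats(4)] zero_carrier_mat mats(1) xc sc]
        assoc_mult_mat_vec[OF B mats(4) sc] sums(2)[OF mult_mat_vec_carrier[OF mats(1) sc] xc] ..
    have Sz: "S *v z j k - ?\<rho> = (C *v x j k - y\<^sub>r) @\<^sub>v (H\<^sub>c *v s j k)" if j: "j \<in> {1..N}" for j
      unfolding S_def zx[OF j] four_block_mat_mult_vec[OF C zero_carrier_mat zero_carrier_mat mats(5) xc sc]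
        sums(1)[OF Cx sc] sums(2)[OF Hs xc] append_vec_minus[OF Cx yr Hs zero_carrier_vec] minus_zero_vec[OF Hs] ..
    let ?a = "wsum p {1..N} (W i) (\<lambda>j. C *v x j k - y\<^sub>r)" and ?b = "wsum q {1..N} (W i) (\<lambda>j. H\<^sub>c *v s j k)"
    have "wsum (p + q) {1..N} (W i) (\<lambda>j. S *v z j k - ?\<rho>)
        = wsum (p + q) {1..N} (W i) (\<lambda>j. (C *v x j k - y\<^sub>r) @\<^sub>v (H\<^sub>c *v s j k))"
      by (rule wsum_cong) (rule Sz)
    also have "\<dots> = ?a @\<^sub>v ?b" by (rule wsum_append[OF minus_carrier_vec[OF Cx yr] Hs])
    finally have w: "wsum (p + q) {1..N} (W i) (\<lambda>j. S *v z j k - ?\<rho>) = ?a @\<^sub>v ?b" .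
    have Qw: "Q *v wsum (p + q) {1..N} (W i) (\<lambda>j. S *v z j k - ?\<rho>)
        = 0\<^sub>v n @\<^sub>v (B\<^sub>c\<^sub>1 *v ?a + B\<^sub>c\<^sub>2 *v ?b)"
    proof -
      have "0\<^sub>m n p *v ?a + 0\<^sub>m n q *v ?b = 0\<^sub>v n" by (intro eq_vecI) auto
      then show ?thesis
        unfolding w Q_def
          four_block_mat_mult_vec[OF zero_carrier_mat zero_carrier_mat mats(2,3) wsum_carrier wsum_carrier] by simp
    qed
    have "x i (Suc k) @\<^sub>v s i (Suc k) = (A *v x i k + B *v (F\<^sub>c *v s i k)) @\<^sub>v
        (A\<^sub>c *v s i k + B\<^sub>c\<^sub>1 *v ?a + B\<^sub>c\<^sub>2 *v ?b)"
      unfolding zx[OF i, symmetric] trajectoryD(2)[OF t i] Pz Qw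
      using Ax[of i k] mats B by (intro eq_vecI) auto
    then show "x i (Suc k) = A *v x i k + B *v (F\<^sub>c *v s i k)"
      "s i (Suc k) = A\<^sub>c *v s i k + B\<^sub>c\<^sub>1 *v ?a + B\<^sub>c\<^sub>2 *v ?b"
      using append_vec_eq[OF xc Ax] by blast+
    show "z i k \<in> carrier_vec (n + c)" "z i k = x i k @\<^sub>v s i k" "x i k \<in> carrier_vec n" "s i k \<in> carrier_vec c"
      by (fact trajectoryD(1)[OF t i] zx[OF i] xc sc)+
  qed
  have traj_sync: "synchronized n p N y\<^sub>r x (\<lambda>i t. C *v x i (nat t))"
    if t: "trajectory ?\<rho> z" and xd: "x = (\<lambda>i k. vec_first (z i k) n)" for z x
  proof (rule sync[OF ag])
    define s where sd: "s = (\<lambda>i k. vec_last (z i k) c)"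
    note st = steps[OF t xd sd]
    let ?y = "\<lambda>i t. C *v x i (nat t)" and ?\<xi> = "\<lambda>i t. H\<^sub>c *v s i (nat t)" and ?u = "\<lambda>i k. F\<^sub>c *v s i k"
    show "delays N (\<lambda>_ _. 0)" by (simp add: delays_def)
    show "agents n m p A B C N x ?u ?y"
      unfolding agents_def nat_int using st(2,3,5) mult_mat_vec_carrier[OF C] mult_mat_vec_carrier[OF mats(4)]
      by blast
    have "network_measurement p N a \<C> (\<lambda>_ _. 0) (\<lambda>j t. ?y j t - y\<^sub>r) i k
        = wsum p {1..N} (W i) (\<lambda>j. C *v x j k - y\<^sub>r)"
      "network_measurement q N a \<C> (\<lambda>_ _. 0) ?\<xi> i k = wsum q {1..N} (W i) (\<lambda>j. H\<^sub>c *v s j k)" for i k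
      by (simp_all add: network_measurement_wsum W_def)
    then show "linear_protocol p c q A\<^sub>c B\<^sub>c\<^sub>1 B\<^sub>c\<^sub>2 F\<^sub>c H\<^sub>c N a \<C> (\<lambda>_ _. 0) y\<^sub>r ?u ?y s ?\<xi>"
      unfolding linear_protocol_def Let_def nat_int
      using st(3,6) mult_mat_vec_carrier[OF mats(5)] by auto
  qed
  obtain z where t: "trajectory ?\<rho> z" using ex_trajectory by blast
  define x where xd: "x = (\<lambda>i k. vec_first (z i k) n)"
  define s where sd: "s = (\<lambda>i k. vec_last (z i k) c)"
  note zc = steps(1)[OF t xd sd] and xc = steps(2)[OF t xd sd] and sc = steps(3)[OF t xd sd]
  have sx: "synchronized n p N y\<^sub>r x (\<lambda>i t. C *v x i (nat t))" by (rule traj_sync[OF t xd])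
  let ?x' = "\<lambda>i k. vec_first (z i k + wsum (n + c) {1..N} (W i) (\<lambda>j. z j (Suc k) - z j k)) n"
  have sx': "synchronized n p N y\<^sub>r ?x' (\<lambda>i t. C *v ?x' i (nat t))"
    by (rule traj_sync[OF trajectory_coupled_increments[OF t] refl]) (use yr in simp)
  have rows: "(\<Sum>j=1..N. W g j) \<noteq> (\<Sum>j=1..N. W N j)"
    unfolding W_def sum_coupling[OF wd g] sum_coupling[OF wd N(1)]
    using gC N(2) in_degree_nonneg[OF wd g] by simp
  have incr: "(\<lambda>k. (x g (Suc k) - x g k) $ l) \<longlonglongrightarrow> 0" if l: "l < n" for l
  proof -
    have comp: "(x i k - x j k) $ l = x i k $ l - x j k $ l" if "j \<in> {1..N}" for i j k
      using xc[OF that, of k] l by simp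
    have zx: "x j k $ l = z j k $ l" for j k using l by (simp add: xd vec_first_def)
    have x': "?x' i k $ l = x i k $ l + (\<Sum>j=1..N. W i j * (x j (Suc k) $ l - x j k $ l))" for i k
    proof -
      have "(z j (Suc k) - z j k) $ l = x j (Suc k) $ l - x j k $ l" if "j \<in> {1..N}" for j
        using zc[OF that, of k] l by (simp add: zx)
      then show ?thesis using l by (auto simp: vec_first_def wsum_def zx intro!: sum.cong)
    qed
    have comp': "(?x' i k - ?x' j k) $ l = ?x' i k $ l - ?x' j k $ l" for i j k using l by simp
    have "(\<lambda>k. x g (Suc k) $ l - x g k $ l) \<longlonglongrightarrow> 0"
    proof (rule increments_tendsto_0[where I = "{1..N}" and W = W and x = "\<lambda>i k. x i k $ l", OF g N(1) _ _ _ rows])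
      fix i j assume ij: "i \<in> {1..N}" "j \<in> {1..N}"
      have "(\<lambda>k. (x i k - x j k) $ l) \<longlonglongrightarrow> 0"
        using sx ij l unfolding synchronized_def tendsto_zero_vec_def by blast
      then show "(\<lambda>k. x i k $ l - x j k $ l) \<longlonglongrightarrow> 0" unfolding comp[OF ij(2)] .
    next
      have "(\<lambda>k. (?x' g k - ?x' N k) $ l) \<longlonglongrightarrow> 0"
        using sx' g N(1) l unfolding synchronized_def tendsto_zero_vec_def by blast
      then show "(\<lambda>k. (x g k $ l + (\<Sum>j=1..N. W g j * (x j (Suc k) $ l - x j k $ l))) -
          (x N k $ l + (\<Sum>j=1..N. W N j * (x j (Suc k) $ l - x j k $ l)))) \<longlonglongrightarrow> 0"
        unfolding comp' x' .
    qed simp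
    moreover have "(x g (Suc k) - x g k) $ l = x g (Suc k) $ l - x g k $ l" for k
      using xc[OF g, of k] l by simp
    ultimately show ?thesis by simp
  qed
  let ?M = "four_block_mat (A - 1\<^sub>m n) B C (0\<^sub>m p m)"
  have M: "?M \<in> carrier_mat (n + p) (n + m)" by (rule regulator_block_carrier[OF A])
  let ?u = "\<lambda>k. F\<^sub>c *v s g k"
  have uc: "?u k \<in> carrier_vec m" for k by (rule mult_mat_vec_carrier[OF mats(4) sc[OF g]])
  have Mz: "?M *v (x g k @\<^sub>v ?u k) = (x g (Suc k) - x g k) @\<^sub>v (C *v x g k)" for k
    unfolding regulator_block_mult[OF A B C xc[OF g] uc] steps(5)[OF t xd sd g] ..
  \<comment> \<open>The limit is a value of the regulator matrix, though the vectors it is applied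
    to need not converge. A preimage is the steady state sought.\<close>
  have "0\<^sub>v n @\<^sub>v y\<^sub>r \<in> mat_image ?M"
  proof (rule mat_image_closed[OF M, of "\<lambda>k. x g k @\<^sub>v ?u k"])
    show "x g k @\<^sub>v ?u k \<in> carrier_vec (n + m)" for k using xc[OF g] uc by simp
    show "0\<^sub>v n @\<^sub>v y\<^sub>r \<in> carrier_vec (n + p)" using yr by simp
    fix l assume l: "l < n + p"
    show "(\<lambda>k. (?M *v (x g k @\<^sub>v ?u k)) $ l) \<longlonglongrightarrow> (0\<^sub>v n @\<^sub>v y\<^sub>r) $ l"
      unfolding Mz
    proof (cases "l < n")
      case True
      have "((x g (Suc k) - x g k) @\<^sub>v (C *v x g k)) $ l = (x g (Suc k) - x g k) $ l" for k
        using True xc[OF g, of k] C by simp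
      then show "(\<lambda>k. ((x g (Suc k) - x g k) @\<^sub>v (C *v x g k)) $ l) \<longlonglongrightarrow> (0\<^sub>v n @\<^sub>v y\<^sub>r) $ l"
        using incr[OF True] True yr by simp
    next
      case False
      then have l': "l - n < p" using l by simp
      have "(\<lambda>k. (C *v x g k - y\<^sub>r) $ (l - n)) \<longlonglongrightarrow> 0"
        using sx g l' unfolding synchronized_def tendsto_zero_vec_def nat_int by blast
      then have "(\<lambda>k. (C *v x g k) $ (l - n) - y\<^sub>r $ (l - n)) \<longlonglongrightarrow> 0" using l' yr by simp
      then have "(\<lambda>k. (C *v x g k) $ (l - n)) \<longlonglongrightarrow> y\<^sub>r $ (l - n)" by (rule LIM_zero_cancel)
      moreover have "((x g (Suc k) - x g k) @\<^sub>v (C *v x g k)) $ l = (C *v x g k) $ (l - n)" for k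
        using False l xc[OF g, of k] C by simp
      ultimately show "(\<lambda>k. ((x g (Suc k) - x g k) @\<^sub>v (C *v x g k)) $ l) \<longlonglongrightarrow> (0\<^sub>v n @\<^sub>v y\<^sub>r) $ l"
        using False l yr by simp
    qed
  qed
  then obtain z where z: "z \<in> carrier_vec (n + m)" "0\<^sub>v n @\<^sub>v y\<^sub>r = ?M *v z"
    using M by (auto simp: mat_image_def)
  obtain x' u' where xu: "x' \<in> carrier_vec n" "u' \<in> carrier_vec m" "z = x' @\<^sub>v u'"
    using z(1) by (elim carrier_vec_splitE)
  have c: "A *v x' + B *v u' \<in> carrier_vec n"
    by (rule add_carrier_vec[OF mult_mat_vec_carrier[OF A xu(1)] mult_mat_vec_carrier[OF B xu(2)]])
  have "0\<^sub>v n @\<^sub>v y\<^sub>r = (A *v x' + B *v u' - x') @\<^sub>v (C *v x')"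
    using z(2) unfolding xu(3) regulator_block_mult[OF A B C xu(1,2)] .
  then have "0\<^sub>v n = A *v x' + B *v u' - x'" "y\<^sub>r = C *v x'"
    using append_vec_eq[OF zero_carrier_vec minus_carrier_vec[OF c xu(1)]] by blast+
  then have "A *v x' + B *v u' = x'" "C *v x' = y\<^sub>r" using minus_eq_0_vec_iff[OF c xu(1)] by metis+
  then show ?thesis unfolding regulable_outputs_def using yr xu by blast
qed

section \<open>Solvability of the design and the steady state of a given output\<close>

lemma ex_design_gains:
  assumes A: "A \<in> carrier_mat n n" and B: "B \<in> carrier_mat n m" and C: "C \<in> carrier_mat p n"
    and stab: "stabilizable n m A B" and detect: "detectable n p A C"
    and ext: "extended_plant n m p \<nu> A B C \<Gamma>\<^sub>1 \<Gamma>\<^sub>2"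
    and inv: "invertible_mat (\<Gamma>\<^sub>1 @\<^sub>c \<Gamma>\<^sub>2)"
    and inj: "\<And>x z. x \<in> carrier_vec n \<Longrightarrow> z \<in> carrier_vec \<nu> \<Longrightarrow>
      A *v x + B *v (\<Gamma>\<^sub>1 *v z) = x \<Longrightarrow> C *v x = 0\<^sub>v p \<Longrightarrow> z = 0\<^sub>v \<nu>"
  shows "\<exists>K F. design_gains n m p \<nu> A B C \<Gamma>\<^sub>1 \<Gamma>\<^sub>2 K F"
proof -
  obtain K0 where K0: "K0 \<in> carrier_mat m n" "schur_stable (A - B * K0)"
    using stab unfolding stabilizable_def by blast
  obtain K where K: "K \<in> carrier_mat m (n + \<nu>)"
    "schur_stable (ext_A n \<nu> A B \<Gamma>\<^sub>1 - ext_B n m \<nu> B \<Gamma>\<^sub>2 * K)"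
    using extended_plant.ext_stabilizable[OF ext K0 inv] .
  obtain F0 where F0: "F0 \<in> carrier_mat n p" "schur_stable (A - F0 * C)"
    using detect unfolding detectable_def by blast
  obtain F where F: "F \<in> carrier_mat (n + \<nu>) p"
    "schur_stable (ext_A n \<nu> A B \<Gamma>\<^sub>1 - F * ext_C p \<nu> C)"
    using extended_plant.ext_detectable[OF ext F0 inj] .
  show ?thesis unfolding design_gains_def using K F by blast
qed

text \<open>The Hautus test at the eigenvalue 1: output injection does not act on a vector with zero
  output.\<close>

lemma detectable_fixpoint:
  assumes A: "A \<in> carrier_mat n n" and C: "C \<in> carrier_mat p n" and detect: "detectable n p A C"
    and x: "x \<in> carrier_vec n" "A *v x = x" "C *v x = 0\<^sub>v p"
  shows "x = 0\<^sub>v n"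
proof -
  obtain F where F: "F \<in> carrier_mat n p" "schur_stable (A - F * C)"
    using detect unfolding detectable_def by blast
  have FC: "F * C \<in> carrier_mat n n" by (rule mult_carrier_mat[OF F(1) C])
  have "(A - F * C) *v x = x"
    unfolding minus_mult_distrib_mat_vec[OF A FC x(1)] assoc_mult_mat_vec[OF F(1) C x(1)] x(2,3)
      mult_mat_vec_0[OF F(1)] using x(1) by simp
  then show ?thesis by (rule schur_stable_fixpoint[OF minus_carrier_mat[OF FC] F(2) x(1)])
qed

text \<open>If \<open>y\<^sub>0 = R *v w\<close>, the regulator equations give the state
  \<open>\<Pi>\<^sub>0 *v w\<close> and the input \<open>\<Gamma> *v w\<close>. The input lies in
  the image of \<open>\<Gamma>\<^sub>1\<close>, so the integrators can hold it.\<close>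

lemma steady_state:
  assumes A: "A \<in> carrier_mat n n" and B: "B \<in> carrier_mat n m" and C: "C \<in> carrier_mat p n"
    and R: "design_R n m p A B C R" and reg: "design_regulator n m p A B C R \<Pi>\<^sub>0 \<Gamma>"
    and inputs: "design_inputs m \<nu> \<Gamma> \<Gamma>\<^sub>1 \<Gamma>\<^sub>2" and y: "y\<^sub>0 \<in> regulable_outputs n m p A B C"
  obtains xr zr where "xr \<in> carrier_vec n" "zr \<in> carrier_vec \<nu>"
    "A *v xr + B *v (\<Gamma>\<^sub>1 *v zr) = xr" "C *v xr = y\<^sub>0"
proof -
  define r where "r = dim_col R"
  have Rc: "R \<in> carrier_mat p r" and RI: "mat_image R = regulable_outputs n m p A B C"
    using R unfolding design_R_def r_def by auto
  have \<Pi>: "\<Pi>\<^sub>0 \<in> carrier_mat n r" and \<Gamma>: "\<Gamma> \<in> carrier_mat m r"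
    and eq: "four_block_mat (A - 1\<^sub>m n) B C (0\<^sub>m p m) * (\<Pi>\<^sub>0 @\<^sub>r \<Gamma>) = 0\<^sub>m n r @\<^sub>r R"
    using reg unfolding design_regulator_def r_def by auto
  have \<Gamma>1: "\<Gamma>\<^sub>1 \<in> carrier_mat m \<nu>" and \<Gamma>I: "mat_image \<Gamma>\<^sub>1 = mat_image \<Gamma>"
    using inputs unfolding design_inputs_def by auto
  obtain w where w: "w \<in> carrier_vec r" "y\<^sub>0 = R *v w"
    using y Rc unfolding RI[symmetric] by (auto simp: mat_image_def)
  let ?x = "\<Pi>\<^sub>0 *v w" and ?u = "\<Gamma> *v w"
  have x: "?x \<in> carrier_vec n" and u: "?u \<in> carrier_vec m"
    using mult_mat_vec_carrier[OF \<Pi> w(1)] mult_mat_vec_carrier[OF \<Gamma> w(1)] by auto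
  have "?u \<in> mat_image \<Gamma>\<^sub>1" unfolding \<Gamma>I using \<Gamma> w(1) by (intro mat_imageI) simp
  then obtain z where z: "z \<in> carrier_vec \<nu>" "?u = \<Gamma>\<^sub>1 *v z" using \<Gamma>1 by (auto simp: mat_image_def)
  let ?M = "four_block_mat (A - 1\<^sub>m n) B C (0\<^sub>m p m)"
  have M: "?M \<in> carrier_mat (n + p) (n + m)" by (rule regulator_block_carrier[OF A])
  have "(A *v ?x + B *v ?u - ?x) @\<^sub>v (C *v ?x) = ?M *v ((\<Pi>\<^sub>0 @\<^sub>r \<Gamma>) *v w)"
    unfolding mat_mult_append[OF \<Pi> \<Gamma> w(1)] by (rule regulator_block_mult[OF A B C x u, symmetric])
  also have "\<dots> = (?M * (\<Pi>\<^sub>0 @\<^sub>r \<Gamma>)) *v w"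
    by (rule assoc_mult_mat_vec[OF M carrier_append_rows[OF \<Pi> \<Gamma>] w(1), symmetric])
  also have "\<dots> = (0\<^sub>m n r *v w) @\<^sub>v y\<^sub>0" unfolding eq w(2) by (rule mat_mult_append[OF zero_carrier_mat Rc w(1)])
  also have "0\<^sub>m n r *v w = 0\<^sub>v n" by (rule zero_mat_mult_vec[OF w(1)])
  finally have eq': "(A *v ?x + B *v ?u - ?x) @\<^sub>v (C *v ?x) = 0\<^sub>v n @\<^sub>v y\<^sub>0" .
  have c: "A *v ?x + B *v ?u \<in> carrier_vec n"
    by (rule add_carrier_vec[OF mult_mat_vec_carrier[OF A x] mult_mat_vec_carrier[OF B u]])
  have "A *v ?x + B *v ?u - ?x = 0\<^sub>v n" "C *v ?x = y\<^sub>0"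
    using eq' append_vec_eq[OF minus_carrier_vec[OF c x] zero_carrier_vec] by blast+
  then have "A *v ?x + B *v (\<Gamma>\<^sub>1 *v z) = ?x" "C *v ?x = y\<^sub>0"
    using minus_eq_0_vec_iff[OF c x] z(2) by auto
  then show ?thesis using that x z(1) by blast
qed

text \<open>The existence claims between the universal ones say that every choice asked for by the
  construction can be made, whatever admissible choices preceded it. The reference
  \<open>y\<^sub>0\<close> is quantified after the gains because one design serves all references.
  The assumptions on \<open>\<C>\<close> make it a set of nodes of some network.\<close>

theorem theorem2:
  fixes n m p :: nat and A B C :: "real mat" and y\<^sub>r :: "real vec" and \<C> :: "nat set"
  assumes "A \<in> carrier_mat n n" and "B \<in> carrier_mat n m" and "C \<in> carrier_mat p n"
    and "stabilizable n m A B" and "detectable n p A C"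
    and "eigenvalues_in_closed_disc A"
    and "finite \<C>" and "\<C> \<noteq> {}" and "0 \<notin> \<C>"
    and "y\<^sub>r \<in> carrier_vec p"
  shows "(scalable_sync_solvable n m p A B C y\<^sub>r \<C> \<longleftrightarrow> y\<^sub>r \<in> regulable_outputs n m p A B C) \<and>
    (\<exists>R. design_R n m p A B C R) \<and>
    (\<forall>R. design_R n m p A B C R \<longrightarrow>
      (\<exists>\<Pi>\<^sub>0 \<Gamma>. design_regulator n m p A B C R \<Pi>\<^sub>0 \<Gamma>) \<and>
      (\<forall>\<Pi>\<^sub>0 \<Gamma> \<nu>. design_regulator n m p A B C R \<Pi>\<^sub>0 \<Gamma> \<and> \<nu> = vec_space.rank m \<Gamma> \<longrightarrow>
        (\<exists>\<Gamma>\<^sub>1 \<Gamma>\<^sub>2. design_inputs m \<nu> \<Gamma> \<Gamma>\<^sub>1 \<Gamma>\<^sub>2) \<and>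
        (\<forall>\<Gamma>\<^sub>1 \<Gamma>\<^sub>2. design_inputs m \<nu> \<Gamma> \<Gamma>\<^sub>1 \<Gamma>\<^sub>2 \<longrightarrow>
          (\<exists>K F. design_gains n m p \<nu> A B C \<Gamma>\<^sub>1 \<Gamma>\<^sub>2 K F) \<and>
          (\<forall>K F. design_gains n m p \<nu> A B C \<Gamma>\<^sub>1 \<Gamma>\<^sub>2 K F \<longrightarrow>
            (\<forall>y\<^sub>0 \<in> regulable_outputs n m p A B C.
              \<forall>N. \<forall>a \<in> graph_set \<C> N. \<forall>\<kappa>. delays N \<kappa> \<longrightarrow>
              (\<forall>x u y pc xh chi v. agents n m p A B C N x u y \<and>
                designed_protocol n m p \<nu> A B C \<Gamma>\<^sub>1 \<Gamma>\<^sub>2 K F N a \<C> \<kappa> y\<^sub>0 u y pc xh chi v \<longrightarrow>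
                synchronized n p N y\<^sub>0 x y))))))"
proof -
  note A = assms(1) and B = assms(2) and C = assms(3)
  note det = detectable_fixpoint[OF A C assms(5)]
  have \<Gamma>c: "\<Gamma> \<in> carrier_mat m (dim_col \<Gamma>)" if "design_regulator n m p A B C R \<Pi>\<^sub>0 \<Gamma>" for R \<Pi>\<^sub>0 \<Gamma>
    using that unfolding design_regulator_def by (metis carrier_matD(2))
  have regulator: "\<exists>\<Pi>\<^sub>0 \<Gamma>. design_regulator n m p A B C R \<Pi>\<^sub>0 \<Gamma>" if "design_R n m p A B C R" for R
    by (rule ex_design_regulator[OF A B C det that])
  have inputs: "\<exists>\<Gamma>\<^sub>1 \<Gamma>\<^sub>2. design_inputs m (vec_space.rank m \<Gamma>) \<Gamma> \<Gamma>\<^sub>1 \<Gamma>\<^sub>2"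
    if "design_regulator n m p A B C R \<Pi>\<^sub>0 \<Gamma>" for R \<Pi>\<^sub>0 \<Gamma>
    by (rule ex_design_inputs[OF \<Gamma>c[OF that]])
  have ext: "extended_plant n m p \<nu> A B C \<Gamma>\<^sub>1 \<Gamma>\<^sub>2" if "design_inputs m \<nu> \<Gamma> \<Gamma>\<^sub>1 \<Gamma>\<^sub>2" for \<nu> \<Gamma> \<Gamma>\<^sub>1 \<Gamma>\<^sub>2
  proof
    have \<Gamma>s: "\<Gamma>\<^sub>1 \<in> carrier_mat m \<nu>" "\<Gamma>\<^sub>2 \<in> carrier_mat m (m - \<nu>)" and inv: "invertible_mat (\<Gamma>\<^sub>1 @\<^sub>c \<Gamma>\<^sub>2)"
      using that unfolding design_inputs_def by auto
    show "\<Gamma>\<^sub>1 \<in> carrier_mat m \<nu>" "\<Gamma>\<^sub>2 \<in> carrier_mat m (m - \<nu>)" by (fact \<Gamma>s)+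
    \<comment> \<open>Invertibility includes squareness; this excludes that the truncated
      subtraction \<open>m - \<nu>\<close> hides a larger \<open>\<nu>\<close>.\<close>
    have "\<nu> + (m - \<nu>) = m"
      using inv append_cols_carrier[OF \<Gamma>s] unfolding invertible_mat_def square_mat.simps by simp
    then show "\<nu> \<le> m" by simp
  qed (fact A B C)+
  have gains: "\<exists>K F. design_gains n m p \<nu> A B C \<Gamma>\<^sub>1 \<Gamma>\<^sub>2 K F"
    if reg: "design_regulator n m p A B C R \<Pi>\<^sub>0 \<Gamma>" and \<nu>: "\<nu> = vec_space.rank m \<Gamma>"
      and inp: "design_inputs m \<nu> \<Gamma> \<Gamma>\<^sub>1 \<Gamma>\<^sub>2" for R \<Pi>\<^sub>0 \<Gamma> \<nu> \<Gamma>\<^sub>1 \<Gamma>\<^sub>2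
  proof (rule ex_design_gains[OF A B C assms(4,5) ext[OF inp]])
    define r where "r = dim_col R"
    have \<Gamma>: "\<Gamma> \<in> carrier_mat m r"
      and rk: "vec_space.rank (n + p) (four_block_mat (A - 1\<^sub>m n) (B * \<Gamma>) C (0\<^sub>m p r)) = n + vec_space.rank m \<Gamma>"
      using reg unfolding design_regulator_def r_def by auto
    have \<Gamma>1: "\<Gamma>\<^sub>1 \<in> carrier_mat m (vec_space.rank m \<Gamma>)" "injective_mat \<Gamma>\<^sub>1" "mat_image \<Gamma>\<^sub>1 = mat_image \<Gamma>"
      and inv: "invertible_mat (\<Gamma>\<^sub>1 @\<^sub>c \<Gamma>\<^sub>2)"
      using inp unfolding design_inputs_def \<nu> by auto
    show "invertible_mat (\<Gamma>\<^sub>1 @\<^sub>c \<Gamma>\<^sub>2)" by (fact inv)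
    show "z = 0\<^sub>v \<nu>" if "x \<in> carrier_vec n" "z \<in> carrier_vec \<nu>"
      "A *v x + B *v (\<Gamma>\<^sub>1 *v z) = x" "C *v x = 0\<^sub>v p" for x z
      using regulator_rank_iff[OF A B C \<Gamma> \<Gamma>1 det] rk that unfolding \<nu> by blast
  qed
  have converge: "synchronized n p N y\<^sub>0 x y"
    if R: "design_R n m p A B C R" and reg: "design_regulator n m p A B C R \<Pi>\<^sub>0 \<Gamma>"
      and inp: "design_inputs m \<nu> \<Gamma> \<Gamma>\<^sub>1 \<Gamma>\<^sub>2" and g: "design_gains n m p \<nu> A B C \<Gamma>\<^sub>1 \<Gamma>\<^sub>2 K F"
      and y0: "y\<^sub>0 \<in> regulable_outputs n m p A B C"
      and a: "a \<in> graph_set \<C> N" and \<kappa>: "delays N \<kappa>" and ag: "agents n m p A B C N x u y"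
      and pr: "designed_protocol n m p \<nu> A B C \<Gamma>\<^sub>1 \<Gamma>\<^sub>2 K F N a \<C> \<kappa> y\<^sub>0 u y pc xh chi v"
    for R \<Pi>\<^sub>0 \<Gamma> \<nu> \<Gamma>\<^sub>1 \<Gamma>\<^sub>2 K F y\<^sub>0 N a \<kappa> x u y pc xh chi v
  proof -
    obtain xr zr where "xr \<in> carrier_vec n" "zr \<in> carrier_vec \<nu>"
      "A *v xr + B *v (\<Gamma>\<^sub>1 *v zr) = xr" "C *v xr = y\<^sub>0"
      using steady_state[OF A B C R reg inp y0] .
    then show ?thesis
      by (rule extended_plant.designed_protocol_synchronized[OF ext[OF inp] assms(6) g _ _ _ _ a \<kappa> ag pr])
  qed
  have "scalable_sync_solvable n m p A B C y\<^sub>r \<C>" if yr: "y\<^sub>r \<in> regulable_outputs n m p A B C"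
  proof -
    obtain R where R: "design_R n m p A B C R" using ex_design_R[OF A B C] by blast
    obtain \<Pi>\<^sub>0 \<Gamma> where reg: "design_regulator n m p A B C R \<Pi>\<^sub>0 \<Gamma>" using regulator[OF R] by blast
    obtain \<Gamma>\<^sub>1 \<Gamma>\<^sub>2 where inp: "design_inputs m (vec_space.rank m \<Gamma>) \<Gamma> \<Gamma>\<^sub>1 \<Gamma>\<^sub>2" using inputs[OF reg] by blast
    obtain K F where g: "design_gains n m p (vec_space.rank m \<Gamma>) A B C \<Gamma>\<^sub>1 \<Gamma>\<^sub>2 K F"
      using gains[OF reg refl inp] by blast
    obtain c q A\<^sub>c B\<^sub>c\<^sub>1 B\<^sub>c\<^sub>2 F\<^sub>c H\<^sub>c where mats:
      "A\<^sub>c \<in> carrier_mat c c" "B\<^sub>c\<^sub>1 \<in> carrier_mat c p" "B\<^sub>c\<^sub>2 \<in> carrier_mat c q"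
      "F\<^sub>c \<in> carrier_mat m c" "H\<^sub>c \<in> carrier_mat q c"
      and lin: "\<forall>N a \<C> \<kappa> y\<^sub>0 u y x\<^sub>c \<xi>. linear_protocol p c q A\<^sub>c B\<^sub>c\<^sub>1 B\<^sub>c\<^sub>2 F\<^sub>c H\<^sub>c N a \<C> \<kappa> y\<^sub>0 u y x\<^sub>c \<xi> \<longrightarrow>
        (\<exists>pc xh v. designed_protocol n m p (vec_space.rank m \<Gamma>) A B C \<Gamma>\<^sub>1 \<Gamma>\<^sub>2 K F N a \<C> \<kappa> y\<^sub>0 u y pc xh \<xi> v)"
      using extended_plant.designed_protocol_linear[OF ext[OF inp] g] .
    have "synchronized n p N y\<^sub>r x y"
      if a: "a \<in> graph_set \<C> N" and \<kappa>: "delays N \<kappa>" and ag: "agents n m p A B C N x u y"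
        and l: "linear_protocol p c q A\<^sub>c B\<^sub>c\<^sub>1 B\<^sub>c\<^sub>2 F\<^sub>c H\<^sub>c N a \<C> \<kappa> y\<^sub>r u y x\<^sub>c \<xi>" for N a \<kappa> x u y x\<^sub>c \<xi>
    proof -
      obtain pc xh v where
        "designed_protocol n m p (vec_space.rank m \<Gamma>) A B C \<Gamma>\<^sub>1 \<Gamma>\<^sub>2 K F N a \<C> \<kappa> y\<^sub>r u y pc xh \<xi> v"
        using lin l by blast
      then show ?thesis by (rule converge[OF R reg inp g yr a \<kappa> ag])
    qed
    note sync = this
    show ?thesis
      unfolding scalable_sync_solvable_def
    proof (intro exI conjI allI ballI impI)
      fix N a \<kappa> x u y x\<^sub>c \<xi>
      assume "a \<in> graph_set \<C> N" "delays N \<kappa>" and "agents n m p A B C N x u y \<and>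
        linear_protocol p c q A\<^sub>c B\<^sub>c\<^sub>1 B\<^sub>c\<^sub>2 F\<^sub>c H\<^sub>c N a \<C> \<kappa> y\<^sub>r u y x\<^sub>c \<xi>"
      then show "synchronized n p N y\<^sub>r x y" by (elim conjE) (rule sync)
    qed (fact mats)+
  qed
  then have iff: "scalable_sync_solvable n m p A B C y\<^sub>r \<C> \<longleftrightarrow> y\<^sub>r \<in> regulable_outputs n m p A B C"
    using solvable_imp_regulable[OF A B C assms(7-10)] by blast
  show ?thesis
  proof (intro conjI allI ballI impI)
    show "scalable_sync_solvable n m p A B C y\<^sub>r \<C> \<longleftrightarrow> y\<^sub>r \<in> regulable_outputs n m p A B C" by (rule iff)
    show "\<exists>R. design_R n m p A B C R" by (rule ex_design_R[OF A B C])
    fix R assume R: "design_R n m p A B C R"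
    show "\<exists>\<Pi>\<^sub>0 \<Gamma>. design_regulator n m p A B C R \<Pi>\<^sub>0 \<Gamma>" by (rule regulator[OF R])
    fix \<Pi>\<^sub>0 \<Gamma> \<nu> assume "design_regulator n m p A B C R \<Pi>\<^sub>0 \<Gamma> \<and> \<nu> = vec_space.rank m \<Gamma>"
    then have reg: "design_regulator n m p A B C R \<Pi>\<^sub>0 \<Gamma>" and \<nu>: "\<nu> = vec_space.rank m \<Gamma>" by auto
    show "\<exists>\<Gamma>\<^sub>1 \<Gamma>\<^sub>2. design_inputs m \<nu> \<Gamma> \<Gamma>\<^sub>1 \<Gamma>\<^sub>2" unfolding \<nu> by (rule inputs[OF reg])
    fix \<Gamma>\<^sub>1 \<Gamma>\<^sub>2 assume inp: "design_inputs m \<nu> \<Gamma> \<Gamma>\<^sub>1 \<Gamma>\<^sub>2"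
    show "\<exists>K F. design_gains n m p \<nu> A B C \<Gamma>\<^sub>1 \<Gamma>\<^sub>2 K F" by (rule gains[OF reg \<nu> inp])
    fix K F y\<^sub>0 N a \<kappa> x u y pc xh chi v
    assume "design_gains n m p \<nu> A B C \<Gamma>\<^sub>1 \<Gamma>\<^sub>2 K F" "y\<^sub>0 \<in> regulable_outputs n m p A B C"
      "a \<in> graph_set \<C> N" "delays N \<kappa>" "agents n m p A B C N x u y \<and>
        designed_protocol n m p \<nu> A B C \<Gamma>\<^sub>1 \<Gamma>\<^sub>2 K F N a \<C> \<kappa> y\<^sub>0 u y pc xh chi v"
    then show "synchronized n p N y\<^sub>0 x y" by (elim conjE) (rule converge[OF R reg inp])
  qed
qed

end
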